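(* Let $p,m,r\ge1$, $\sigma>0$ and $\Sigma\in\mathbb{R}^{p\times p}$ a covariance matrix. Let $\mathcal{A}_r=\{B\in\mathbb{R}^{p\times m}\setminus\{0\}:\mathrm{rank}(B)\le r\}$. For $B\in\mathcal{A}_r$ let $P_B$ be the law of $(X,Y)\in\mathbb{R}^p\times\mathbb{R}^m$ with $X\sim N(0,\Sigma)$, $Y\mid X\sim N(B^TX,\sigma^2I_m)$. For $\epsilon\in[0,1)$ and arbitrary $Q$, let $(X_1,Y_1),\dots,(X_n,Y_n)$ be i.i.d. from $\mathbb{P}_{(\epsilon,B,Q)}=(1-\epsilon)P_B+\epsilon Q$. For $\mathcal{U}\subset\mathbb{R}^{p\times m}\setminus\{0\}$ define $\mathcal{D}_{\mathcal{U}}(B,\mathbb{P})=\inf_{U\in\mathcal{U}}\mathbb{P}\{\langle U^TX,Y-B^TX\rangle\ge0\}$, and let $\widehat B$ be any maximizer over $B\in\mathcal{A}_r$ of $\mathcal{D}_{\mathcal{A}_{2r}}(B,\mathbb{P}_n)$, $\mathbb{P}_n$ the empirical measure. Let $\kappa=\inf_{v\ne0}\|\Sigma^{1/2}v\|/\|v\|$. Then there exist absolute constants $c_0,C,C'>0$ such that whenever $\epsilon^2+\frac{r(p+m)}{n}\le c_0$, $$\mathrm{Tr}\big((\widehat B-B)^T\Sigma(\widehat B-B)\big)\le C\sigma^2\Big(\frac{r(p+m)}{n}\vee\epsilon^2\Big),\quad \|\widehat B-B\|_{\rm F}^2\le C\frac{\sigma^2}{\kappa^2}\Big(\frac{r(p+m)}{n}\vee\epsilon^2\Big),$$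 $$\|\widehat B-B\|_{\rm N}^2\le C\frac{\sigma^2}{\kappa^2}\Big(\frac{r^2(p+m)}{n}\vee r\epsilon^2\Big),$$ with $\mathbb{P}_{(\epsilon,B,Q)}$-probability at least $1-\exp(-C'(r(p+m)+n\epsilon^2))$, uniformly over all $Q$ and $B\in\mathcal{A}_r$.
   Context: $\|\cdot\|_{\rm F}$ Frobenius norm; $\|A\|_{\rm N}$ the nuclear norm (sum of singular values); $a\vee b=\max(a,b)$. *)

theory Defs
  imports "HOL-Probability.Probability" "Jordan_Normal_Form.DL_Rank"
begin

definition mtrace :: "real mat \<Rightarrow> real" where
  "mtrace A = (\<Sum>i<dim_row A. A $$ (i,i))"

definition vnorm :: "real vec \<Rightarrow> real" where
  "vnorm v = sqrt (v \<bullet> v)"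

definition psd_mat :: "nat \<Rightarrow> real mat \<Rightarrow> bool" where
  "psd_mat k A \<longleftrightarrow> A \<in> carrier_mat k k \<and> transpose_mat A = A \<and>
     (\<forall>v\<in>carrier_vec k. 0 \<le> v \<bullet> (A *\<^sub>v v))"

definition psd_sqrt :: "real mat \<Rightarrow> real mat" where
  "psd_sqrt A = (THE S. psd_mat (dim_row A) S \<and> S * S = A)"

definition fro_norm :: "real mat \<Rightarrow> real" where
  "fro_norm A = sqrt (\<Sum>i<dim_row A. \<Sum>j<dim_col A. (A $$ (i,j))\<^sup>2)"

text \<open>nuclear norm = sum of singular values = trace of (A^T A)^(1/2)\<close>
definition nuc_norm :: "real mat \<Rightarrow> real" where
  "nuc_norm A = mtrace (psd_sqrt (transpose_mat A * A))"

definition mrank :: "real mat \<Rightarrow> nat" where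
  "mrank A = vec_space.rank (dim_row A) A"

definition low_rank_set :: "nat \<Rightarrow> nat \<Rightarrow> nat \<Rightarrow> real mat set" where
  "low_rank_set p m r = {B \<in> carrier_mat p m. B \<noteq> 0\<^sub>m p m \<and> mrank B \<le> r}"

definition kappa :: "real mat \<Rightarrow> real" where
  "kappa Sig = (INF v\<in>carrier_vec (dim_row Sig) - {0\<^sub>v (dim_row Sig)}.
                  vnorm (psd_sqrt Sig *\<^sub>v v) / vnorm v)"

text \<open>points of R^p x R^m are pairs of extensional functions on {..<p}, {..<m}\<close>
definition fun_of :: "nat \<Rightarrow> real vec \<Rightarrow> nat \<Rightarrow> real" where
  "fun_of k v = restrict (\<lambda>i. v $ i) {..<k}"

definition eucl :: "nat \<Rightarrow> (nat \<Rightarrow> real) measure" where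
  "eucl k = PiM {..<k} (\<lambda>_. lborel)"

definition pt_space :: "nat \<Rightarrow> nat \<Rightarrow> ((nat \<Rightarrow> real) \<times> (nat \<Rightarrow> real)) measure" where
  "pt_space p m = eucl p \<Otimes>\<^sub>M eucl m"

definition std_gauss :: "nat \<Rightarrow> (nat \<Rightarrow> real) measure" where
  "std_gauss k = PiM {..<k} (\<lambda>_. density lborel std_normal_density)"

text \<open>P_B: law of (X,Y) with X = Sigma^(1/2) Z ~ N(0,Sigma), Y = B^T X + sigma W, Z, W independent standard Gaussian\<close>
definition model_law :: "nat \<Rightarrow> nat \<Rightarrow> real mat \<Rightarrow> real \<Rightarrow> real mat
    \<Rightarrow> ((nat \<Rightarrow> real) \<times> (nat \<Rightarrow> real)) measure" where
  "model_law p m Sig \<sigma> B =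
     distr (std_gauss p \<Otimes>\<^sub>M std_gauss m) (pt_space p m)
       (\<lambda>(z, w). let x = psd_sqrt Sig *\<^sub>v vec p z
                 in (fun_of p x, fun_of m (transpose_mat B *\<^sub>v x + \<sigma> \<cdot>\<^sub>v vec m w)))"

definition contam :: "real \<Rightarrow> 'a measure \<Rightarrow> 'a measure \<Rightarrow> 'a measure" where
  "contam \<epsilon> P Q = measure_of (space P) (sets P)
      (\<lambda>A. ennreal (1 - \<epsilon>) * emeasure P A + ennreal \<epsilon> * emeasure Q A)"

definition emp_depth :: "nat \<Rightarrow> nat \<Rightarrow> nat \<Rightarrow> real mat set \<Rightarrow> real mat
    \<Rightarrow> (nat \<Rightarrow> (nat \<Rightarrow> real) \<times> (nat \<Rightarrow> real)) \<Rightarrow> real" where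
  "emp_depth p m n U B \<omega> =
     (INF V\<in>U. real (card {i\<in>{..<n}.
          0 \<le> (transpose_mat V *\<^sub>v vec p (fst (\<omega> i))) \<bullet>
               (vec m (snd (\<omega> i)) - transpose_mat B *\<^sub>v vec p (fst (\<omega> i)))}) / real n)"

end

theory Submission
  imports Defs
begin

text \<open>
  Put \<open>\<eta>\<^sup>2 = r (p + m) / n + \<epsilon>\<^sup>2\<close>. Whitening turns the depth of a matrix \<open>B'\<close> in a direction \<open>V\<close> into the
  frequency of \<open>\<sigma> \<langle>V\<^sup>T z, w\<rangle> \<ge> \<langle>V\<^sup>T z, \<Delta>\<^sup>T z\<rangle>\<close> for standard Gaussian \<open>z\<close> and \<open>w\<close>, where \<open>\<Delta>\<close> is the whitened
  difference \<open>B' - B\<close>. For \<open>\<Delta> = 0\<close> this event has probability \<open>1/2\<close>. For \<open>V\<close> proportional to \<open>\<Delta>\<close> and normalised it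
  is the event \<open>\<langle>V\<^sup>T z, w\<rangle> \<ge> s \<parallel>V\<^sup>T z\<parallel>\<^sup>2\<close> with \<open>s = \<parallel>\<Delta>\<parallel> / \<sigma>\<close>, which decreases in \<open>s\<close> and whose probability is at most
  \<open>1/2 - s/24\<close> when \<open>s \<le> 1\<close>. If, for \<open>s = 0\<close> and for one fixed \<open>s\<close> of order \<open>\<eta>\<close>, these frequencies exceed their bounds by
  at most \<open>O(\<eta>)\<close> uniformly over all \<open>V\<close> of rank at most \<open>2 r\<close>, then \<open>B\<close> has depth at least \<open>1/2 - O(\<eta>)\<close>, while a matrix
  at distance more than a large multiple of \<open>\<sigma> \<eta>\<close> has smaller depth in the direction of its difference to \<open>B\<close>.

  Uniformity comes from dyadic chaining along nets obtained by rounding the factors of a singular value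
  decomposition, which have \<open>exp (O(r (p + m)) j)\<close> elements at scale \<open>2\<^sup>-\<^sup>j\<close>. The chain stops at scale \<open>\<eta>\<close>, where the
  remaining error is the frequency of a small ball event plus a first-moment bound for the bilinear form; the latter is uniform
  by a net of constant scale and self-similarity, so no logarithmic factor arises. Every
  bound used is an exponential-moment test for a sum over the uncontaminated indices, whence contamination costs only the
  number of contaminated indices, which is binomial.
\<close>

section \<open>Exponential tests under contamination\<close>

text \<open>\<open>Bhat\<close> is an arbitrary selection and a supremum over directions need not be
  measurable, so no probability is ever assigned to either: the good event is cut out by finitely
  many tests, chosen without reference to \<open>Bhat\<close>, and every uniform statement is a
  deterministic consequence of them (\<open>ensured\<close>). This also lets the set of contaminated
  indices be fixed after sampling. \<open>Sig\<close> may be singular, so the latent Gaussian vector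
  cannot be recovered from the data; nets live on the images under the root of \<open>Sig\<close>,
  which keeps the constants free of \<open>Sig\<close>, and a direction is evaluated on the data
  through any preimage. The obstacle to self-similarity is that bounded rank is not preserved by
  sums: the difference of two nearby matrices has up to twice the rank. A difference of products is
  therefore split into two summands of the original rank, each a rescaled member of the class
  (\<open>lowclass_cover\<close>), so that a supremum over the class is bounded by a net value plus
  a fraction of itself (\<open>bootstrap_bound\<close>). Two fixed shifts suffice because
  normalising a longer difference only shrinks the halfspace event.\<close>

lemma chernoff_PiM:
  fixes \<xi> :: "'a \<Rightarrow> real"
  assumes M: "prob_space M" and \<xi>[measurable]: "\<xi> \<in> borel_measurable M" and l: "0 < l"
    and mgf: "(\<integral>\<^sup>+x. ennreal (exp (l * \<xi> x)) \<partial>M) \<le> ennreal (exp \<kappa>)"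
  shows "measure (PiM {..<n} (\<lambda>_. M)) {\<omega>\<in>space (PiM {..<n} (\<lambda>_. M)). c < (\<Sum>i<n. \<xi> (\<omega> i))}
    \<le> exp (real n * \<kappa> - l * c)"
proof -
  interpret M: prob_space M by fact
  interpret product_prob_space "\<lambda>_. M" "{..<n}" by unfold_locales
  let ?L = "PiM {..<n} (\<lambda>_. M)"
  let ?A = "{\<omega>\<in>space ?L. c < (\<Sum>i<n. \<xi> (\<omega> i))}"
  have [measurable]: "?A \<in> sets ?L" by measurable
  have "emeasure ?L ?A = (\<integral>\<^sup>+\<omega>. indicator ?A \<omega> \<partial>?L)" by simp
  also have "\<dots> \<le> (\<integral>\<^sup>+\<omega>. ennreal (exp (- l * c)) * (\<Prod>i<n. ennreal (exp (l * \<xi> (\<omega> i)))) \<partial>?L)"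
  proof (rule nn_integral_mono)
    fix \<omega> assume "\<omega> \<in> space ?L"
    have eq: "ennreal (exp (- l * c)) * (\<Prod>i<n. ennreal (exp (l * \<xi> (\<omega> i)))) = ennreal (exp (l * ((\<Sum>i<n. \<xi> (\<omega> i)) - c)))"
      by (simp add: prod_ennreal exp_sum[symmetric] sum_distrib_left[symmetric] ennreal_mult'[symmetric]
        mult_exp_exp algebra_simps)
    show "indicator ?A \<omega> \<le> ennreal (exp (- l * c)) * (\<Prod>i<n. ennreal (exp (l * \<xi> (\<omega> i))))"
      unfolding eq using l by (auto simp: indicator_def)
  qed
  also have "\<dots> = ennreal (exp (- l * c)) * (\<Prod>i<n. \<integral>\<^sup>+x. ennreal (exp (l * \<xi> x)) \<partial>M)"
    by (subst nn_integral_cmult, measurable, subst product_nn_integral_prod) auto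
  also have "\<dots> \<le> ennreal (exp (- l * c)) * (\<Prod>i<n. ennreal (exp \<kappa>))"
    by (intro mult_left_mono prod_mono_ennreal mgf) auto
  also have "\<dots> = ennreal (exp (real n * \<kappa> - l * c))"
    by (simp add: ennreal_mult'[symmetric] exp_of_nat_mult[symmetric] mult_exp_exp ennreal_power algebra_simps)
  finally show ?thesis
    by (simp add: emeasure_eq_measure)
qed

section \<open>Contaminated laws as a coupling with hidden labels\<close>

lemma sets_contam [simp]: "sets (contam \<epsilon> P Q) = sets P"
  and space_contam [simp]: "space (contam \<epsilon> P Q) = space P"
  by (auto simp: contam_def sets.space_closed sets.sigma_sets_eq space_measure_of_conv)

text \<open>Each observation carries a Bernoulli label and an independent draw from both laws.
  Keeping the clean draw even when the label hides it makes the contaminated law an image of a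
  product measure, so moments of clean functions are computed separately from the label.\<close>

definition mixture_label :: "real \<Rightarrow> 'a measure \<Rightarrow> 'a measure \<Rightarrow> (bool \<times> 'a \<times> 'a) measure" where
  "mixture_label \<epsilon> P Q = measure_pmf (bernoulli_pmf \<epsilon>) \<Otimes>\<^sub>M (P \<Otimes>\<^sub>M Q)"

definition observe :: "bool \<times> 'a \<times> 'a \<Rightarrow> 'a" where
  "observe u = (if fst u then snd (snd u) else fst (snd u))"

context
  fixes P Q :: "'a measure" and \<epsilon> :: real
  assumes P: "prob_space P" and Q: "prob_space Q" and PQ: "sets Q = sets P"
    and e0: "0 \<le> \<epsilon>" and e1: "\<epsilon> < 1"
begin

interpretation P: prob_space P by (rule P)
interpretation Q: prob_space Q by (rule Q)
interpretation PQ: pair_prob_space P Q ..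
interpretation B: pair_prob_space "measure_pmf (bernoulli_pmf \<epsilon>)" "P \<Otimes>\<^sub>M Q" ..

lemma prob_space_mixture_label: "prob_space (mixture_label \<epsilon> P Q)"
  unfolding mixture_label_def by unfold_locales

lemma nn_integral_mixture_label:
  assumes f[measurable]: "f \<in> borel_measurable (mixture_label \<epsilon> P Q)"
  shows "(\<integral>\<^sup>+u. f u \<partial>mixture_label \<epsilon> P Q) =
    ennreal (1 - \<epsilon>) * (\<integral>\<^sup>+x. \<integral>\<^sup>+y. f (False, x, y) \<partial>Q \<partial>P) + ennreal \<epsilon> * (\<integral>\<^sup>+x. \<integral>\<^sup>+y. f (True, x, y) \<partial>Q \<partial>P)"
proof -
  have [measurable]: "f \<in> borel_measurable (measure_pmf (bernoulli_pmf \<epsilon>) \<Otimes>\<^sub>M (P \<Otimes>\<^sub>M Q))"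
    using f by (simp add: mixture_label_def)
  have "(\<integral>\<^sup>+u. f u \<partial>mixture_label \<epsilon> P Q) = (\<integral>\<^sup>+b. \<integral>\<^sup>+v. f (b, v) \<partial>(P \<Otimes>\<^sub>M Q) \<partial>measure_pmf (bernoulli_pmf \<epsilon>))"
    unfolding mixture_label_def by (subst PQ.nn_integral_fst[symmetric]) auto
  also have "\<dots> = (\<integral>\<^sup>+b. (\<integral>\<^sup>+x. \<integral>\<^sup>+y. f (b, x, y) \<partial>Q \<partial>P) \<partial>measure_pmf (bernoulli_pmf \<epsilon>))"
    by (subst Q.nn_integral_fst[symmetric]) auto
  finally show ?thesis using e0 e1
    by (simp add: nn_integral_bernoulli_pmf mult.commute add.commute)
qed

lemma observe_measurable [measurable]: "observe \<in> mixture_label \<epsilon> P Q \<rightarrow>\<^sub>M P"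
proof -
  have [measurable_cong]: "sets Q = sets P" by (rule PQ)
  show ?thesis unfolding observe_def[abs_def] mixture_label_def by measurable
qed

lemma contam_eq_distr: "contam \<epsilon> P Q = distr (mixture_label \<epsilon> P Q) P observe"
proof -
  let ?D = "distr (mixture_label \<epsilon> P Q) P observe"
  have *: "emeasure ?D A = ennreal (1 - \<epsilon>) * emeasure P A + ennreal \<epsilon> * emeasure Q A" if A[measurable]: "A \<in> sets P" for A
  proof -
    have [measurable]: "A \<in> sets Q" using PQ by simp
    have "emeasure ?D A = (\<integral>\<^sup>+x. indicator A x \<partial>?D)" by simp
    also have "\<dots> = (\<integral>\<^sup>+u. indicator A (observe u) \<partial>mixture_label \<epsilon> P Q)"
      by (subst nn_integral_distr) auto
    also have "\<dots> = ennreal (1 - \<epsilon>) * emeasure P A + ennreal \<epsilon> * emeasure Q A"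
      by (subst nn_integral_mixture_label, measurable) (auto simp: observe_def P.emeasure_space_1 Q.emeasure_space_1)
    finally show ?thesis .
  qed
  have "contam \<epsilon> P Q = measure_of (space P) (sets P) (emeasure ?D)"
    unfolding contam_def
    by (rule measure_of_eq) (auto simp: sets.space_closed sets.sigma_sets_eq *)
  also have "\<dots> = ?D" using measure_of_of_measure[of ?D] by simp
  finally show ?thesis .
qed

lemma PiM_contam_eq:
  "PiM {..<n::nat} (\<lambda>_. contam \<epsilon> P Q) =
    distr (PiM {..<n} (\<lambda>_. mixture_label \<epsilon> P Q)) (PiM {..<n} (\<lambda>_. P)) (compose {..<n} observe)"
  unfolding contam_eq_distr
  by (rule distr_PiM_finite_prob_space[symmetric])
    (auto intro!: product_prob_spaceI P prob_space_mixture_label)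

lemma bernoulli_mgf_le:
  assumes "0 < l" "l \<le> 1"
  shows "(\<integral>\<^sup>+u. ennreal (exp (l * of_bool (fst u))) \<partial>mixture_label \<epsilon> P Q) \<le> ennreal (exp (\<epsilon> * (l + l\<^sup>2)))"
proof -
  have "(\<integral>\<^sup>+u. ennreal (exp (l * of_bool (fst u))) \<partial>mixture_label \<epsilon> P Q) = ennreal ((1 - \<epsilon>) + \<epsilon> * exp l)"
    using e0 e1
    by (subst nn_integral_mixture_label)
      (auto simp: mixture_label_def P.emeasure_space_1 Q.emeasure_space_1 ennreal_mult'[symmetric] ennreal_plus[symmetric] simp del: ennreal_plus)
  \<comment> \<open>The restriction \<open>l \<le> 1\<close> enters through
    \<open>exp l \<le> 1 + l + l\<^sup>2\<close>.\<close>
  also have "(1 - \<epsilon>) + \<epsilon> * exp l \<le> 1 + \<epsilon> * (l + l\<^sup>2)"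
    using exp_bound[of l] assms e0 mult_left_mono[of "exp l" "1 + l + l\<^sup>2" \<epsilon>] by (simp add: algebra_simps)
  also have "\<dots> \<le> exp (\<epsilon> * (l + l\<^sup>2))" by (rule exp_ge_add_one_self)
  finally show ?thesis by (simp add: ennreal_leI)
qed

lemma masked_mgf_le:
  assumes \<psi>[measurable]: "\<psi> \<in> borel_measurable P" and k: "0 \<le> \<kappa>"
    and mgf: "(\<integral>\<^sup>+x. ennreal (exp (l * \<psi> x)) \<partial>P) \<le> ennreal (exp \<kappa>)"
  shows "(\<integral>\<^sup>+u. ennreal (exp (l * (if fst u then 0 else \<psi> (fst (snd u))))) \<partial>mixture_label \<epsilon> P Q) \<le> ennreal (exp \<kappa>)"
proof -
  have "(\<integral>\<^sup>+u. ennreal (exp (l * (if fst u then 0 else \<psi> (fst (snd u))))) \<partial>mixture_label \<epsilon> P Q)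
    = ennreal (1 - \<epsilon>) * (\<integral>\<^sup>+x. ennreal (exp (l * \<psi> x)) \<partial>P) + ennreal \<epsilon>"
    by (subst nn_integral_mixture_label)
      (auto simp: mixture_label_def P.emeasure_space_1 Q.emeasure_space_1)
  \<comment> \<open>A hidden draw contributes the factor 1, which is at most
    \<open>exp \<kappa>\<close> because \<open>0 \<le> \<kappa>\<close>. This is why the tests below
    carry a nonnegative exponent.\<close>
  also have "\<dots> \<le> ennreal (1 - \<epsilon>) * ennreal (exp \<kappa>) + ennreal \<epsilon> * ennreal (exp \<kappa>)"
    using mgf k e0 mult_left_mono[of 1 "exp \<kappa>" \<epsilon>]
    by (intro add_mono mult_left_mono) (auto simp: ennreal_mult'[symmetric])
  also have "\<dots> = ennreal (exp \<kappa>)"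
    using e0 e1 by (simp add: ennreal_mult'[symmetric] ennreal_plus[symmetric] algebra_simps del: ennreal_plus)
  finally show ?thesis .
qed

end

section \<open>Finite families of exponential tests\<close>

definition chernoff_test :: "'a measure \<Rightarrow> nat \<Rightarrow> ('a \<Rightarrow> real) \<Rightarrow> real \<Rightarrow> real \<Rightarrow> bool" where
  "chernoff_test P n \<psi> c q \<longleftrightarrow> \<psi> \<in> borel_measurable P \<and>
    (\<exists>l>0. \<exists>\<kappa>\<ge>0. (\<integral>\<^sup>+x. ennreal (exp (l * \<psi> x)) \<partial>P) \<le> ennreal (exp \<kappa>) \<and> exp (real n * \<kappa> - l * c) \<le> q)"

text \<open>The failure weights of the tests add up to at most \<open>q\<close>, and
  \<open>R\<close> follows from them sample by sample. Nothing asks \<open>R\<close> to be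
  measurable, so it may quantify over uncountably many directions; \<open>S\<close> is universally
  quantified so that the discarded indices can be chosen after sampling.\<close>

definition ensured :: "'a measure \<Rightarrow> nat \<Rightarrow> real \<Rightarrow> (nat set \<Rightarrow> (nat \<Rightarrow> 'a) \<Rightarrow> bool) \<Rightarrow> bool" where
  "ensured P n q R \<longleftrightarrow> (\<exists>X. finite X \<and> (\<forall>(\<psi>, c, w)\<in>X. chernoff_test P n \<psi> c w) \<and> (\<Sum>(\<psi>, c, w)\<in>X. w) \<le> q \<and>
    (\<forall>S \<omega>. (\<forall>i<n. \<omega> i \<in> space P) \<longrightarrow> (\<forall>(\<psi>, c, w)\<in>X. (\<Sum>i\<in>{..<n} - S. \<psi> (\<omega> i)) \<le> c) \<longrightarrow> R S \<omega>))"

lemma chernoff_test_nonneg: "chernoff_test P n \<psi> c q \<Longrightarrow> 0 \<le> q"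
  unfolding chernoff_test_def by (meson exp_ge_zero order_trans)

lemma chernoff_testD:
  "chernoff_test P n \<psi> c q \<Longrightarrow> ensured P n q (\<lambda>S \<omega>. (\<Sum>i\<in>{..<n} - S. \<psi> (\<omega> i)) \<le> c)"
  unfolding ensured_def by (rule exI[of _ "{(\<psi>, c, q)}"]) auto

lemma ensured_mono:
  assumes e: "ensured P n q R" and q: "q \<le> q'"
    and R: "\<And>S \<omega>. \<forall>i<n. \<omega> i \<in> space P \<Longrightarrow> R S \<omega> \<Longrightarrow> R' S \<omega>"
  shows "ensured P n q' R'"
proof -
  obtain X where X: "finite X" "\<forall>(\<psi>, c, w)\<in>X. chernoff_test P n \<psi> c w" "(\<Sum>(\<psi>, c, w)\<in>X. w) \<le> q"
    and imp: "\<forall>S \<omega>. (\<forall>i<n. \<omega> i \<in> space P) \<longrightarrow> (\<forall>(\<psi>, c, w)\<in>X. (\<Sum>i\<in>{..<n} - S. \<psi> (\<omega> i)) \<le> c) \<longrightarrow> R S \<omega>"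
    using e unfolding ensured_def by (elim exE conjE)
  show ?thesis unfolding ensured_def
  proof (intro exI[of _ X] conjI allI impI)
    show "(\<Sum>(\<psi>, c, w)\<in>X. w) \<le> q'" using X(3) q by (rule order_trans)
  next
    fix S \<omega> assume \<omega>: "\<forall>i<n. \<omega> i \<in> space P" and c: "\<forall>(\<psi>, c, w)\<in>X. (\<Sum>i\<in>{..<n} - S. \<psi> (\<omega> i)) \<le> c"
    show "R' S \<omega>" by (rule R[OF \<omega> imp[THEN spec, THEN spec, THEN mp, OF \<omega>, THEN mp, OF c]])
  qed (fact X)+
qed

lemma ensured_conj:
  assumes "ensured P n q R" "ensured P n q' R'"
  shows "ensured P n (q + q') (\<lambda>S \<omega>. R S \<omega> \<and> R' S \<omega>)"
proof -
  obtain X where X: "finite X" "\<forall>(\<psi>, c, w)\<in>X. chernoff_test P n \<psi> c w" "(\<Sum>(\<psi>, c, w)\<in>X. w) \<le> q"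
    "\<forall>S \<omega>. (\<forall>i<n. \<omega> i \<in> space P) \<longrightarrow> (\<forall>(\<psi>, c, w)\<in>X. (\<Sum>i\<in>{..<n} - S. \<psi> (\<omega> i)) \<le> c) \<longrightarrow> R S \<omega>"
    using assms(1) unfolding ensured_def by blast
  obtain Y where Y: "finite Y" "\<forall>(\<psi>, c, w)\<in>Y. chernoff_test P n \<psi> c w" "(\<Sum>(\<psi>, c, w)\<in>Y. w) \<le> q'"
    "\<forall>S \<omega>. (\<forall>i<n. \<omega> i \<in> space P) \<longrightarrow> (\<forall>(\<psi>, c, w)\<in>Y. (\<Sum>i\<in>{..<n} - S. \<psi> (\<omega> i)) \<le> c) \<longrightarrow> R' S \<omega>"
    using assms(2) unfolding ensured_def by blast
  \<comment> \<open>Tests common to both families are counted once in the union, which only lowers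
    the total because weights are nonnegative.\<close>
  have "0 \<le> (\<Sum>(\<psi>, c, w)\<in>X \<inter> Y. w)"
    using X(2) by (intro sum_nonneg) (auto dest!: chernoff_test_nonneg)
  moreover have "(\<Sum>(\<psi>, c, w)\<in>X \<union> Y. w) = (\<Sum>(\<psi>, c, w)\<in>X. w) + (\<Sum>(\<psi>, c, w)\<in>Y. w) - (\<Sum>(\<psi>, c, w)\<in>X \<inter> Y. w)"
    using X(1) Y(1) by (rule sum_Un)
  ultimately have "(\<Sum>(\<psi>, c, w)\<in>X \<union> Y. w) \<le> q + q'" using X(3) Y(3) by linarith
  moreover have "\<forall>S \<omega>. (\<forall>i<n. \<omega> i \<in> space P) \<longrightarrow>
      (\<forall>(\<psi>, c, w)\<in>X \<union> Y. (\<Sum>i\<in>{..<n} - S. \<psi> (\<omega> i)) \<le> c) \<longrightarrow> R S \<omega> \<and> R' S \<omega>"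
    using X(4) Y(4) by blast
  ultimately show ?thesis
    unfolding ensured_def using X(1,2) Y(1,2) by (intro exI[of _ "X \<union> Y"]) blast
qed

lemma ensured_True: "ensured P n 0 (\<lambda>S \<omega>. True)"
  unfolding ensured_def by (rule exI[of _ "{}"]) auto

lemma ensured_ball:
  assumes "finite I" "\<And>a. a \<in> I \<Longrightarrow> ensured P n (q a) (R a)"
  shows "ensured P n (\<Sum>a\<in>I. q a) (\<lambda>S \<omega>. \<forall>a\<in>I. R a S \<omega>)"
  using assms
proof (induction I rule: finite_induct)
  case empty
  then show ?case using ensured_True by simp
next
  case (insert a I)
  have "ensured P n (q a + (\<Sum>a\<in>I. q a)) (\<lambda>S \<omega>. R a S \<omega> \<and> (\<forall>a\<in>I. R a S \<omega>))"
    using insert by (intro ensured_conj) auto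
  then show ?case using insert(1,2) by simp
qed

text \<open>An almost sure property is a test like any other: the indicator of its failure has
  exponential moment 1 at every rate, so a rate of order \<open>1 + \<bar>ln q\<bar>\<close> pushes
  the bound at threshold 1/2 below any positive \<open>q\<close>, and an integer count below 1/2 is
  0.\<close>

lemma ensured_AE:
  assumes P: "prob_space P" and A[measurable]: "Measurable.pred P A" and AE: "AE x in P. A x" and q: "0 < q"
  shows "ensured P n q (\<lambda>S \<omega>. \<forall>i\<in>{..<n} - S. A (\<omega> i))"
proof -
  interpret prob_space P by fact
  let ?\<psi> = "\<lambda>x. of_bool (\<not> A x) :: real"
  define l where "l = 2 * (1 + \<bar>ln q\<bar>)"
  have "(\<integral>\<^sup>+x. ennreal (exp (l * ?\<psi> x)) \<partial>P) = (\<integral>\<^sup>+x. 1 \<partial>P)"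
    by (rule nn_integral_cong_AE) (use AE in auto)
  then have 1: "(\<integral>\<^sup>+x. ennreal (exp (l * ?\<psi> x)) \<partial>P) \<le> ennreal (exp 0)" by (simp add: emeasure_space_1)
  have "- l * (1/2) \<le> ln q" unfolding l_def by simp
  then have 2: "exp (real n * 0 - l * (1/2)) \<le> q" using q by (simp add: ln_ge_iff)
  have "chernoff_test P n ?\<psi> (1/2) q"
    unfolding chernoff_test_def using 1 2 by (intro conjI exI[of _ l] exI[of _ 0]) (auto simp: l_def)
  from chernoff_testD[OF this] show ?thesis
  proof (rule ensured_mono)
    fix S :: "nat set" and \<omega> :: "nat \<Rightarrow> 'a"
    assume le: "(\<Sum>i\<in>{..<n} - S. ?\<psi> (\<omega> i)) \<le> 1 / 2"
    show "\<forall>i\<in>{..<n} - S. A (\<omega> i)"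
    proof (rule ccontr)
      assume "\<not> ?thesis"
      then obtain i where "i \<in> {..<n} - S" "\<not> A (\<omega> i)" by auto
      then have "1 \<le> (\<Sum>i\<in>{..<n} - S. ?\<psi> (\<omega> i))"
        using member_le_sum[of i "{..<n} - S" "\<lambda>i. ?\<psi> (\<omega> i)"] by simp
      then show False using le by simp
    qed
  qed simp
qed

text \<open>A union over the possible sets \<open>S\<close> of contaminated indices makes the event measurable without
  reference to the (unobserved) labels.\<close>

lemma ensured_contam:
  assumes P: "prob_space P" and Q: "prob_space Q" and PQ: "sets Q = sets P"
    and e0: "0 \<le> \<epsilon>" and e1: "\<epsilon> < 1" and l: "0 < l" "l \<le> 1"
    and R: "ensured P n q R"
  shows "\<exists>E\<in>sets (PiM {..<n} (\<lambda>_. contam \<epsilon> P Q)).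
    measure (PiM {..<n} (\<lambda>_. contam \<epsilon> P Q)) E \<ge> 1 - (q + exp (real n * (\<epsilon> * (l + l\<^sup>2)) - l * k)) \<and>
    (\<forall>\<omega>\<in>E. \<exists>S\<subseteq>{..<n}. real (card S) \<le> k \<and> R S \<omega>)"
proof -
  note ctx = P Q PQ e0 e1
  let ?B = "mixture_label \<epsilon> P Q" and ?C = "PiM {..<n} (\<lambda>_. contam \<epsilon> P Q)"
  let ?L = "PiM {..<n} (\<lambda>_. ?B)" and ?P = "PiM {..<n} (\<lambda>_. P)" and ?T = "compose {..<n} observe"
  interpret B: prob_space ?B by (rule prob_space_mixture_label[OF ctx])
  interpret L: product_prob_space "\<lambda>_. ?B" "{..<n}" by unfold_locales
  interpret P: prob_space P by fact
  have [measurable]: "?T \<in> ?L \<rightarrow>\<^sub>M ?P"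
    using observe_measurable[OF ctx] unfolding compose_def by measurable
  have [measurable]: "observe \<in> ?B \<rightarrow>\<^sub>M P" by (rule observe_measurable[OF ctx])
  obtain X where X: "finite X" "\<forall>(\<psi>, c, w)\<in>X. chernoff_test P n \<psi> c w" "(\<Sum>(\<psi>, c, w)\<in>X. w) \<le> q"
    "\<forall>S \<omega>. (\<forall>i<n. \<omega> i \<in> space P) \<longrightarrow> (\<forall>(\<psi>, c, w)\<in>X. (\<Sum>i\<in>{..<n} - S. \<psi> (\<omega> i)) \<le> c) \<longrightarrow> R S \<omega>"
    using R unfolding ensured_def by blast
  have mX: "\<psi> \<in> borel_measurable P" if "(\<psi>, c, w) \<in> X" for \<psi> c w
    using X(2) that by (auto simp: chernoff_test_def)
  define F where "F = {S. S \<subseteq> {..<n} \<and> real (card S) \<le> k}"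
  have finF: "finite F" unfolding F_def by (rule finite_subset[of _ "Pow {..<n}"]) auto
  define G where "G S = {\<omega>\<in>space ?P. \<forall>(\<psi>, c, w)\<in>X. (\<Sum>i\<in>{..<n} - S. \<psi> (\<omega> i)) \<le> c}" for S
  have G: "G S \<in> sets ?P" for S
  proof -
    have "G S = {\<omega>\<in>space ?P. \<forall>z\<in>X. (\<Sum>i\<in>{..<n} - S. fst z (\<omega> i)) \<le> fst (snd z)}"
      unfolding G_def by (auto simp: split_beta)
    also have "\<dots> \<in> sets ?P"
    proof (rule sets.sets_Collect_finite_All[OF _ X(1)])
      fix z assume "z \<in> X"
      then have [measurable]: "fst z \<in> borel_measurable P" using mX[of "fst z" "fst (snd z)" "snd (snd z)"] by simp
      show "{\<omega> \<in> space ?P. (\<Sum>i\<in>{..<n} - S. fst z (\<omega> i)) \<le> fst (snd z)} \<in> sets ?P"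
        by measurable
    qed
    finally show ?thesis .
  qed
  define E where "E = (\<Union>S\<in>F. G S)"
  have E[measurable]: "E \<in> sets ?P" unfolding E_def using finF G by auto
  \<comment> \<open>Masking turns the sum over a label-dependent index set into a sum of
    \<open>n\<close> independent identically distributed terms, to which \<open>chernoff_PiM\<close>
    applies.\<close>
  define mask where "mask \<psi> u = (if fst u then 0 else \<psi> (fst (snd u)) :: real)" for \<psi> and u :: "bool \<times> 'a \<times> 'a"
  define bad where "bad z = {v\<in>space ?L. fst (snd z) < (\<Sum>i<n. mask (fst z) (v i))}" for z :: "('a \<Rightarrow> real) \<times> real \<times> real"
  define bad0 where "bad0 = {v\<in>space ?L. k < (\<Sum>i<n. of_bool (fst (v i)) :: real)}"
  have mb: "mask (fst z) \<in> borel_measurable ?B" if "z \<in> X" for z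
  proof -
    have [measurable]: "fst z \<in> borel_measurable P" using that mX[of "fst z" "fst (snd z)" "snd (snd z)"] by simp
    show ?thesis unfolding mask_def[abs_def] mixture_label_def by measurable
  qed
  have mfst: "(\<lambda>u. of_bool (fst u) :: real) \<in> borel_measurable ?B"
    unfolding mixture_label_def by measurable
  \<comment> \<open>Off the bad events, the set of indices with true label is a witness for the
    union that defines \<open>E\<close>.\<close>
  have sub: "space ?L - (bad0 \<union> (\<Union>z\<in>X. bad z)) \<subseteq> ?T -` E \<inter> space ?L"
  proof
    fix v assume v: "v \<in> space ?L - (bad0 \<union> (\<Union>z\<in>X. bad z))"
    define S where "S = {i\<in>{..<n}. fst (v i)}"
    have "real (card S) = (\<Sum>i<n. of_bool (fst (v i)))" unfolding S_def by (simp add: sum.If_cases Int_def of_bool_def)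
    also have "\<dots> \<le> k" using v by (auto simp: bad0_def)
    finally have SF: "S \<in> F" by (auto simp: F_def S_def)
    have "(\<Sum>i\<in>{..<n} - S. fst z (?T v i)) \<le> fst (snd z)" if z: "z \<in> X" for z
    proof -
      have "(\<Sum>i\<in>{..<n} - S. fst z (?T v i)) = (\<Sum>i\<in>{..<n} - S. mask (fst z) (v i))"
        by (rule sum.cong) (auto simp: S_def compose_def observe_def mask_def)
      also have "\<dots> = (\<Sum>i<n. mask (fst z) (v i))"
        by (rule sum.mono_neutral_left) (auto simp: S_def mask_def)
      also have "\<dots> \<le> fst (snd z)" using v z by (auto simp: bad_def)
      finally show ?thesis .
    qed
    moreover have "?T v \<in> space ?P" using v by (intro measurable_space[of ?T ?L]) auto
    ultimately have "?T v \<in> G S" unfolding G_def by (auto simp: split_beta)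
    then show "v \<in> ?T -` E \<inter> space ?L" using SF v unfolding E_def by auto
  qed
  have bad0m: "bad0 \<in> sets ?L" unfolding bad0_def using mfst by measurable
  have badm: "bad z \<in> sets ?L" if "z \<in> X" for z unfolding bad_def using mb[OF that] by measurable
  have badU: "(\<Union>z\<in>X. bad z) \<in> sets ?L" using X(1) badm by (rule sets.finite_UN)
  have "measure ?L bad0 \<le> exp (real n * (\<epsilon> * (l + l\<^sup>2)) - l * k)"
    unfolding bad0_def using bernoulli_mgf_le[OF ctx l] l
    by (intro chernoff_PiM mfst) (auto intro: B.prob_space_axioms)
  moreover have "measure ?L (\<Union>z\<in>X. bad z) \<le> q"
  proof -
    have "measure ?L (\<Union>z\<in>X. bad z) \<le> (\<Sum>z\<in>X. measure ?L (bad z))"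
      using X(1) badm by (intro L.finite_measure_subadditive_finite) auto
    also have "\<dots> \<le> (\<Sum>z\<in>X. snd (snd z))"
    proof (rule sum_mono)
      fix z assume z: "z \<in> X"
      then have "chernoff_test P n (fst z) (fst (snd z)) (snd (snd z))" using X(2) by (auto simp: split_beta)
      then obtain l' \<kappa> where *: "fst z \<in> borel_measurable P" "0 < l'" "0 \<le> \<kappa>"
          "(\<integral>\<^sup>+x. ennreal (exp (l' * fst z x)) \<partial>P) \<le> ennreal (exp \<kappa>)" "exp (real n * \<kappa> - l' * fst (snd z)) \<le> snd (snd z)"
        unfolding chernoff_test_def by blast
      have "measure ?L (bad z) \<le> exp (real n * \<kappa> - l' * fst (snd z))"
        unfolding bad_def
        by (rule chernoff_PiM[OF B.prob_space_axioms mb[OF z] *(2)])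
          (unfold mask_def, rule masked_mgf_le[OF ctx *(1,3,4)])
      then show "measure ?L (bad z) \<le> snd (snd z)" using *(5) by linarith
    qed
    finally show ?thesis using X(3) by (simp add: split_beta)
  qed
  moreover have "measure ?L (bad0 \<union> (\<Union>z\<in>X. bad z)) \<le> measure ?L bad0 + measure ?L (\<Union>z\<in>X. bad z)"
    using bad0m badU by (rule measure_Un_le)
  moreover have "measure ?L (space ?L - (bad0 \<union> (\<Union>z\<in>X. bad z))) = 1 - measure ?L (bad0 \<union> (\<Union>z\<in>X. bad z))"
    using bad0m badU by (intro L.prob_compl sets.Un)
  moreover have "measure ?L (space ?L - (bad0 \<union> (\<Union>z\<in>X. bad z))) \<le> measure ?L (?T -` E \<inter> space ?L)"
    using sub by (intro L.finite_measure_mono) measurable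
  moreover have "measure ?C E = measure ?L (?T -` E \<inter> space ?L)"
    unfolding PiM_contam_eq[OF ctx] by (subst measure_distr) auto
  ultimately have "measure ?C E \<ge> 1 - (q + exp (real n * (\<epsilon> * (l + l\<^sup>2)) - l * k))" by linarith
  moreover have "E \<in> sets ?C" using E by (simp add: cong: sets_PiM_cong)
  moreover have "\<exists>S\<subseteq>{..<n}. real (card S) \<le> k \<and> R S \<omega>" if w: "\<omega> \<in> E" for \<omega>
  proof -
    obtain S where S: "S \<in> F" "\<omega> \<in> G S" using w unfolding E_def by blast
    then have "\<forall>i<n. \<omega> i \<in> space P" by (auto simp: G_def space_PiM)
    then have "R S \<omega>" using X(4) S(2) unfolding G_def by blast
    then show ?thesis using S(1) unfolding F_def by blast
  qed
  ultimately show ?thesis by blast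
qed

section \<open>Spectral theorem and singular value decomposition\<close>

text \<open>Vectors are total functions read only below \<open>n\<close>. Dimensions stay ordinary
  variables, sums carry no carrier conditions, and the space \<open>nat \<Rightarrow> real\<close>
  supplies the topology for the compactness argument.\<close>

definition ip :: "nat \<Rightarrow> (nat \<Rightarrow> real) \<Rightarrow> (nat \<Rightarrow> real) \<Rightarrow> real" where
  "ip n x y = (\<Sum>i<n. x i * y i)"

lemma ip_commute: "ip n x y = ip n y x"
  by (simp add: ip_def mult.commute)

lemma ip_add_left: "ip n (\<lambda>i. x i + y i) z = ip n x z + ip n y z"
  and ip_diff_left: "ip n (\<lambda>i. x i - y i) z = ip n x z - ip n y z"
  and ip_scale_left: "ip n (\<lambda>i. c * x i) z = c * ip n x z"
  and ip_add_right: "ip n z (\<lambda>i. x i + y i) = ip n z x + ip n z y"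
  and ip_diff_right: "ip n z (\<lambda>i. x i - y i) = ip n z x - ip n z y"
  and ip_scale_right: "ip n z (\<lambda>i. c * x i) = c * ip n z x"
  by (simp_all add: ip_def algebra_simps sum.distrib sum_subtractf sum_distrib_left)

lemma ip_sum_left: "ip n (\<lambda>i. \<Sum>j\<in>J. f j i) z = (\<Sum>j\<in>J. ip n (f j) z)"
  unfolding ip_def sum_distrib_right by (rule sum.swap)

lemma ip_sum_right: "ip n z (\<lambda>i. \<Sum>j\<in>J. f j i) = (\<Sum>j\<in>J. ip n z (f j))"
  unfolding ip_def sum_distrib_left by (rule sum.swap)

lemma ip_nonneg: "0 \<le> ip n x x"
  unfolding ip_def by (intro sum_nonneg) simp

lemma ip_eq_0D: "ip n x x = 0 \<Longrightarrow> i < n \<Longrightarrow> x i = 0"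
  unfolding ip_def by (subst (asm) sum_nonneg_eq_0_iff) auto

lemma ip_cong: "(\<And>i. i < n \<Longrightarrow> x i = x' i) \<Longrightarrow> (\<And>i. i < n \<Longrightarrow> y i = y' i) \<Longrightarrow> ip n x y = ip n x' y'"
  unfolding ip_def by (intro sum.cong) auto

definition mv :: "nat \<Rightarrow> (nat \<Rightarrow> nat \<Rightarrow> real) \<Rightarrow> (nat \<Rightarrow> real) \<Rightarrow> nat \<Rightarrow> real" where
  "mv n a x i = (\<Sum>h<n. a i h * x h)"

lemma mv_add: "mv n a (\<lambda>i. x i + y i) = (\<lambda>i. mv n a x i + mv n a y i)"
  and mv_diff: "mv n a (\<lambda>i. x i - y i) = (\<lambda>i. mv n a x i - mv n a y i)"
  and mv_scale: "mv n a (\<lambda>i. c * x i) = (\<lambda>i. c * mv n a x i)"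
  by (auto simp: mv_def fun_eq_iff algebra_simps sum.distrib sum_subtractf sum_distrib_left)

lemma ip_mv_symmetric:
  assumes "\<And>i h. i < n \<Longrightarrow> h < n \<Longrightarrow> a i h = a h i"
  shows "ip n x (mv n a y) = ip n (mv n a x) y"
proof -
  have "ip n x (mv n a y) = (\<Sum>i<n. \<Sum>h<n. a i h * x i * y h)"
    by (simp add: ip_def mv_def sum_distrib_left mult_ac)
  also have "\<dots> = (\<Sum>h<n. \<Sum>i<n. a i h * x i * y h)" by (rule sum.swap)
  also have "\<dots> = (\<Sum>h<n. \<Sum>i<n. a h i * x i * y h)" using assms by (intro sum.cong) auto
  also have "\<dots> = ip n (mv n a x) y" by (simp add: ip_def mv_def sum_distrib_right sum_distrib_left mult_ac)
  finally show ?thesis .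
qed

text \<open>The first-order condition at a maximum: along a line through the maximiser the gain is a
  quadratic without constant term, and for small t of the right sign a nonzero linear part would
  win.\<close>

lemma linear_part_zero:
  fixes b c :: real
  assumes "\<And>t. b * t + c * t\<^sup>2 \<le> 0"
  shows "b = 0"
proof (rule ccontr)
  assume b: "b \<noteq> 0"
  \<comment> \<open>Chosen so that \<open>(\<bar>c\<bar> + 1) * t = b / 2\<close>: the quadratic
    term then costs at most half of the linear gain \<open>b * t\<close>.\<close>
  define t where "t = b / (\<bar>c\<bar> + 1) / 2"
  have "\<bar>c\<bar> * t\<^sup>2 \<le> (\<bar>c\<bar> + 1) * t\<^sup>2" by (intro mult_right_mono) auto
  also have "(\<bar>c\<bar> + 1) * t\<^sup>2 = (\<bar>c\<bar> + 1) * t * t" by (simp add: power2_eq_square)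
  also have "(\<bar>c\<bar> + 1) * t = b / 2" unfolding t_def by (simp add: field_simps)
  also have "b / 2 * t = b * t / 2" by simp
  finally have "- (c * t\<^sup>2) \<le> b * t / 2"
    by (metis abs_ge_minus_self abs_mult abs_of_nonneg order_trans zero_le_power2)
  moreover have "b * t = b\<^sup>2 / (2 * (\<bar>c\<bar> + 1))" unfolding t_def by (simp add: power2_eq_square mult_ac)
  then have "0 < b * t" using b by (simp add: add_nonneg_pos)
  ultimately show False using assms[of t] by linarith
qed

section \<open>Orthonormal systems: completeness and extension\<close>

definition orthonormal :: "nat \<Rightarrow> nat \<Rightarrow> (nat \<Rightarrow> nat \<Rightarrow> real) \<Rightarrow> bool" where
  "orthonormal n k e \<longleftrightarrow> (\<forall>j<k. \<forall>l<k. ip n (e j) (e l) = of_bool (j = l))"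

text \<open>The component of the \<open>i\<close>-th standard basis vector orthogonal to
  \<open>e 0\<close>, ..., \<open>e (k - 1)\<close>.\<close>

definition residual :: "nat \<Rightarrow> (nat \<Rightarrow> nat \<Rightarrow> real) \<Rightarrow> nat \<Rightarrow> nat \<Rightarrow> real" where
  "residual k e i h = of_bool (i = h) - (\<Sum>j<k. e j i * e j h)"

lemma residual_orthogonal:
  assumes "orthonormal n k e" "i < n" "l < k"
  shows "ip n (residual k e i) (e l) = 0"
proof -
  have "ip n (residual k e i) (e l) = ip n (\<lambda>h. of_bool (i = h)) (e l) - (\<Sum>j<k. e j i * ip n (e j) (e l))"
    unfolding residual_def by (simp add: ip_diff_left ip_sum_left ip_scale_left)
  also have "ip n (\<lambda>h. of_bool (i = h)) (e l) = e l i"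
    using assms(2) by (simp add: ip_def of_bool_def if_distrib[of "\<lambda>x. x * _"] cong: if_cong)
  also have "(\<Sum>j<k. e j i * ip n (e j) (e l)) = (\<Sum>j<k. if j = l then e l i else 0)"
    using assms(1,3) by (intro sum.cong) (auto simp: orthonormal_def)
  finally show ?thesis using assms(3) by simp
qed

lemma residual_norm:
  assumes "orthonormal n k e" "i < n"
  shows "ip n (residual k e i) (residual k e i) = 1 - (\<Sum>j<k. (e j i)\<^sup>2)"
proof -
  have "ip n (residual k e i) (residual k e i) = ip n (residual k e i) (\<lambda>h. of_bool (i = h)) -
      (\<Sum>j<k. e j i * ip n (residual k e i) (e j))"
    by (subst (2) residual_def[abs_def]) (simp add: ip_diff_right ip_sum_right ip_scale_right)
  also have "(\<Sum>j<k. e j i * ip n (residual k e i) (e j)) = 0"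
    using residual_orthogonal[OF assms] by simp
  also have "ip n (residual k e i) (\<lambda>h. of_bool (i = h)) = residual k e i i"
    using assms(2) by (simp add: ip_def of_bool_def if_distrib[of "\<lambda>x. _ * x"] cong: if_cong)
  finally show ?thesis by (simp add: residual_def[of k e i i] power2_eq_square)
qed

text \<open>The trace of the projection onto the orthogonal complement. For \<open>k = n\<close> all
  residuals must vanish, which is completeness; for \<open>k < n\<close> some residual is nonzero
  and yields a further orthonormal vector.\<close>

lemma sum_residual_norm:
  assumes "orthonormal n k e"
  shows "(\<Sum>i<n. 1 - (\<Sum>j<k. (e j i)\<^sup>2)) = real n - real k"
proof -
  have "(\<Sum>i<n. \<Sum>j<k. (e j i)\<^sup>2) = (\<Sum>j<k. ip n (e j) (e j))"
    by (subst sum.swap) (simp add: ip_def power2_eq_square)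
  also have "\<dots> = real k" using assms by (simp add: orthonormal_def)
  finally show ?thesis by (simp add: sum_subtractf)
qed

lemma orthonormal_complete:
  assumes "orthonormal n n e" "i < n" "h < n"
  shows "(\<Sum>j<n. e j i * e j h) = of_bool (i = h)"
proof -
  have nn: "0 \<le> 1 - (\<Sum>j<n. (e j i)\<^sup>2)" if "i < n" for i
    using residual_norm[OF assms(1) that] ip_nonneg[of n "residual n e i"] by simp
  have "(\<Sum>i<n. 1 - (\<Sum>j<n. (e j i)\<^sup>2)) = 0" using sum_residual_norm[OF assms(1)] by simp
  then have "1 - (\<Sum>j<n. (e j i)\<^sup>2) = 0" using nn assms(2) by (subst (asm) sum_nonneg_eq_0_iff) auto
  then have "ip n (residual n e i) (residual n e i) = 0" using residual_norm[OF assms(1,2)] by simp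
  from ip_eq_0D[OF this assms(3)] show ?thesis by (simp add: residual_def)
qed

lemma orthonormal_extend:
  assumes "orthonormal n k e" "k < n"
  obtains x where "ip n x x = 1" "\<And>j. j < k \<Longrightarrow> ip n x (e j) = 0" "\<And>i. i \<ge> n \<Longrightarrow> x i = 0"
proof -
  have "0 < (\<Sum>i<n. 1 - (\<Sum>j<k. (e j i)\<^sup>2))" using sum_residual_norm[OF assms(1)] assms(2) by simp
  then have "\<exists>i\<in>{..<n}. 0 < 1 - (\<Sum>j<k. (e j i)\<^sup>2)"
    using sum_nonpos[of "{..<n}" "\<lambda>i. 1 - (\<Sum>j<k. (e j i)\<^sup>2)"] by (meson not_less)
  then obtain i where i: "i < n" "0 < 1 - (\<Sum>j<k. (e j i)\<^sup>2)" by blast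
  define s where "s = sqrt (ip n (residual k e i) (residual k e i))"
  define y where "y h = inverse s * residual k e i h" for h
  have s: "0 < s" using i residual_norm[OF assms(1) i(1)] by (simp add: s_def)
  have s2: "ip n (residual k e i) (residual k e i) = s * s" unfolding s_def by (simp add: ip_nonneg)
  have "ip n y y = 1" unfolding y_def ip_scale_left ip_scale_right s2 using s by (simp add: field_simps)
  moreover have "ip n y (e j) = 0" if "j < k" for j
    unfolding y_def ip_scale_left using residual_orthogonal[OF assms(1) i(1) that] by simp
  moreover have "ip n (\<lambda>i. if i < n then y i else 0) w = ip n y w" for w by (rule ip_cong) auto
  moreover have "ip n w (\<lambda>i. if i < n then y i else 0) = ip n w y" for w by (rule ip_cong) auto
  \<comment> \<open>Truncation past \<open>n\<close> places the vector in the constrained sphere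
    treated next.\<close>
  ultimately show ?thesis
    by (intro that[of "\<lambda>i. if i < n then y i else 0"]) simp_all
qed

text \<open>Pinning the coordinates from \<open>n\<close> on to 0 makes the set a closed subset of a
  product of compact intervals, hence compact by Tychonoff's theorem.\<close>

lemma compact_constrained_sphere:
  "compact {x. ip n x x = 1 \<and> (\<forall>j<k. ip n x (e j) = 0) \<and> (\<forall>i\<ge>n. x i = 0)}" (is "compact ?S")
proof -
  let ?K = "\<lambda>i. if i < n then {-1..1} else {0::real}"
  have "compactin (product_topology (\<lambda>_. euclidean) UNIV) (PiE UNIV ?K)"
    unfolding compactin_PiE by (auto simp: compactin_euclidean_iff)
  then have "compact (PiE UNIV ?K)" by (simp add: euclidean_product_topology compactin_euclidean_iff)
  moreover have "closed ?S"
  proof -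
    have c[continuous_intros]: "continuous_on UNIV (\<lambda>x :: nat \<Rightarrow> real. x i)" for i
      by (rule continuous_on_product_coordinates)
    have *: "?S = {x. ip n x x = 1} \<inter> (\<Inter>j\<in>{..<k}. {x. ip n x (e j) = 0}) \<inter> (\<Inter>i\<in>{n..}. {x. x i = 0})" by auto
    show ?thesis unfolding * unfolding ip_def
      by (intro closed_Int closed_INT ballI closed_Collect_eq continuous_intros)
  qed
  moreover have "?S \<subseteq> PiE UNIV ?K"
  proof
    fix x assume x: "x \<in> ?S"
    have "\<bar>x i\<bar> \<le> 1" if "i < n" for i
    proof -
      have "x i * x i \<le> ip n x x" unfolding ip_def using that by (intro member_le_sum) auto
      then show ?thesis using x by (simp add: abs_square_le_1[symmetric] power2_eq_square)
    qed
    then show "x \<in> PiE UNIV ?K" using x by (auto simp: abs_le_iff)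
  qed
  ultimately show ?thesis using compact_Int_closed[of "PiE UNIV ?K" ?S] by (simp add: Int_absorb1)
qed

text \<open>A maximiser of the Rayleigh quotient on the orthogonal complement of finitely many eigenvectors is
  again an eigenvector.\<close>

lemma eigenvector_extend:
  assumes sym: "\<And>i h. i < n \<Longrightarrow> h < n \<Longrightarrow> a i h = a h i"
    and on: "orthonormal n k e" and k: "k < n"
    and eig: "\<And>j i. j < k \<Longrightarrow> i < n \<Longrightarrow> mv n a (e j) i = l j * e j i"
  obtains x \<mu> where "ip n x x = 1" "\<And>j. j < k \<Longrightarrow> ip n x (e j) = 0" "\<And>i. i < n \<Longrightarrow> mv n a x i = \<mu> * x i"
proof -
  let ?S = "{x. ip n x x = 1 \<and> (\<forall>j<k. ip n x (e j) = 0) \<and> (\<forall>i\<ge>n. x i = 0)}"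
  define q where "q x = ip n x (mv n a x)" for x
  have c[continuous_intros]: "continuous_on A (\<lambda>x :: nat \<Rightarrow> real. x i)" for i A
    by (rule continuous_on_subset[OF continuous_on_product_coordinates]) auto
  have cont: "continuous_on ?S q" unfolding q_def ip_def mv_def by (intro continuous_intros)
  obtain x0 where "ip n x0 x0 = 1" "\<And>j. j < k \<Longrightarrow> ip n x0 (e j) = 0" "\<And>i. i \<ge> n \<Longrightarrow> x0 i = 0"
    by (rule orthonormal_extend[OF on k]) (rule that; assumption)
  then have "x0 \<in> ?S" by simp
  then have ne: "?S \<noteq> {}" by (rule ex_in_conv[THEN iffD1, OF exI])
  from continuous_attains_sup[OF compact_constrained_sphere[of n k e] ne cont]
  obtain x where x: "x \<in> ?S" and max': "\<forall>y\<in>?S. q y \<le> q x" by (elim bexE)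
  have max: "q y \<le> q x" if "y \<in> ?S" for y using max' that by (rule bspec)
  \<comment> \<open>Maximality on the sphere, made homogeneous so that it applies to unnormalised
    perturbations \<open>x + t y\<close>.\<close>
  have hom: "q z \<le> q x * ip n z z" if z: "\<And>j. j < k \<Longrightarrow> ip n z (e j) = 0" for z
  proof (cases "ip n z z = 0")
    case True
    have "z i = 0" if "i < n" for i using True that by (rule ip_eq_0D)
    then have "q z = ip n (\<lambda>_. 0) (mv n a z)" unfolding q_def by (intro ip_cong) auto
    then have "q z = 0" by (simp add: ip_def)
    then show ?thesis using True by simp
  next
    case False
    define s where "s = sqrt (ip n z z)"
    have s: "0 < s" using False ip_nonneg[of n z] by (simp add: s_def)
    have s2: "ip n z z = s * s" unfolding s_def by (simp add: ip_nonneg)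
    define y where "y i = (if i < n then inverse s * z i else 0)" for i
    have y: "ip n y w = inverse s * ip n z w" for w
      unfolding ip_scale_left[symmetric] by (rule ip_cong) (auto simp: y_def)
    have y': "ip n w y = inverse s * ip n w z" for w
      unfolding ip_commute[of n w] by (rule y)
    have "mv n a y = (\<lambda>i. inverse s * mv n a z i)"
      unfolding mv_scale[symmetric] by (auto simp: mv_def y_def fun_eq_iff intro!: sum.cong)
    then have qy: "q y = inverse s * inverse s * q z" unfolding q_def y by (simp add: ip_scale_right)
    have "ip n y y = 1" unfolding y y' s2 using s by (simp add: field_simps)
    moreover have "ip n y (e j) = 0" if "j < k" for j unfolding y using z[OF that] by simp
    ultimately have "y \<in> ?S" by (simp add: y_def)
    from max[OF this] have "inverse s * inverse s * q z \<le> q x" unfolding qy .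
    then have "(s * s) * (inverse s * inverse s * q z) \<le> (s * s) * q x" by (intro mult_left_mono) auto
    also have "(s * s) * (inverse s * inverse s * q z) = q z" using s by (simp add: field_simps)
    finally show ?thesis unfolding s2 by (simp only: mult.commute)
  qed
  \<comment> \<open>When \<open>x + t y\<close> is compared with the homogeneous bound, the constant
    terms cancel and the coefficient of t is \<open>2 * ip n y (mv n a x)\<close>.\<close>
  have orth: "ip n y (mv n a x) = 0" if y: "\<And>j. j < k \<Longrightarrow> ip n y (e j) = 0" "ip n x y = 0" for y
  proof -
    have "2 * ip n y (mv n a x) * t + (q y - q x * ip n y y) * t\<^sup>2 \<le> 0" for t
    proof -
      let ?z = "\<lambda>i. x i + t * y i"
      have "ip n x (mv n a y) = ip n y (mv n a x)"
        using ip_mv_symmetric[where x = x and y = y and a = a and n = n, OF sym] ip_commute by metis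
      then have A: "q ?z = q x + 2 * t * ip n y (mv n a x) + t\<^sup>2 * q y"
        unfolding q_def mv_add mv_scale ip_add_left ip_add_right ip_scale_left ip_scale_right
        by (simp add: distrib_left power2_eq_square)
      have "ip n y x = 0" "ip n x x = 1" using y(2) x unfolding ip_commute[of n y x] by simp_all
      then have B: "ip n ?z ?z = 1 + t\<^sup>2 * ip n y y"
        unfolding ip_add_left ip_add_right ip_scale_left ip_scale_right using y(2)
        by (simp add: power2_eq_square)
      have "ip n ?z (e j) = 0" if "j < k" for j
        unfolding ip_add_left ip_scale_left using x y(1)[OF that] that by simp
      from hom[OF this] show ?thesis unfolding A B by (simp add: algebra_simps)
    qed
    from linear_part_zero[OF this] show ?thesis by simp
  qed
  \<comment> \<open>The defect of the eigenvector equation is orthogonal to all \<open>e j\<close>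
    and to \<open>x\<close>, so it may itself serve as the perturbation; the conclusion is then that
    it is orthogonal to itself.\<close>
  define y where "y i = mv n a x i - q x * x i" for i
  have ye: "ip n y (e j) = 0" if "j < k" for j
  proof -
    have "ip n (mv n a x) (e j) = ip n x (mv n a (e j))" using ip_mv_symmetric[where x = x and y = "e j" and a = a and n = n, OF sym] by simp
    also have "\<dots> = ip n x (\<lambda>i. l j * e j i)" using eig[OF that] by (intro ip_cong) auto
    also have "\<dots> = 0" using x that by (simp add: ip_scale_right)
    finally show ?thesis using x that unfolding y_def by (simp add: ip_diff_left ip_scale_left)
  qed
  have xy: "ip n x y = 0" using x unfolding y_def by (simp add: ip_diff_right ip_scale_right q_def)
  have "ip n y y = ip n y (\<lambda>i. mv n a x i - q x * x i)" by (rule ip_cong) (simp_all add: y_def)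
  also have "\<dots> = ip n y (mv n a x) - q x * ip n x y"
    by (simp add: ip_diff_right ip_scale_right ip_commute[of n y x])
  also have "\<dots> = 0" using orth[OF ye xy] xy by simp
  finally have "mv n a x i = q x * x i" if "i < n" for i
    using ip_eq_0D[OF _ that, of y] by (simp add: y_def)
  then show ?thesis using x by (intro that[of x "q x"]) auto
qed

lemma spectral_symmetric:
  assumes sym: "\<And>i h. i < n \<Longrightarrow> h < n \<Longrightarrow> a i h = a h i"
  obtains e l where "orthonormal n n e" "\<And>j i. j < n \<Longrightarrow> i < n \<Longrightarrow> mv n a (e j) i = l j * e j i"
proof -
  have "\<exists>e l. orthonormal n k e \<and> (\<forall>j<k. \<forall>i<n. mv n a (e j) i = l j * e j i)" if "k \<le> n" for k
    using that
  proof (induction k)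
    case 0
    then show ?case by (auto simp: orthonormal_def)
  next
    case (Suc k)
    then obtain e l where el: "orthonormal n k e" "\<forall>j<k. \<forall>i<n. mv n a (e j) i = l j * e j i" by auto
    obtain x \<mu> where x: "ip n x x = 1" "\<And>j. j < k \<Longrightarrow> ip n x (e j) = 0" "\<And>i. i < n \<Longrightarrow> mv n a x i = \<mu> * x i"
      by (rule eigenvector_extend[of n a k e l]) (use sym el Suc.prems in auto)
    have x': "ip n (e j) x = 0" if "j < k" for j using x(2)[OF that] by (simp add: ip_commute)
    have "orthonormal n (Suc k) (e(k := x))"
      using el(1) x x' unfolding orthonormal_def by (auto simp: less_Suc_eq)
    moreover have "\<forall>j<Suc k. \<forall>i<n. mv n a ((e(k := x)) j) i = (l(k := \<mu>)) j * (e(k := x)) j i"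
      using el(2) x by (auto simp: less_Suc_eq)
    ultimately show ?case by blast
  qed
  from this[of n] show ?thesis using that by blast
qed

lemma orthonormal_expand:
  assumes "orthonormal n n e" "i < n"
  shows "x i = (\<Sum>j<n. ip n x (e j) * e j i)"
proof -
  have "(\<Sum>j<n. ip n x (e j) * e j i) = (\<Sum>h<n. x h * (\<Sum>j<n. e j h * e j i))"
    unfolding ip_def sum_distrib_left sum_distrib_right by (subst sum.swap) (simp add: mult_ac)
  also have "\<dots> = (\<Sum>h<n. if h = i then x h else 0)"
    using orthonormal_complete[OF assms(1) _ assms(2)] by (intro sum.cong) auto
  finally show ?thesis using assms(2) by simp
qed

lemma orthonormal_parseval:
  assumes "orthonormal n n e"
  shows "ip n x y = (\<Sum>j<n. ip n x (e j) * ip n (e j) y)"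
proof -
  have "ip n x y = ip n (\<lambda>i. \<Sum>j<n. ip n x (e j) * e j i) y"
    using orthonormal_expand[OF assms] by (intro ip_cong) auto
  then show ?thesis by (simp add: ip_sum_left ip_scale_left)
qed

text \<open>Gaussian elimination by induction on the number of equations: a pivot \<open>j0\<close>
  removes the last equation, and its own coefficient is recovered at the end.\<close>

lemma nontrivial_kernel:
  fixes \<alpha> :: "'a \<Rightarrow> nat \<Rightarrow> real"
  assumes "finite J" "k < card J"
  shows "\<exists>c. (\<exists>j\<in>J. c j \<noteq> 0) \<and> (\<forall>l<k. (\<Sum>j\<in>J. c j * \<alpha> j l) = 0)"
  using assms
proof (induction k arbitrary: J \<alpha>)
  case 0
  then obtain j where "j \<in> J" by fastforce
  then show ?case by (intro exI[of _ "\<lambda>_. 1"]) auto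
next
  case (Suc k)
  show ?case
  proof (cases "\<forall>j\<in>J. \<alpha> j k = 0")
    case True
    obtain c where c: "\<exists>j\<in>J. c j \<noteq> 0" "\<forall>l<k. (\<Sum>j\<in>J. c j * \<alpha> j l) = 0" using Suc.IH[of J \<alpha>] Suc.prems by auto
    then show ?thesis using True by (intro exI[of _ c]) (auto simp: less_Suc_eq)
  next
    case False
    then obtain j0 where j0: "j0 \<in> J" "\<alpha> j0 k \<noteq> 0" by auto
    define r where "r j = \<alpha> j k / \<alpha> j0 k" for j
    obtain c where c: "\<exists>j\<in>J - {j0}. c j \<noteq> 0" "\<forall>l<k. (\<Sum>j\<in>J - {j0}. c j * (\<alpha> j l - r j * \<alpha> j0 l)) = 0"
    proof -
      have "k < card (J - {j0})" using Suc.prems j0(1) by (simp add: card_Diff_singleton)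
      then show thesis
        using that Suc.IH[of "J - {j0}" "\<lambda>j l. \<alpha> j l - r j * \<alpha> j0 l"] Suc.prems(1) by auto
    qed
    define c' where "c' = c(j0 := - (\<Sum>j\<in>J - {j0}. c j * r j))"
    have "(\<Sum>j\<in>J. c' j * \<alpha> j l) = (\<Sum>j\<in>J - {j0}. c j * (\<alpha> j l - r j * \<alpha> j0 l))" for l
    proof -
      have "(\<Sum>j\<in>J. c' j * \<alpha> j l) = c' j0 * \<alpha> j0 l + (\<Sum>j\<in>J - {j0}. c' j * \<alpha> j l)"
        using Suc.prems(1) j0(1) by (rule sum.remove)
      also have "(\<Sum>j\<in>J - {j0}. c' j * \<alpha> j l) = (\<Sum>j\<in>J - {j0}. c j * \<alpha> j l)"
        by (rule sum.cong) (auto simp: c'_def)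
      finally show ?thesis
        unfolding c'_def by (simp add: sum_distrib_right right_diff_distrib sum_subtractf mult.assoc)
    qed
    moreover have "(\<Sum>j\<in>J - {j0}. c j * (\<alpha> j k - r j * \<alpha> j0 k)) = 0" using j0(2) by (simp add: r_def)
    ultimately have "\<forall>l<Suc k. (\<Sum>j\<in>J. c' j * \<alpha> j l) = 0" using c(2) by (auto simp: less_Suc_eq)
    moreover have "\<exists>j\<in>J. c' j \<noteq> 0" using c(1) by (auto simp: c'_def)
    ultimately show ?thesis by blast
  qed
qed

section \<open>Gram matrix and singular value decomposition\<close>

definition gram :: "nat \<Rightarrow> (nat \<Rightarrow> nat \<Rightarrow> real) \<Rightarrow> nat \<Rightarrow> nat \<Rightarrow> real" where
  "gram p V j h = (\<Sum>i<p. V i j * V i h)"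

lemma ip_mv_gram: "ip p (mv m V x) (mv m V y) = ip m x (mv m (gram p V) y)"
proof -
  have "ip p (mv m V x) (mv m V y) = (\<Sum>i<p. \<Sum>j<m. \<Sum>h<m. x j * V i j * V i h * y h)"
    unfolding ip_def mv_def by (simp add: sum_product mult_ac)
  also have "\<dots> = (\<Sum>j<m. \<Sum>h<m. \<Sum>i<p. x j * V i j * V i h * y h)"
    by (subst sum.swap, rule sum.cong, simp, subst sum.swap, simp)
  also have "\<dots> = ip m x (mv m (gram p V) y)"
    unfolding ip_def mv_def gram_def by (simp add: sum_distrib_left sum_distrib_right mult_ac)
  finally show ?thesis .
qed

lemma gram_eigen:
  assumes "orthonormal m m e" "\<And>j i. j < m \<Longrightarrow> i < m \<Longrightarrow> mv m (gram p V) (e j) i = l j * e j i" "j < m" "h < m"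
  shows "ip p (mv m V (e j)) (mv m V (e h)) = (if j = h then l j else 0)"
proof -
  have "ip p (mv m V (e j)) (mv m V (e h)) = ip m (e j) (\<lambda>i. l h * e h i)"
    unfolding ip_mv_gram using assms by (intro ip_cong) auto
  then show ?thesis using assms by (auto simp: ip_scale_right orthonormal_def)
qed

text \<open>The vectors \<open>mv m V (e j)\<close> with \<open>l j \<noteq> 0\<close> are
  orthogonal and nonzero, yet lie in the span of the \<open>k\<close> columns of \<open>C\<close>. A
  dependency among more than \<open>k\<close> of them is contradicted by pairing it with one that
  occurs in it.\<close>

lemma gram_rank:
  assumes on: "orthonormal m m e" "\<And>j i. j < m \<Longrightarrow> i < m \<Longrightarrow> mv m (gram p V) (e j) i = l j * e j i"
    and V: "\<And>i j. i < p \<Longrightarrow> j < m \<Longrightarrow> V i j = (\<Sum>h<k. C i h * D h j)"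
  shows "card {j\<in>{..<m}. l j \<noteq> 0} \<le> k"
proof (rule ccontr)
  let ?J = "{j\<in>{..<m}. l j \<noteq> 0}"
  assume "\<not> card ?J \<le> k"
  then obtain c where c: "\<exists>j\<in>?J. c j \<noteq> 0" "\<forall>h<k. (\<Sum>j\<in>?J. c j * mv m D (e j) h) = 0"
    using nontrivial_kernel[of ?J k "\<lambda>j. mv m D (e j)"] by auto
  have Ve: "mv m V (e j) i = (\<Sum>h<k. C i h * mv m D (e j) h)" if "i < p" for i j
  proof -
    have "mv m V (e j) i = (\<Sum>q<m. \<Sum>h<k. C i h * D h q * e j q)"
      unfolding mv_def using V[OF that] by (intro sum.cong) (auto simp: sum_distrib_right)
    also have "\<dots> = (\<Sum>h<k. C i h * mv m D (e j) h)"
      unfolding mv_def by (subst sum.swap) (simp add: sum_distrib_left mult_ac)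
    finally show ?thesis .
  qed
  have 0: "(\<Sum>j\<in>?J. c j * mv m V (e j) i) = 0" if "i < p" for i
  proof -
    have "(\<Sum>j\<in>?J. c j * mv m V (e j) i) = (\<Sum>h<k. C i h * (\<Sum>j\<in>?J. c j * mv m D (e j) h))"
      unfolding Ve[OF that] sum_distrib_left by (subst sum.swap) (simp add: mult_ac)
    then show ?thesis using c(2) by simp
  qed
  obtain j0 where j0: "j0 \<in> ?J" "c j0 \<noteq> 0" using c(1) by auto
  have "ip p (\<lambda>i. \<Sum>j\<in>?J. c j * mv m V (e j) i) (mv m V (e j0)) = (\<Sum>j\<in>?J. c j * (if j = j0 then l j else 0))"
    unfolding ip_sum_left ip_scale_left using j0(1) gram_eigen[OF on] by (intro sum.cong) auto
  also have "\<dots> = c j0 * l j0" using j0(1) by (subst sum.remove[of _ j0]) (auto intro!: sum.neutral)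
  finally have "c j0 * l j0 = 0" using 0 by (simp add: ip_def)
  then show False using j0 by auto
qed

definition fro2 :: "nat \<Rightarrow> nat \<Rightarrow> (nat \<Rightarrow> nat \<Rightarrow> real) \<Rightarrow> real" where
  "fro2 p m V = (\<Sum>i<p. \<Sum>j<m. (V i j)\<^sup>2)"

text \<open>Both sides are the trace of the Gram matrix; Parseval is applied to each row of
  \<open>V\<close>.\<close>

lemma fro2_eq_sum_eigen:
  assumes on: "orthonormal m m e" "\<And>j i. j < m \<Longrightarrow> i < m \<Longrightarrow> mv m (gram p V) (e j) i = l j * e j i"
  shows "fro2 p m V = (\<Sum>j<m. l j)"
proof -
  have mv: "mv m V x i = ip m (V i) x" for x i by (simp add: mv_def ip_def)
  have "(\<Sum>j<m. l j) = (\<Sum>j<m. ip p (mv m V (e j)) (mv m V (e j)))"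
    by (rule sum.cong) (simp_all add: gram_eigen[OF on])
  also have "\<dots> = (\<Sum>j<m. \<Sum>i<p. ip m (V i) (e j) * ip m (e j) (V i))"
    unfolding ip_def[of p] mv by (simp only: ip_commute[of m "e _"])
  also have "\<dots> = (\<Sum>i<p. \<Sum>j<m. ip m (V i) (e j) * ip m (e j) (V i))"
    by (rule sum.swap)
  also have "\<dots> = (\<Sum>i<p. ip m (V i) (V i))"    by (simp only: orthonormal_parseval[OF on(1), symmetric])
  finally show ?thesis by (simp add: fro2_def ip_def power2_eq_square)
qed

text \<open>Normalised images of the Gram eigenvectors with nonzero eigenvalue form
  \<open>U\<close>, the rescaled eigenvectors form \<open>M\<close>; both are padded with zeros up
  to \<open>k\<close>, so columns of \<open>U\<close> have norm 0 or 1. Writing \<open>U\<close> as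
  \<open>V\<close> times a matrix keeps its columns in the range of \<open>V\<close>, so that a
  constraint on that range passes to the factor.\<close>

lemma svd_low_rank:
  assumes V: "\<And>i j. i < p \<Longrightarrow> j < m \<Longrightarrow> V i j = (\<Sum>h<k. C i h * D h j)"
  obtains U M N where
    "\<And>i h. U i h = (\<Sum>j<m. V i j * N j h)"
    "\<And>i j. i < p \<Longrightarrow> j < m \<Longrightarrow> V i j = (\<Sum>h<k. U i h * M h j)"
    "\<And>h h'. h < k \<Longrightarrow> h' < k \<Longrightarrow> h \<noteq> h' \<Longrightarrow> (\<Sum>i<p. U i h * U i h') = 0"
    "\<And>h. h < k \<Longrightarrow> (\<Sum>i<p. (U i h)\<^sup>2) \<le> 1"
    "\<And>h h'. h < k \<Longrightarrow> h' < k \<Longrightarrow> h \<noteq> h' \<Longrightarrow> (\<Sum>j<m. M h j * M h' j) = 0"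
    "fro2 k m M = fro2 p m V"
proof -
  have "\<And>i h. i < m \<Longrightarrow> h < m \<Longrightarrow> gram p V i h = gram p V h i" by (simp add: gram_def mult.commute)
  then obtain e l where on: "orthonormal m m e" "\<And>j i. j < m \<Longrightarrow> i < m \<Longrightarrow> mv m (gram p V) (e j) i = l j * e j i"
    using spectral_symmetric by blast
  let ?J = "{j\<in>{..<m}. l j \<noteq> 0}"
  have cJ: "card ?J \<le> k" by (rule gram_rank[OF on V])
  obtain f where f: "bij_betw f {..<card ?J} ?J"
    using ex_bij_betw_nat_finite[of ?J] by (auto simp: atLeast0LessThan)
  have fm: "f h < m" "l (f h) \<noteq> 0" if "h < card ?J" for h using bij_betwE[OF f] that by auto
  have finj: "f h = f h' \<longleftrightarrow> h = h'" if "h < card ?J" "h' < card ?J" for h h'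
    using bij_betw_imp_inj_on[OF f] that by (auto dest: inj_onD)
  have ge: "ip p (mv m V (e j)) (mv m V (e h)) = (if j = h then l j else 0)" if "j < m" "h < m" for j h
    by (rule gram_eigen[OF on that])
  have l0: "0 \<le> l j" if "j < m" for j using ge[OF that that] ip_nonneg[of p "mv m V (e j)"] by simp
  have lpos: "0 < l (f h)" if "h < card ?J" for h using fm[OF that] l0[of "f h"] by linarith
  define N where "N j h = (if h < card ?J then e (f h) j / sqrt (l (f h)) else 0)" for j h
  define U where "U i h = (\<Sum>j<m. V i j * N j h)" for i h
  define M where "M h j = (if h < card ?J then sqrt (l (f h)) * e (f h) j else 0)" for h j
  have U: "U i h = (if h < card ?J then mv m V (e (f h)) i / sqrt (l (f h)) else 0)" for i h
    unfolding U_def N_def mv_def by (simp add: sum_divide_distrib)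
  have UU: "(\<Sum>i<p. U i h * U i h') = (if h = h' \<and> h < card ?J then 1 else 0)" for h h'
  proof (cases "h < card ?J \<and> h' < card ?J")
    case True
    then have "(\<Sum>i<p. U i h * U i h') = ip p (mv m V (e (f h))) (mv m V (e (f h'))) / (sqrt (l (f h)) * sqrt (l (f h')))"
      unfolding ip_def by (simp add: U sum_divide_distrib)
    also have "\<dots> = (if h = h' then 1 else 0)"
      using True fm finj ge[of "f h" "f h'"] lpos[of h] by (auto simp: real_sqrt_mult[symmetric] abs_if)
    finally show ?thesis using True by auto
  qed (auto simp: U)
  have MM: "(\<Sum>j<m. M h j * M h' j) = (if h = h' \<and> h < card ?J then l (f h) else 0)" for h h'
  proof (cases "h < card ?J \<and> h' < card ?J")
    case True
    then have "(\<Sum>j<m. M h j * M h' j) = sqrt (l (f h)) * sqrt (l (f h')) * ip m (e (f h)) (e (f h'))"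
      unfolding ip_def by (simp add: M_def sum_distrib_left mult_ac)
    also have "\<dots> = (if h = h' then l (f h) else 0)"
      using True fm finj on(1) lpos[of h] by (auto simp: orthonormal_def)
    finally show ?thesis using True by auto
  qed (auto simp: M_def)
  have "V i j = (\<Sum>h<k. U i h * M h j)" if "i < p" "j < m" for i j
  proof -
    have "V i j = (\<Sum>q<m. ip m (V i) (e q) * e q j)" by (rule orthonormal_expand[OF on(1) that(2)])
    also have "\<dots> = (\<Sum>q\<in>?J. ip m (V i) (e q) * e q j)"
    \<comment> \<open>An eigenvector with eigenvalue 0 is annihilated by \<open>V\<close>, so its
      term in the expansion of a row vanishes.\<close>
    proof (rule sum.mono_neutral_right, simp, blast, intro ballI)
      fix q assume q: "q \<in> {..<m} - ?J"
      then have "ip p (mv m V (e q)) (mv m V (e q)) = 0" using ge[of q q] by auto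
      from ip_eq_0D[OF this that(1)] show "ip m (V i) (e q) * e q j = 0" by (simp add: mv_def ip_def)
    qed
    also have "\<dots> = (\<Sum>h<card ?J. ip m (V i) (e (f h)) * e (f h) j)"
      by (rule sum.reindex_bij_betw[OF f, symmetric])
    also have "\<dots> = (\<Sum>h<card ?J. U i h * M h j)"
    proof (rule sum.cong)
      fix h assume h: "h \<in> {..<card ?J}"
      then have "sqrt (l (f h)) \<noteq> 0" using lpos[of h] by simp
      then show "ip m (V i) (e (f h)) * e (f h) j = U i h * M h j" using h by (simp add: U M_def mv_def ip_def)
    qed simp
    also have "\<dots> = (\<Sum>h<k. U i h * M h j)"
      using cJ by (intro sum.mono_neutral_left) (auto simp: M_def)
    finally show ?thesis .
  qed
  moreover have "fro2 k m M = fro2 p m V"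
  proof -
    have "fro2 k m M = (\<Sum>h<k. if h < card ?J then l (f h) else 0)"
      unfolding fro2_def power2_eq_square MM by simp
    also have "\<dots> = (\<Sum>h<card ?J. l (f h))" using cJ by (intro sum.mono_neutral_cong_right) auto
    also have "\<dots> = (\<Sum>q\<in>?J. l q)" by (rule sum.reindex_bij_betw[OF f])
    also have "\<dots> = (\<Sum>q<m. l q)" by (rule sum.mono_neutral_left) auto
    finally show ?thesis using fro2_eq_sum_eigen[OF on] by simp
  qed
  moreover have "(\<Sum>i<p. (U i h)\<^sup>2) \<le> 1" for h using UU[of h h] by (simp add: power2_eq_square)
  ultimately show ?thesis
    by (intro that[of U N M]) (simp_all only: U_def[symmetric] UU MM if_False simp_thms)
qed

abbreviation "N01 \<equiv> density lborel std_normal_density"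

section \<open>Gaussian bilinear and quadratic forms\<close>

lemma prob_space_N01: "prob_space N01"
  by (rule prob_space_normal_density) simp

lemma prob_space_std_gauss: "prob_space (std_gauss k)"
  unfolding std_gauss_def by (rule prob_space_PiM) (rule prob_space_N01)

lemma measurable_std_gauss_component [measurable]: "i < k \<Longrightarrow> (\<lambda>w. w i) \<in> borel_measurable (std_gauss k)"
proof -
  assume "i < k"
  then have "(\<lambda>w. w i) \<in> std_gauss k \<rightarrow>\<^sub>M N01"
    unfolding std_gauss_def by (intro measurable_component_singleton) simp
  then show ?thesis by simp
qed

lemma nn_integral_N01_scale:
  fixes f :: "real \<Rightarrow> ennreal"
  assumes [measurable]: "f \<in> borel_measurable borel" and s: "0 < s"
  shows "(\<integral>\<^sup>+t. f (s * t) \<partial>N01) = (\<integral>\<^sup>+x. ennreal (normal_density 0 s x) * f x \<partial>lborel)"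
proof -
  have "(\<integral>\<^sup>+x. ennreal (normal_density 0 s x) * f x \<partial>lborel) =
      ennreal s * (\<integral>\<^sup>+t. ennreal (normal_density 0 s (s * t)) * f (s * t) \<partial>lborel)"
    using nn_integral_real_affine[of "\<lambda>x. ennreal (normal_density 0 s x) * f x" s 0] s by simp
  also have "\<dots> = (\<integral>\<^sup>+t. ennreal s * (ennreal (normal_density 0 s (s * t)) * f (s * t)) \<partial>lborel)"
    by (rule nn_integral_cmult[symmetric]) simp
  also have "\<dots> = (\<integral>\<^sup>+t. ennreal (std_normal_density t) * f (s * t) \<partial>lborel)"
  proof (rule nn_integral_cong)
    fix t
    have "s * normal_density 0 s (s * t) = std_normal_density t"
      using s by (simp add: normal_density_def real_sqrt_mult power_mult_distrib)
    then show "ennreal s * (ennreal (normal_density 0 s (s * t)) * f (s * t)) = ennreal (std_normal_density t) * f (s * t)"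
      using s by (simp add: mult.assoc[symmetric] ennreal_mult[symmetric])
  qed
  also have "\<dots> = (\<integral>\<^sup>+t. f (s * t) \<partial>N01)" by (subst nn_integral_density) auto
  finally show ?thesis by simp
qed

lemma nn_integral_std_gauss_linear:
  fixes f :: "real \<Rightarrow> ennreal"
  assumes f[measurable]: "f \<in> borel_measurable borel"
  shows "(\<integral>\<^sup>+w. f (\<Sum>i<k. a i * w i) \<partial>std_gauss k) = (\<integral>\<^sup>+t. f (sqrt (\<Sum>i<k. (a i)\<^sup>2) * t) \<partial>N01)"
proof -
  interpret N: prob_space N01 by (rule prob_space_N01)
  interpret G: prob_space "std_gauss k" by (rule prob_space_std_gauss)
  \<comment> \<open>Normal densities need a positive scale, so indices with zero coefficient are
    removed; if none remains, the sum is the constant 0.\<close>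
  define I where "I = {i\<in>{..<k}. a i \<noteq> 0}"
  have sumI: "(\<Sum>i<k. a i * w i) = (\<Sum>i\<in>I. a i * w i)" for w
    unfolding I_def by (rule sum.mono_neutral_right) auto
  have sumI2: "(\<Sum>i<k. (a i)\<^sup>2) = (\<Sum>i\<in>I. \<bar>a i\<bar>\<^sup>2)"
    unfolding I_def by (rule sum.mono_neutral_cong_right) auto
  show ?thesis
  proof (cases "I = {}")
    case True
    then show ?thesis unfolding sumI sumI2 using N.emeasure_space_1 by (simp add: G.emeasure_space_1)
  next
    case False
    have finI: "finite I" by (simp add: I_def)
    have comp: "distr (std_gauss k) N01 (\<lambda>w. w i) = N01" if "i < k" for i
      unfolding std_gauss_def by (rule distr_PiM_component) (use that prob_space_N01 in auto)
    have ind: "G.indep_vars (\<lambda>_. N01) (\<lambda>i w. w i) {..<k}"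
    proof (cases "k = 0")
      case True
      then show ?thesis using False by (simp add: I_def)
    next
      case k: False
      have "distr (std_gauss k) (PiM {..<k} (\<lambda>_. N01)) (\<lambda>x. \<lambda>i\<in>{..<k}. x i) = distr (std_gauss k) (std_gauss k) (\<lambda>x. x)"
        by (rule distr_cong) (auto simp: std_gauss_def space_PiM)
      also have "\<dots> = std_gauss k" by simp
      also have "\<dots> = PiM {..<k} (\<lambda>i. N01)" by (rule std_gauss_def)
      also have "\<dots> = PiM {..<k} (\<lambda>i. distr (std_gauss k) N01 (\<lambda>w. w i))"
        by (rule PiM_cong) (simp_all add: comp)
      finally show ?thesis
        using k by (subst G.indep_vars_iff_distr_eq_PiM') auto
    qed
    then have "G.indep_vars (\<lambda>_. borel) (\<lambda>i w. a i * w i) {..<k}"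
      by (rule G.indep_vars_compose2) auto
    then have indI: "G.indep_vars (\<lambda>_. borel) (\<lambda>i w. a i * w i) I"
      by (rule G.indep_vars_subset) (auto simp: I_def)
    have dist: "distributed (std_gauss k) lborel (\<lambda>w. a i * w i) (normal_density 0 \<bar>a i\<bar>)" if i: "i \<in> I" for i
    proof -
      have ik: "i < k" and ai: "a i \<noteq> 0" using i by (auto simp: I_def)
      have "distributed (std_gauss k) lborel (\<lambda>w. w i) std_normal_density"
        unfolding distributed_def
      proof (intro conjI)
        have "distr (std_gauss k) lborel (\<lambda>w. w i) = distr (std_gauss k) N01 (\<lambda>w. w i)"
          by (rule distr_cong) auto
        then show "distr (std_gauss k) lborel (\<lambda>w. w i) = N01" using comp[OF ik] by simp
      qed (use measurable_std_gauss_component[OF ik] in auto)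
      from G.normal_density_affine[OF this, of "a i" 0] ai show ?thesis by simp
    qed
    have D: "distributed (std_gauss k) lborel (\<lambda>w. \<Sum>i\<in>I. a i * w i) (normal_density 0 (sqrt (\<Sum>i\<in>I. \<bar>a i\<bar>\<^sup>2)))"
      using G.sum_indep_normal[OF finI False indI, of "\<lambda>i. \<bar>a i\<bar>" "\<lambda>_. 0"] dist by (auto simp: I_def)
    have "0 < (\<Sum>i\<in>I. \<bar>a i\<bar>\<^sup>2)" using finI False by (intro sum_pos) (auto simp: I_def)
    then have "0 < sqrt (\<Sum>i\<in>I. \<bar>a i\<bar>\<^sup>2)" by simp
    from nn_integral_N01_scale[OF f this] show ?thesis
      unfolding sumI sumI2 using distributed_nn_integral[OF D, of f] by simp
  qed
qed

text \<open>Reweighting the standard Gaussian gives a multiple of the Gaussian density with variance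
  \<open>1 / (1 + 2 * b)\<close>. Negative \<open>b\<close> above -1/2 is included, which covers
  exponential moments of a square.\<close>

lemma nn_integral_N01_exp_sq:
  assumes "- 1 < 2 * b"
  shows "(\<integral>\<^sup>+t. ennreal (exp (- b * t\<^sup>2)) \<partial>N01) = ennreal (1 / sqrt (1 + 2 * b))"
proof -
  define s where "s = 1 / sqrt (1 + 2 * b)"
  have s: "0 < s" and s2: "s\<^sup>2 = 1 / (1 + 2 * b)" using assms by (auto simp: s_def power_divide)
  have eq: "std_normal_density t * exp (- (b * t\<^sup>2)) = s * normal_density 0 s t" for t
  proof -
    have "t\<^sup>2 / (2 * s\<^sup>2) = t\<^sup>2 / 2 + b * t\<^sup>2" unfolding s2 using assms by (simp add: field_simps)
    then have "exp (- t\<^sup>2 / (2 * s\<^sup>2)) = exp (- t\<^sup>2 / 2) * exp (- (b * t\<^sup>2))" by (simp add: mult_exp_exp)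
    then show ?thesis using s by (simp add: normal_density_def real_sqrt_mult)
  qed
  have "(\<integral>\<^sup>+t. ennreal (exp (- b * t\<^sup>2)) \<partial>N01) = (\<integral>\<^sup>+t. ennreal s * ennreal (normal_density 0 s t) \<partial>lborel)"
    using s by (subst nn_integral_density) (auto simp: ennreal_mult'[symmetric] ennreal_mult[symmetric] eq intro!: nn_integral_cong)
  also have "\<dots> = ennreal s * (\<integral>\<^sup>+t. ennreal (normal_density 0 s t) \<partial>lborel)"
    by (rule nn_integral_cmult) simp
  also have "(\<integral>\<^sup>+t. ennreal (normal_density 0 s t) \<partial>lborel) = 1"
  proof -
    interpret prob_space "density lborel (normal_density 0 s)" by (rule prob_space_normal_density[OF s])
    show ?thesis using emeasure_space_1 by (simp add: emeasure_density)
  qed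
  finally show ?thesis by (simp add: s_def)
qed

lemma nn_integral_N01_exp_linear: "(\<integral>\<^sup>+t. ennreal (exp (a * t)) \<partial>N01) = ennreal (exp (a\<^sup>2 / 2))"
proof -
  have eq: "std_normal_density t * exp (a * t) = exp (a\<^sup>2 / 2) * normal_density a 1 t" for t
  proof -
    have "exp (- t\<^sup>2 / 2) * exp (a * t) = exp (a\<^sup>2 / 2) * exp (- (t - a)\<^sup>2 / 2)"
      by (simp add: mult_exp_exp power2_eq_square algebra_simps add_divide_distrib diff_divide_distrib)
    then show ?thesis by (simp add: normal_density_def)
  qed
  have "(\<integral>\<^sup>+t. ennreal (exp (a * t)) \<partial>N01) = (\<integral>\<^sup>+t. ennreal (exp (a\<^sup>2 / 2)) * ennreal (normal_density a 1 t) \<partial>lborel)"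
    by (subst nn_integral_density) (auto simp: ennreal_mult'[symmetric] ennreal_mult[symmetric] eq intro!: nn_integral_cong)
  also have "\<dots> = ennreal (exp (a\<^sup>2 / 2)) * (\<integral>\<^sup>+t. ennreal (normal_density a 1 t) \<partial>lborel)"
    by (rule nn_integral_cmult) simp
  also have "(\<integral>\<^sup>+t. ennreal (normal_density a 1 t) \<partial>lborel) = 1"
  proof -
    interpret prob_space "density lborel (normal_density a 1)" by (rule prob_space_normal_density) simp
    show ?thesis using emeasure_space_1 by (simp add: emeasure_density)
  qed
  finally show ?thesis by simp
qed

lemma nn_integral_N01_sq: "(\<integral>\<^sup>+t. ennreal (c * t\<^sup>2) \<partial>N01) = ennreal c" if "0 \<le> c"
proof -
  have h: "has_bochner_integral lborel (\<lambda>t. std_normal_density t * t\<^sup>2) 1"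
    using std_normal_moment_even[of 1] by (simp add: fact_numeral)
  have "(\<integral>\<^sup>+t. ennreal (c * t\<^sup>2) \<partial>N01) = (\<integral>\<^sup>+t. ennreal c * ennreal (std_normal_density t * t\<^sup>2) \<partial>lborel)"
    using that by (subst nn_integral_density) (auto simp: ennreal_mult'[symmetric] ennreal_mult[symmetric] mult_ac intro!: nn_integral_cong)
  also have "\<dots> = ennreal c * (\<integral>\<^sup>+t. ennreal (std_normal_density t * t\<^sup>2) \<partial>lborel)"
    by (rule nn_integral_cmult) simp
  also have "(\<integral>\<^sup>+t. ennreal (std_normal_density t * t\<^sup>2) \<partial>lborel) = 1"
    using h by (subst nn_integral_eq_integral) (auto simp: has_bochner_integral_iff)
  finally show ?thesis by simp
qed

section \<open>Interval and tail bounds for the one-dimensional Gaussian\<close>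

lemma N01_interval_le: "emeasure N01 {t. \<bar>t - c\<bar> \<le> \<tau>} \<le> ennreal \<tau>" if "0 \<le> \<tau>"
proof -
  have eq: "{t. \<bar>t - c\<bar> \<le> \<tau>} = {c - \<tau>..c + \<tau>}" by auto
  have "2\<^sup>2 \<le> 2 * pi" using pi_ge_two by simp
  then have "2 \<le> sqrt (2 * pi)" by (rule real_le_rsqrt)
  then have "1 / sqrt (2 * pi) \<le> 1 / 2" by (intro divide_left_mono) auto
  then have "1 / sqrt (2 * pi) * exp (- t\<^sup>2 / 2) \<le> 1 / 2 * 1" for t by (intro mult_mono) auto
  then have le: "std_normal_density t \<le> 1 / 2" for t unfolding std_normal_density_def by simp
  have "emeasure N01 {c - \<tau>..c + \<tau>} = (\<integral>\<^sup>+t. ennreal (std_normal_density t) * indicator {c - \<tau>..c + \<tau>} t \<partial>lborel)"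
    by (subst emeasure_density) auto
  also have "\<dots> \<le> (\<integral>\<^sup>+t. ennreal (1/2) * indicator {c - \<tau>..c + \<tau>} t \<partial>lborel)"
    using le by (intro nn_integral_mono mult_right_mono ennreal_leI) auto
  also have "\<dots> = ennreal (1/2) * ennreal (2 * \<tau>)"
    using that by (subst nn_integral_cmult_indicator) auto
  also have "\<dots> = ennreal \<tau>" using that by (simp add: ennreal_mult[symmetric] del: ennreal_half)
  finally show ?thesis unfolding eq .
qed

lemma N01_nonneg: "measure N01 {0..} = 1 / 2"
proof -
  interpret N: prob_space N01 by (rule prob_space_N01)
  have ms: "emeasure N01 {0} = 0" by (subst emeasure_density) (auto simp: nn_integral_indicator_singleton)
  have "emeasure N01 {0<..} = (\<integral>\<^sup>+t. ennreal (std_normal_density t) * indicator {0<..} t \<partial>lborel)"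
    by (subst emeasure_density) auto
  also have "\<dots> = (\<integral>\<^sup>+t. ennreal (std_normal_density (0 + (-1) * t)) * indicator {0<..} (0 + (-1) * t) \<partial>lborel)"
    by (subst nn_integral_real_affine[of _ "-1" 0]) auto
  also have "\<dots> = (\<integral>\<^sup>+t. ennreal (std_normal_density t) * indicator {..<0} t \<partial>lborel)"
    by (rule nn_integral_cong) (auto simp: std_normal_density_def indicator_def)
  also have "\<dots> = emeasure N01 {..<0}" by (subst emeasure_density) auto
  finally have sym: "measure N01 {0<..} = measure N01 {..<0}" by (simp add: N.emeasure_eq_measure)
  have z: "measure N01 {0} = 0" using ms by (simp add: N.emeasure_eq_measure)
  have "measure N01 ({0} \<union> {0<..}) = measure N01 {0} + measure N01 {0<..}"
    by (rule N.finite_measure_Union) auto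
  moreover have "{0} \<union> {0<..} = {0::real..}" by auto
  ultimately have p: "measure N01 {0..} = measure N01 {0<..}" using z by simp
  have "measure N01 ({..<0} \<union> {0..}) = measure N01 {..<0} + measure N01 {0..}"
    by (rule N.finite_measure_Union) auto
  moreover have "{..<0} \<union> {0::real..} = UNIV" by auto
  ultimately have "measure N01 {..<0} + measure N01 {0..} = 1" using N.prob_space by simp
  then show ?thesis using p sym by simp
qed

text \<open>The density is at least 1/6 on the unit interval, so moving the threshold from 0 to
  \<open>min x 1\<close> removes at least a sixth of that length from the mass 1/2.\<close>

lemma N01_tail_le:
  assumes "0 \<le> x"
  shows "measure N01 {x..} \<le> 1 / 2 - min x 1 / 6"
proof -
  interpret N: prob_space N01 by (rule prob_space_N01)
  define y where "y = min x 1"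
  have y: "0 \<le> y" "y \<le> 1" "y \<le> x" using assms by (auto simp: y_def)
  have ge: "1 / 6 \<le> std_normal_density t" if "0 \<le> t" "t \<le> 1" for t
  proof -
    have "2 * pi \<le> 3\<^sup>2" using pi_less_4 by simp
    then have "sqrt (2 * pi) \<le> 3" by (rule real_le_lsqrt[rotated -1]) auto
    then have a: "1 / 3 \<le> 1 / sqrt (2 * pi)" by (intro divide_left_mono) auto
    have "t\<^sup>2 \<le> 1" using that by (simp add: power_le_one)
    then have b: "1 / 2 \<le> exp (- t\<^sup>2 / 2)" using exp_ge_add_one_self[of "- t\<^sup>2 / 2"] by simp
    have "1 / 3 * (1 / 2) \<le> 1 / sqrt (2 * pi) * exp (- t\<^sup>2 / 2)" by (rule mult_mono[OF a b]) auto
    then show ?thesis by (simp add: std_normal_density_def)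
  qed
  have "ennreal (1 / 6) * ennreal y = (\<integral>\<^sup>+t. ennreal (1/6) * indicator {0..<y} t \<partial>lborel)"
    using y by (subst nn_integral_cmult_indicator) auto
  also have "\<dots> \<le> (\<integral>\<^sup>+t. ennreal (std_normal_density t) * indicator {0..<y} t \<partial>lborel)"
    using ge y by (intro nn_integral_mono) (auto simp: indicator_def intro!: ennreal_leI)
  also have "\<dots> = emeasure N01 {0..<y}" by (subst emeasure_density) auto
  finally have "y / 6 \<le> measure N01 {0..<y}"
    using y by (simp add: N.emeasure_eq_measure ennreal_mult[symmetric])
  moreover have "measure N01 ({0..<y} \<union> {y..}) = measure N01 {0..<y} + measure N01 {y..}"
    by (rule N.finite_measure_Union) auto
  moreover have "{0..<y} \<union> {y..} = {0..}" using y by auto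
  moreover have "measure N01 {x..} \<le> measure N01 {y..}" using y by (intro N.finite_measure_mono) auto
  ultimately show ?thesis using N01_nonneg by (simp add: y_def)
qed

section \<open>The forms \<langle>V^T z, w\<rangle> and \<parallel>V^T z\<parallel>^2 in standard
  Gaussian z and w\<close>

definition gform :: "nat \<Rightarrow> nat \<Rightarrow> (nat \<Rightarrow> nat \<Rightarrow> real) \<Rightarrow> (nat \<Rightarrow> real) \<Rightarrow> (nat \<Rightarrow> real) \<Rightarrow> real" where
  "gform p m V z w = (\<Sum>j<m. (\<Sum>i<p. V i j * z i) * w j)"

definition qform :: "nat \<Rightarrow> nat \<Rightarrow> (nat \<Rightarrow> nat \<Rightarrow> real) \<Rightarrow> (nat \<Rightarrow> real) \<Rightarrow> real" where
  "qform p m V z = (\<Sum>j<m. (\<Sum>i<p. V i j * z i)\<^sup>2)"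

definition gauss2 :: "nat \<Rightarrow> nat \<Rightarrow> ((nat \<Rightarrow> real) \<times> (nat \<Rightarrow> real)) measure" where
  "gauss2 p m = std_gauss p \<Otimes>\<^sub>M std_gauss m"

lemma qform_nonneg: "0 \<le> qform p m V z"
  unfolding qform_def by (intro sum_nonneg) simp

lemma fro2_nonneg: "0 \<le> fro2 p m V"
  unfolding fro2_def by (intro sum_nonneg) simp

lemma prob_space_gauss2: "prob_space (gauss2 p m)"
proof -
  interpret A: prob_space "std_gauss p" by (rule prob_space_std_gauss)
  interpret B: prob_space "std_gauss m" by (rule prob_space_std_gauss)
  interpret pair_prob_space "std_gauss p" "std_gauss m" ..
  show ?thesis unfolding gauss2_def by unfold_locales
qed

lemma nn_integral_gauss2:
  assumes "f \<in> borel_measurable (gauss2 p m)"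
  shows "(\<integral>\<^sup>+u. f u \<partial>gauss2 p m) = (\<integral>\<^sup>+z. \<integral>\<^sup>+w. f (z, w) \<partial>std_gauss m \<partial>std_gauss p)"
proof -
  interpret B: prob_space "std_gauss m" by (rule prob_space_std_gauss)
  show ?thesis using assms unfolding gauss2_def by (rule B.nn_integral_fst[symmetric])
qed

lemma measurable_lin [measurable]: "(\<lambda>z. \<Sum>i<p. a i * z i) \<in> borel_measurable (std_gauss p)"
  by (intro borel_measurable_sum borel_measurable_times measurable_std_gauss_component) auto

lemma measurable_qform [measurable]: "qform p m V \<in> borel_measurable (std_gauss p)"
  unfolding qform_def[abs_def] by measurable

lemma measurable_qform_gauss2 [measurable]: "(\<lambda>u. qform p m V (fst u)) \<in> borel_measurable (gauss2 p m)"
  unfolding gauss2_def by measurable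

lemma measurable_gform [measurable]: "(\<lambda>u. gform p m V (fst u) (snd u)) \<in> borel_measurable (gauss2 p m)"
proof -
  have L: "(\<lambda>u. \<Sum>i<p. V i j * fst u i) \<in> borel_measurable (gauss2 p m)" for j
    unfolding gauss2_def using measurable_compose[OF measurable_fst measurable_lin] by simp
  have W: "(\<lambda>u. snd u j) \<in> borel_measurable (gauss2 p m)" if "j \<in> {..<m}" for j
    unfolding gauss2_def using that measurable_compose[OF measurable_snd measurable_std_gauss_component[of j m]] by simp
  show ?thesis unfolding gform_def
  proof (rule borel_measurable_sum)
    fix j assume "j \<in> {..<m}"
    then show "(\<lambda>u. (\<Sum>i<p. V i j * fst u i) * snd u j) \<in> borel_measurable (gauss2 p m)"
      by (intro borel_measurable_times L W)
  qed
qed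

text \<open>Given z, the bilinear form is a centred Gaussian with variance
  \<open>qform p m V z\<close>. Its moments, small balls and signs are estimated by integrating w
  out first and then controlling this random variance.\<close>

lemma inner_gform:
  fixes f :: "real \<Rightarrow> ennreal"
  assumes "f \<in> borel_measurable borel"
  shows "(\<integral>\<^sup>+w. f (gform p m V z w) \<partial>std_gauss m) = (\<integral>\<^sup>+t. f (sqrt (qform p m V z) * t) \<partial>N01)"
  unfolding gform_def qform_def by (rule nn_integral_std_gauss_linear[OF assms])

text \<open>Convexity of \<open>exp\<close> reduces the quadratic form to a single squared Gaussian, without diagonalising \<open>V\<close>.\<close>

lemma nn_integral_exp_qform_le:
  "(\<integral>\<^sup>+z. ennreal (exp (b * qform p m V z)) \<partial>std_gauss p) \<le> (\<integral>\<^sup>+t. ennreal (exp (b * fro2 p m V * t\<^sup>2)) \<partial>N01)"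
proof (cases "fro2 p m V = 0")
  case True
  then have "\<forall>i\<in>{..<p}. (\<Sum>j<m. (V i j)\<^sup>2) = 0"
    unfolding fro2_def by (subst (asm) sum_nonneg_eq_0_iff) (auto intro: sum_nonneg)
  then have "\<forall>i\<in>{..<p}. \<forall>j\<in>{..<m}. V i j = 0"
    by (subst (asm) sum_nonneg_eq_0_iff) auto
  then have "qform p m V z = 0" for z unfolding qform_def by simp
  then show ?thesis
    using True prob_space.emeasure_space_1[OF prob_space_std_gauss] prob_space.emeasure_space_1[OF prob_space_N01] by simp
next
  case False
  define c where "c = fro2 p m V"
  have c: "0 < c" using False fro2_nonneg[of p m V] by (simp add: c_def)
  define L where "L j z = (\<Sum>i<p. V i j * z i)" for j z
  define v where "v j = (\<Sum>i<p. (V i j)\<^sup>2)" for j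
  have v0: "0 \<le> v j" for j unfolding v_def by (intro sum_nonneg) simp
  have sv: "(\<Sum>j<m. v j) = c" unfolding v_def c_def fro2_def by (rule sum.swap)
  have m0: "{..<m} \<noteq> {}" using c sv by (cases "m = 0") auto
  have L0: "L j z = 0" if "v j = 0" for j z
  proof -
    have "\<forall>i\<in>{..<p}. (V i j)\<^sup>2 = 0" using that unfolding v_def by (subst (asm) sum_nonneg_eq_0_iff) auto
    then show ?thesis unfolding L_def by simp
  qed
  have [measurable]: "L j \<in> borel_measurable (std_gauss p)" for j unfolding L_def[abs_def] by measurable
  have "exp (b * qform p m V z) \<le> (\<Sum>j<m. v j / c * exp (b * c * ((L j z)\<^sup>2 / v j)))" for z
  proof -
    \<comment> \<open>The \<open>v j / c\<close> are convex weights and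
      \<open>L j z / sqrt (v j)\<close> is standard Gaussian. When \<open>v j = 0\<close>, division
      yields 0 and \<open>L j z = 0\<close>, so the identity survives.\<close>
    have "v j / c * (b * c * ((L j z)\<^sup>2 / v j)) = b * (L j z)\<^sup>2" for j
      using c L0[of j z] by (cases "v j = 0") auto
    then have "b * qform p m V z = (\<Sum>j<m. (v j / c) *\<^sub>R (b * c * ((L j z)\<^sup>2 / v j)))"
      unfolding qform_def L_def[symmetric] by (simp add: sum_distrib_left)
    also have "exp \<dots> \<le> (\<Sum>j<m. v j / c * exp (b * c * ((L j z)\<^sup>2 / v j)))"
      using m0 c v0 sv by (intro convex_on_sum[OF _ _ exp_convex]) (auto simp: sum_divide_distrib[symmetric])
    finally show ?thesis .
  qed
  then have "(\<integral>\<^sup>+z. ennreal (exp (b * qform p m V z)) \<partial>std_gauss p) \<le>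
      (\<integral>\<^sup>+z. (\<Sum>j<m. ennreal (v j / c) * ennreal (exp (b * c * ((L j z)\<^sup>2 / v j)))) \<partial>std_gauss p)"
    using v0 c by (intro nn_integral_mono) (simp add: ennreal_mult[symmetric] sum_ennreal ennreal_leI)
  also have "\<dots> = (\<Sum>j<m. ennreal (v j / c) * (\<integral>\<^sup>+z. ennreal (exp (b * c * ((L j z)\<^sup>2 / v j))) \<partial>std_gauss p))"
    by (subst nn_integral_sum) (auto intro!: sum.cong nn_integral_cmult)
  also have "\<dots> = (\<Sum>j<m. ennreal (v j / c) * (\<integral>\<^sup>+t. ennreal (exp (b * c * t\<^sup>2)) \<partial>N01))"
  proof (rule sum.cong)
    fix j
    show "ennreal (v j / c) * (\<integral>\<^sup>+z. ennreal (exp (b * c * ((L j z)\<^sup>2 / v j))) \<partial>std_gauss p) =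
        ennreal (v j / c) * (\<integral>\<^sup>+t. ennreal (exp (b * c * t\<^sup>2)) \<partial>N01)"
    proof (cases "v j = 0")
      case False
      have "(\<integral>\<^sup>+z. ennreal (exp (b * c * ((L j z)\<^sup>2 / v j))) \<partial>std_gauss p) =
          (\<integral>\<^sup>+t. ennreal (exp (b * c * ((sqrt (v j) * t)\<^sup>2 / v j))) \<partial>N01)"
        unfolding L_def v_def
        by (rule nn_integral_std_gauss_linear[where f = "\<lambda>x. ennreal (exp (b * c * (x\<^sup>2 / (\<Sum>i<p. (V i j)\<^sup>2))))"]) measurable
      then show ?thesis using False v0[of j] by (simp add: power_mult_distrib)
    qed simp
  qed simp
  also have "\<dots> = (\<integral>\<^sup>+t. ennreal (exp (b * c * t\<^sup>2)) \<partial>N01)"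
    using v0 c sv by (simp add: sum_distrib_right[symmetric] sum_ennreal sum_divide_distrib[symmetric])
  finally show ?thesis unfolding c_def .
qed

lemma nn_integral_exp_qform_le1:
  assumes "fro2 p m V \<le> 1" "0 \<le> b" "2 * b < 1"
  shows "(\<integral>\<^sup>+z. ennreal (exp (b * qform p m V z)) \<partial>std_gauss p) \<le> ennreal (1 / sqrt (1 - 2 * b))"
proof -
  have "(\<integral>\<^sup>+z. ennreal (exp (b * qform p m V z)) \<partial>std_gauss p) \<le> (\<integral>\<^sup>+t. ennreal (exp (b * fro2 p m V * t\<^sup>2)) \<partial>N01)"
    by (rule nn_integral_exp_qform_le)
  also have "\<dots> \<le> (\<integral>\<^sup>+t. ennreal (exp (- (- b) * t\<^sup>2)) \<partial>N01)"
    using assms fro2_nonneg[of p m V] by (intro nn_integral_mono ennreal_leI) (auto intro!: mult_right_mono mult_left_le)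
  also have "\<dots> = ennreal (1 / sqrt (1 + 2 * (- b)))"
    using assms by (intro nn_integral_N01_exp_sq) simp
  finally show ?thesis by simp
qed

lemma nn_integral_qform: "(\<integral>\<^sup>+z. ennreal (qform p m V z) \<partial>std_gauss p) = ennreal (fro2 p m V)"
proof -
  have "(\<integral>\<^sup>+z. ennreal (qform p m V z) \<partial>std_gauss p) = (\<integral>\<^sup>+z. (\<Sum>j<m. ennreal ((\<Sum>i<p. V i j * z i)\<^sup>2)) \<partial>std_gauss p)"
    unfolding qform_def by (simp add: sum_ennreal)
  also have "\<dots> = (\<Sum>j<m. \<integral>\<^sup>+z. ennreal ((\<Sum>i<p. V i j * z i)\<^sup>2) \<partial>std_gauss p)"
    by (rule nn_integral_sum) measurable
  also have "\<dots> = (\<Sum>j<m. ennreal (\<Sum>i<p. (V i j)\<^sup>2))"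
  proof (rule sum.cong)
    fix j
    have "(\<integral>\<^sup>+z. ennreal ((\<Sum>i<p. V i j * z i)\<^sup>2) \<partial>std_gauss p) = (\<integral>\<^sup>+t. ennreal ((sqrt (\<Sum>i<p. (V i j)\<^sup>2) * t)\<^sup>2) \<partial>N01)"
      by (rule nn_integral_std_gauss_linear[where f = "\<lambda>x. ennreal (x\<^sup>2)"]) measurable
    also have "\<dots> = (\<integral>\<^sup>+t. ennreal ((\<Sum>i<p. (V i j)\<^sup>2) * t\<^sup>2) \<partial>N01)"
      by (simp add: power_mult_distrib sum_nonneg)
    also have "\<dots> = ennreal (\<Sum>i<p. (V i j)\<^sup>2)" by (intro nn_integral_N01_sq sum_nonneg) simp
    finally show "(\<integral>\<^sup>+z. ennreal ((\<Sum>i<p. V i j * z i)\<^sup>2) \<partial>std_gauss p) = ennreal (\<Sum>i<p. (V i j)\<^sup>2)" .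
  qed simp
  also have "\<dots> = ennreal (fro2 p m V)"
    by (subst sum_ennreal) (auto intro: sum_nonneg simp: fro2_def sum.swap[of _ "{..<m}"])
  finally show ?thesis .
qed

lemma nn_integral_qform_gauss2: "(\<integral>\<^sup>+u. ennreal (qform p m V (fst u)) \<partial>gauss2 p m) = ennreal (fro2 p m V)"
  using prob_space.emeasure_space_1[OF prob_space_std_gauss]
  by (subst nn_integral_gauss2) (auto simp: nn_integral_qform)

lemma nn_integral_gform_sq: "(\<integral>\<^sup>+u. ennreal ((gform p m V (fst u) (snd u))\<^sup>2) \<partial>gauss2 p m) = ennreal (fro2 p m V)"
proof -
  have "(\<integral>\<^sup>+w. ennreal ((gform p m V z w)\<^sup>2) \<partial>std_gauss m) = ennreal (qform p m V z)" for z
  proof -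
    have "(\<integral>\<^sup>+w. ennreal ((gform p m V z w)\<^sup>2) \<partial>std_gauss m) = (\<integral>\<^sup>+t. ennreal ((sqrt (qform p m V z) * t)\<^sup>2) \<partial>N01)"
      by (rule inner_gform[where f = "\<lambda>x. ennreal (x\<^sup>2)"]) measurable
    also have "\<dots> = ennreal (qform p m V z)"
      using nn_integral_N01_sq[OF qform_nonneg] by (simp add: power_mult_distrib qform_nonneg)
    finally show ?thesis .
  qed
  then show ?thesis by (subst nn_integral_gauss2) (auto simp: nn_integral_qform)
qed

lemma nn_integral_exp_qform_gauss2:
  assumes "fro2 p m V \<le> 1"
  shows "(\<integral>\<^sup>+u. ennreal (exp (1/4 * qform p m V (fst u))) \<partial>gauss2 p m) \<le> ennreal (exp 2)"
proof -
  have "(\<integral>\<^sup>+u. ennreal (exp (1/4 * qform p m V (fst u))) \<partial>gauss2 p m) = (\<integral>\<^sup>+z. ennreal (exp (1/4 * qform p m V z)) \<partial>std_gauss p)"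
    using prob_space.emeasure_space_1[OF prob_space_std_gauss] by (subst nn_integral_gauss2) auto
  also have "\<dots> \<le> ennreal (1 / sqrt (1 - 2 * (1/4)))"
    by (rule nn_integral_exp_qform_le1) (use assms in auto)
  also have "\<dots> \<le> ennreal (exp 2)"
  proof (rule ennreal_leI)
    have "1/2 \<le> sqrt (1 - 2 * (1/4))" by (rule real_le_rsqrt) (simp add: power2_eq_square)
    then have "1 / sqrt (1 - 2 * (1/4)) \<le> 1 / (1/2)" by (intro divide_left_mono) auto
    then show "1 / sqrt (1 - 2 * (1/4)) \<le> exp 2" using exp_ge_add_one_self[of 2] by simp
  qed
  finally show ?thesis .
qed

text \<open>Summing over both signs leaves two Gaussian Laplace transforms, each
  \<open>exp (q / 32)\<close> in the conditional variance q; this is relaxed to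
  \<open>exp (q / 4)\<close>, still inside the domain \<open>2 * b < 1\<close> of the quadratic
  moment.\<close>

lemma nn_integral_exp_abs_gform:
  assumes "fro2 p m V \<le> 1"
  shows "(\<integral>\<^sup>+u. ennreal (exp (1/4 * \<bar>gform p m V (fst u) (snd u)\<bar>)) \<partial>gauss2 p m) \<le> ennreal (exp 4)"
proof -
  have inner: "(\<integral>\<^sup>+w. ennreal (exp (1/4 * \<bar>gform p m V z w\<bar>)) \<partial>std_gauss m) \<le> ennreal 2 * ennreal (exp (1/4 * qform p m V z))" for z
  proof -
    let ?s = "sqrt (qform p m V z)"
    have "(\<integral>\<^sup>+w. ennreal (exp (1/4 * \<bar>gform p m V z w\<bar>)) \<partial>std_gauss m) = (\<integral>\<^sup>+t. ennreal (exp (1/4 * \<bar>?s * t\<bar>)) \<partial>N01)"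
      by (rule inner_gform[where f = "\<lambda>x. ennreal (exp (1/4 * \<bar>x\<bar>))"]) measurable
    also have "\<dots> \<le> (\<integral>\<^sup>+t. ennreal (exp (?s / 4 * t)) + ennreal (exp (- ?s / 4 * t)) \<partial>N01)"
      by (intro nn_integral_mono) (auto simp: abs_if ennreal_plus[symmetric] simp del: ennreal_plus intro!: ennreal_leI)
    also have "\<dots> = ennreal (exp ((?s / 4)\<^sup>2 / 2)) + ennreal (exp ((- ?s / 4)\<^sup>2 / 2))"
      by (subst nn_integral_add) (auto simp: nn_integral_N01_exp_linear[of "?s / 4", simplified] nn_integral_N01_exp_linear[of "- ?s / 4", simplified])
    also have "\<dots> = ennreal (2 * exp (qform p m V z / 32))"
      using qform_nonneg[of p m V z] by (simp add: power_divide ennreal_plus[symmetric] del: ennreal_plus)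
    also have "\<dots> \<le> ennreal (2 * exp (1/4 * qform p m V z))"
      using qform_nonneg[of p m V z] by (intro ennreal_leI) simp
    finally show ?thesis by (simp add: ennreal_mult')
  qed
  have "(\<integral>\<^sup>+u. ennreal (exp (1/4 * \<bar>gform p m V (fst u) (snd u)\<bar>)) \<partial>gauss2 p m) =
      (\<integral>\<^sup>+z. \<integral>\<^sup>+w. ennreal (exp (1/4 * \<bar>gform p m V z w\<bar>)) \<partial>std_gauss m \<partial>std_gauss p)"
    by (subst nn_integral_gauss2) auto
  also have "\<dots> \<le> (\<integral>\<^sup>+z. ennreal 2 * ennreal (exp (1/4 * qform p m V z)) \<partial>std_gauss p)"
    by (intro nn_integral_mono inner)
  also have "\<dots> = ennreal 2 * (\<integral>\<^sup>+z. ennreal (exp (1/4 * qform p m V z)) \<partial>std_gauss p)"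
    by (rule nn_integral_cmult) measurable
  also have "(\<integral>\<^sup>+z. ennreal (exp (1/4 * qform p m V z)) \<partial>std_gauss p) = (\<integral>\<^sup>+u. ennreal (exp (1/4 * qform p m V (fst u))) \<partial>gauss2 p m)"
    using prob_space.emeasure_space_1[OF prob_space_std_gauss] by (subst nn_integral_gauss2) auto
  also have "ennreal 2 * \<dots> \<le> ennreal 2 * ennreal (exp 2)"
    by (intro mult_left_mono nn_integral_exp_qform_gauss2 assms) simp
  also have "\<dots> \<le> ennreal (exp 4)"
  proof -
    have "2 * exp 2 \<le> exp 2 * exp (2::real)" using exp_ge_add_one_self[of 2] by (intro mult_right_mono) auto
    then have "2 * exp 2 \<le> exp (4::real)" by (simp add: mult_exp_exp)
    then show ?thesis by (simp add: ennreal_mult'[symmetric] ennreal_leI del: ennreal_numeral)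
  qed
  finally show ?thesis .
qed

text \<open>By the convexity bound the Laplace transform is at most that of a single squared
  Gaussian, whatever the rank. It quantifies how rarely the conditional variance is close to
  0.\<close>

lemma nn_integral_exp_neg_qform:
  assumes "fro2 p m V = 1" "0 < b"
  shows "(\<integral>\<^sup>+z. ennreal (exp (- b * qform p m V z)) \<partial>std_gauss p) \<le> ennreal (1 / sqrt (1 + 2 * b))"
  using nn_integral_exp_qform_le[where b = "- b" and p = p and m = m and V = V] nn_integral_N01_exp_sq[of b] assms by simp

lemma inverse_sqrt_le: "0 < e \<Longrightarrow> 1 / sqrt (1 + 2 * (1 / e\<^sup>2)) \<le> e"
proof -
  assume e: "0 < e"
  have pos: "0 \<le> 1 / e\<^sup>2" by simp
  then have "1 / e\<^sup>2 \<le> 1 + 2 * (1 / e\<^sup>2)" by linarith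
  then have le: "1 / e \<le> sqrt (1 + 2 * (1 / e\<^sup>2))" by (intro real_le_rsqrt) (simp add: power_divide)
  have "0 < sqrt (1 + 2 * (1 / e\<^sup>2))" using pos by (simp only: real_sqrt_gt_0_iff)
  then have "1 / sqrt (1 + 2 * (1 / e\<^sup>2)) \<le> 1 / (1 / e)"
    using e by (intro divide_left_mono[OF le] mult_pos_pos) auto
  then show ?thesis by simp
qed

text \<open>The conditional density is not bounded uniformly in z, since the conditional variance q
  can be arbitrarily small. For \<open>q > \<tau>\<close> it still gives
  \<open>\<tau> / sqrt q \<le> sqrt \<tau>\<close>, and \<open>q \<le> \<tau>\<close> has
  probability of order \<open>sqrt \<tau>\<close> by the Laplace transform. The shift
  \<open>s q\<close> is fixed given z and merely recentres the interval.\<close>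

lemma small_ball:
  assumes V: "fro2 p m V = 1" and \<tau>: "0 < \<tau>"
  shows "emeasure (gauss2 p m) {u\<in>space (gauss2 p m). \<bar>gform p m V (fst u) (snd u) - s * qform p m V (fst u)\<bar> \<le> \<tau>} \<le> ennreal (4 * sqrt \<tau>)"
proof -
  let ?F = "\<lambda>z w. gform p m V z w - s * qform p m V z"
  have inner: "(\<integral>\<^sup>+w. indicator {x. \<bar>x - s * qform p m V z\<bar> \<le> \<tau>} (gform p m V z w) \<partial>std_gauss m)
      \<le> ennreal (exp 1) * ennreal (exp (- (1 / \<tau>) * qform p m V z)) + ennreal (sqrt \<tau>)" for z
  proof -
    let ?q = "qform p m V z"
    have "(\<integral>\<^sup>+w. indicator {x. \<bar>x - s * ?q\<bar> \<le> \<tau>} (gform p m V z w) \<partial>std_gauss m) =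
        (\<integral>\<^sup>+t. indicator {x. \<bar>x - s * ?q\<bar> \<le> \<tau>} (sqrt ?q * t) \<partial>N01)"
      by (rule inner_gform) measurable
    also have "\<dots> = (\<integral>\<^sup>+t. indicator {t. \<bar>sqrt ?q * t - s * ?q\<bar> \<le> \<tau>} t \<partial>N01)"
      by (intro nn_integral_cong) (simp add: indicator_def)
    also have "\<dots> = emeasure N01 {t. \<bar>sqrt ?q * t - s * ?q\<bar> \<le> \<tau>}"
      by (rule nn_integral_indicator) simp
    also have "\<dots> \<le> ennreal (exp 1) * ennreal (exp (- (1 / \<tau>) * ?q)) + ennreal (sqrt \<tau>)"
    proof (cases "?q \<le> \<tau>")
      case True
      interpret prob_space N01 by (rule prob_space_N01)
      have "emeasure N01 {t. \<bar>sqrt ?q * t - s * ?q\<bar> \<le> \<tau>} \<le> 1" by (rule emeasure_le_1)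
      \<comment> \<open>An exponential majorant of the indicator of \<open>?q \<le> \<tau>\<close>,
        whose integral is under control.\<close>
      also have "1 \<le> ennreal (exp (1 - ?q / \<tau>))" using True \<tau> by simp
      also have "\<dots> = ennreal (exp 1) * ennreal (exp (- (1 / \<tau>) * ?q))"
        by (simp add: ennreal_mult[symmetric] mult_exp_exp)
      finally show ?thesis by (rule add_increasing2[OF zero_le])
    next
      case False
      then have q: "0 < ?q" using \<tau> by linarith
      then have sq: "0 < sqrt ?q" "sqrt ?q * sqrt ?q = ?q" by auto
      have "\<bar>sqrt ?q * t - s * ?q\<bar> = sqrt ?q * \<bar>t - s * sqrt ?q\<bar>" for t
      proof -
        have "sqrt ?q * t - s * ?q = sqrt ?q * (t - s * sqrt ?q)" using sq(2) by (simp add: algebra_simps)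
        then show ?thesis using sq(1) by (simp add: abs_mult)
      qed
      then have "{t. \<bar>sqrt ?q * t - s * ?q\<bar> \<le> \<tau>} = {t. \<bar>t - s * sqrt ?q\<bar> \<le> \<tau> / sqrt ?q}"
        using sq(1) by (auto simp: field_simps)
      then have "emeasure N01 {t. \<bar>sqrt ?q * t - s * ?q\<bar> \<le> \<tau>} \<le> ennreal (\<tau> / sqrt ?q)"
        using N01_interval_le[of "\<tau> / sqrt ?q" "s * sqrt ?q"] sq \<tau> by simp
      also have "\<tau> / sqrt ?q \<le> \<tau> / sqrt \<tau>" using False \<tau> q by (intro divide_left_mono) auto
      also have "\<tau> / sqrt \<tau> = sqrt \<tau>" using \<tau> by (simp add: real_div_sqrt)
      finally have "emeasure N01 {t. \<bar>sqrt ?q * t - s * ?q\<bar> \<le> \<tau>} \<le> ennreal (sqrt \<tau>)" by (simp add: ennreal_leI)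
      then show ?thesis by (rule add_increasing[OF zero_le])
    qed
    finally show ?thesis .
  qed
  let ?A = "{u\<in>space (gauss2 p m). \<bar>?F (fst u) (snd u)\<bar> \<le> \<tau>}"
  have "emeasure (gauss2 p m) ?A = (\<integral>\<^sup>+u. indicator ?A u \<partial>gauss2 p m)" by simp
  also have "\<dots> = (\<integral>\<^sup>+u. indicator {x. \<bar>x\<bar> \<le> \<tau>} (?F (fst u) (snd u)) \<partial>gauss2 p m)"
    by (intro nn_integral_cong) (auto simp: indicator_def)
  also have "\<dots> = (\<integral>\<^sup>+z. \<integral>\<^sup>+w. indicator {x. \<bar>x\<bar> \<le> \<tau>} (?F z w) \<partial>std_gauss m \<partial>std_gauss p)"
    by (subst nn_integral_gauss2) auto
  also have "\<dots> = (\<integral>\<^sup>+z. \<integral>\<^sup>+w. indicator {x. \<bar>x - s * qform p m V z\<bar> \<le> \<tau>} (gform p m V z w) \<partial>std_gauss m \<partial>std_gauss p)"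
    by (intro nn_integral_cong) (auto simp: indicator_def)
  also have "\<dots> \<le> (\<integral>\<^sup>+z. ennreal (exp 1) * ennreal (exp (- (1 / \<tau>) * qform p m V z)) + ennreal (sqrt \<tau>) \<partial>std_gauss p)"
    by (intro nn_integral_mono inner)
  also have "\<dots> = ennreal (exp 1) * (\<integral>\<^sup>+z. ennreal (exp (- (1 / \<tau>) * qform p m V z)) \<partial>std_gauss p) + ennreal (sqrt \<tau>)"
    using prob_space.emeasure_space_1[OF prob_space_std_gauss]
    by (subst nn_integral_add) (auto simp: nn_integral_cmult)
  also have "\<dots> \<le> ennreal (exp 1) * ennreal (sqrt \<tau>) + ennreal (sqrt \<tau>)"
  proof -
    have "(\<integral>\<^sup>+z. ennreal (exp (- (1 / \<tau>) * qform p m V z)) \<partial>std_gauss p) \<le> ennreal (1 / sqrt (1 + 2 * (1 / \<tau>)))"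
      using \<tau> by (intro nn_integral_exp_neg_qform V) simp
    also have "\<dots> \<le> ennreal (sqrt \<tau>)"
      using inverse_sqrt_le[of "sqrt \<tau>"] \<tau> by (intro ennreal_leI) simp
    finally show ?thesis by (intro add_right_mono mult_left_mono) auto
  qed
  also have "\<dots> = ennreal ((exp 1 + 1) * sqrt \<tau>)"
    using \<tau> by (simp add: ennreal_mult[symmetric] ennreal_plus[symmetric] distrib_right del: ennreal_plus)
  also have "\<dots> \<le> ennreal (4 * sqrt \<tau>)"
    using exp_le \<tau> by (intro ennreal_leI mult_right_mono) auto
  finally show ?thesis .
qed

lemma ennreal_affine:
  "0 \<le> a \<Longrightarrow> 0 \<le> b \<Longrightarrow> 0 \<le> x \<Longrightarrow> 0 \<le> y \<Longrightarrow> ennreal (a + b * x + y) = ennreal a + ennreal b * ennreal x + ennreal y"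
  by (simp add: ennreal_mult)

text \<open>Given z the probability is a Gaussian tail at \<open>s * sqrt q\<close>, hence at most
  \<open>1/2 - min (s * sqrt q) 1 / 6\<close>. The minimum is at least
  \<open>s * (1 - exp (- q / 2))\<close>, whose mean is at least s/4 because
  \<open>1 / sqrt 2 \<le> 3 / 4\<close>; this gives s/24. The arbitrary \<open>e\<close> pays for
  \<open>q = 0\<close>, where the event is certain.\<close>

lemma half_space_prob:
  assumes V: "fro2 p m V = 1" and s: "0 \<le> s" "s \<le> 1"
  shows "measure (gauss2 p m) {u\<in>space (gauss2 p m). 0 \<le> gform p m V (fst u) (snd u) - s * qform p m V (fst u)} \<le> 1 / 2 - s / 24"
proof (rule field_le_epsilon)
  fix e :: real assume e: "0 < e"
  let ?F = "\<lambda>z w. gform p m V z w - s * qform p m V z"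
  let ?c = "1 / 2 - s / 6"
  have c: "0 \<le> ?c" using s by simp
  have inner: "(\<integral>\<^sup>+w. indicator {x. 0 \<le> x - s * qform p m V z} (gform p m V z w) \<partial>std_gauss m)
      \<le> ennreal ?c + ennreal (s / 6) * ennreal (exp (- (1 / 2) * qform p m V z)) + ennreal (exp (- (1 / e\<^sup>2) * qform p m V z))" for z
  proof -
    let ?q = "qform p m V z"
    interpret N: prob_space N01 by (rule prob_space_N01)
    have "(\<integral>\<^sup>+w. indicator {x. 0 \<le> x - s * ?q} (gform p m V z w) \<partial>std_gauss m) =
        (\<integral>\<^sup>+t. indicator {x. 0 \<le> x - s * ?q} (sqrt ?q * t) \<partial>N01)"
      by (rule inner_gform) measurable
    also have "\<dots> = (\<integral>\<^sup>+t. indicator {t. 0 \<le> sqrt ?q * t - s * ?q} t \<partial>N01)"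
      by (intro nn_integral_cong) (simp add: indicator_def)
    also have "\<dots> = emeasure N01 {t. 0 \<le> sqrt ?q * t - s * ?q}"
      by (rule nn_integral_indicator) simp
    also have "\<dots> \<le> ennreal (?c + s / 6 * exp (- (1 / 2) * ?q) + exp (- (1 / e\<^sup>2) * ?q))"
    \<comment> \<open>At \<open>q = 0\<close> the last exponential equals 1, while its mean is at
      most \<open>e\<close>; it stands for the fact that q is almost surely positive.\<close>
    proof (cases "?q = 0")
      case True
      then have "1 \<le> ?c + s / 6 * exp (- (1 / 2) * ?q) + exp (- (1 / e\<^sup>2) * ?q)" by simp
      then have "1 \<le> ennreal (?c + s / 6 * exp (- (1 / 2) * ?q) + exp (- (1 / e\<^sup>2) * ?q))"
        by (subst ennreal_1[symmetric]) (rule ennreal_leI)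
      then show ?thesis by (rule order_trans[OF N.emeasure_le_1])
    next
      case False
      then have q: "0 < ?q" using qform_nonneg[of p m V z] by linarith
      then have sq: "0 < sqrt ?q" "sqrt ?q * sqrt ?q = ?q" by auto
      have "0 \<le> sqrt ?q * t - s * ?q \<longleftrightarrow> s * sqrt ?q \<le> t" for t
      proof -
        have "sqrt ?q * t - s * ?q = sqrt ?q * (t - s * sqrt ?q)" using sq(2) by (simp add: algebra_simps)
        then show ?thesis using sq(1) by (simp add: zero_le_mult_iff)
      qed
      then have eq: "{t. 0 \<le> sqrt ?q * t - s * ?q} = {s * sqrt ?q..}" by auto
      have a: "measure N01 {s * sqrt ?q..} \<le> 1 / 2 - min (s * sqrt ?q) 1 / 6"
        using s by (intro N01_tail_le) (simp add: qform_nonneg)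
      have b: "s - s * exp (- (1 / 2) * ?q) \<le> min (s * sqrt ?q) 1"
      proof -
        have "1 - exp (- (1 / 2) * ?q) \<le> sqrt ?q"
        proof (cases "?q \<le> 1")
          case True
          have "1 - exp (- (1 / 2) * ?q) \<le> (1 / 2) * ?q" using exp_ge_add_one_self[of "- (1 / 2) * ?q"] by linarith
          also have "\<dots> \<le> ?q" using q by simp
          also have "?q = sqrt ?q * sqrt ?q" using sq by simp
          also have "\<dots> \<le> sqrt ?q * 1" using True sq by (intro mult_left_mono) auto
          finally show ?thesis by simp
        next
          case False
          then have "1 \<le> sqrt ?q" by simp
          then show ?thesis using exp_gt_zero[of "- (1 / 2) * ?q"] by linarith
        qed
        then have "s * (1 - exp (- (1 / 2) * ?q)) \<le> s * sqrt ?q" using s by (intro mult_left_mono) auto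
        moreover have "s * (1 - exp (- (1 / 2) * ?q)) \<le> 1 * 1" using s q by (intro mult_mono) auto
        ultimately show ?thesis by (simp add: right_diff_distrib)
      qed
      have "0 < exp (- (1 / e\<^sup>2) * ?q)" by simp
      moreover have "s / 6 * exp (- (1 / 2) * ?q) = s * exp (- (1 / 2) * ?q) / 6" by simp
      ultimately have "measure N01 {t. 0 \<le> sqrt ?q * t - s * ?q} \<le> ?c + s / 6 * exp (- (1 / 2) * ?q) + exp (- (1 / e\<^sup>2) * ?q)"
        using a b unfolding eq by linarith
      then show ?thesis by (simp add: N.emeasure_eq_measure ennreal_leI)
    qed
    finally show ?thesis using ennreal_affine[of ?c "s / 6" "exp (- (1 / 2) * ?q)" "exp (- (1 / e\<^sup>2) * ?q)"] c s by simp
  qed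
  interpret G: prob_space "gauss2 p m" by (rule prob_space_gauss2)
  have E1: "(\<integral>\<^sup>+z. ennreal (exp (- (1 / 2) * qform p m V z)) \<partial>std_gauss p) \<le> ennreal (3 / 4)"
  proof -
    have "4 / 3 \<le> sqrt 2" by (rule real_le_rsqrt) (simp add: power2_eq_square)
    then have "1 / sqrt 2 \<le> 1 / (4 / 3)" by (intro divide_left_mono) auto
    then show ?thesis
      using nn_integral_exp_neg_qform[OF V, of "1/2"] by (intro order_trans[OF _ ennreal_leI[of "1 / sqrt 2" "3 / 4"]]) auto
  qed
  have E2: "(\<integral>\<^sup>+z. ennreal (exp (- (1 / e\<^sup>2) * qform p m V z)) \<partial>std_gauss p) \<le> ennreal e"
    by (rule order_trans[OF nn_integral_exp_neg_qform[OF V] ennreal_leI[OF inverse_sqrt_le[OF e]]]) (use e in simp)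
  let ?A = "{u\<in>space (gauss2 p m). 0 \<le> ?F (fst u) (snd u)}"
  have "emeasure (gauss2 p m) ?A = (\<integral>\<^sup>+u. indicator ?A u \<partial>gauss2 p m)" by simp
  also have "\<dots> = (\<integral>\<^sup>+u. indicator {x. 0 \<le> x} (?F (fst u) (snd u)) \<partial>gauss2 p m)"
    by (intro nn_integral_cong) (auto simp: indicator_def)
  also have "\<dots> = (\<integral>\<^sup>+z. \<integral>\<^sup>+w. indicator {x. 0 \<le> x} (?F z w) \<partial>std_gauss m \<partial>std_gauss p)"
    by (subst nn_integral_gauss2) auto
  also have "\<dots> = (\<integral>\<^sup>+z. \<integral>\<^sup>+w. indicator {x. 0 \<le> x - s * qform p m V z} (gform p m V z w) \<partial>std_gauss m \<partial>std_gauss p)"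
    by (intro nn_integral_cong) (auto simp: indicator_def)
  also have "\<dots> \<le> (\<integral>\<^sup>+z. ennreal ?c + ennreal (s / 6) * ennreal (exp (- (1 / 2) * qform p m V z)) + ennreal (exp (- (1 / e\<^sup>2) * qform p m V z)) \<partial>std_gauss p)"
    by (intro nn_integral_mono inner)
  also have "\<dots> = (\<integral>\<^sup>+z. ennreal ?c + ennreal (s / 6) * ennreal (exp (- (1 / 2) * qform p m V z)) \<partial>std_gauss p)
      + (\<integral>\<^sup>+z. ennreal (exp (- (1 / e\<^sup>2) * qform p m V z)) \<partial>std_gauss p)"
    by (rule nn_integral_add) measurable
  also have "(\<integral>\<^sup>+z. ennreal ?c + ennreal (s / 6) * ennreal (exp (- (1 / 2) * qform p m V z)) \<partial>std_gauss p) =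
      (\<integral>\<^sup>+z. ennreal ?c \<partial>std_gauss p) + (\<integral>\<^sup>+z. ennreal (s / 6) * ennreal (exp (- (1 / 2) * qform p m V z)) \<partial>std_gauss p)"
    by (rule nn_integral_add) measurable
  also have "(\<integral>\<^sup>+z. ennreal (s / 6) * ennreal (exp (- (1 / 2) * qform p m V z)) \<partial>std_gauss p) =
      ennreal (s / 6) * (\<integral>\<^sup>+z. ennreal (exp (- (1 / 2) * qform p m V z)) \<partial>std_gauss p)"
    by (rule nn_integral_cmult) measurable
  also have "(\<integral>\<^sup>+z. ennreal ?c \<partial>std_gauss p) = ennreal ?c"
    by (simp add: prob_space.emeasure_space_1[OF prob_space_std_gauss])
  also have "ennreal ?c + ennreal (s / 6) * (\<integral>\<^sup>+z. ennreal (exp (- (1 / 2) * qform p m V z)) \<partial>std_gauss p)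
      + (\<integral>\<^sup>+z. ennreal (exp (- (1 / e\<^sup>2) * qform p m V z)) \<partial>std_gauss p) \<le> ennreal ?c + ennreal (s / 6) * ennreal (3 / 4) + ennreal e"
    by (rule add_mono[OF add_mono[OF order_refl mult_left_mono[OF E1]] E2]) simp
  also have "\<dots> = ennreal (?c + s / 6 * (3 / 4) + e)"
    using c s e by (intro ennreal_affine[symmetric]) auto
  also have "?c + s / 6 * (3 / 4) + e = 1 / 2 - s / 24 + e" by simp
  finally show "measure (gauss2 p m) ?A \<le> 1 / 2 - s / 24 + e"
    using s e by (subst (asm) G.emeasure_eq_measure, subst (asm) ennreal_le_iff) auto
qed

section \<open>Stability of the shifted form under changes of the direction\<close>

definition fform :: "nat \<Rightarrow> nat \<Rightarrow> real \<Rightarrow> (nat \<Rightarrow> nat \<Rightarrow> real) \<Rightarrow> (nat \<Rightarrow> real) \<times> (nat \<Rightarrow> real) \<Rightarrow> real" where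
  "fform p m s V u = gform p m V (fst u) (snd u) - s * qform p m V (fst u)"

lemma measurable_fform [measurable]: "fform p m s V \<in> borel_measurable (gauss2 p m)"
  unfolding fform_def[abs_def] by measurable

lemma gform_diff: "gform p m (\<lambda>i j. V i j - V' i j) z w = gform p m V z w - gform p m V' z w"
  unfolding gform_def by (simp add: left_diff_distrib sum_subtractf)

lemma gform_add: "gform p m (\<lambda>i j. V i j + V' i j) z w = gform p m V z w + gform p m V' z w"
  unfolding gform_def by (simp add: distrib_right sum.distrib)

lemma square_sum_le: "(a + b)\<^sup>2 \<le> 2 * a\<^sup>2 + 2 * (b::real)\<^sup>2"
proof -
  have "0 \<le> (a - b)\<^sup>2" by simp
  then show ?thesis by (simp add: power2_eq_square algebra_simps)
qed

lemma qform_add_le: "qform p m (\<lambda>i j. V i j + V' i j) z \<le> 2 * qform p m V z + 2 * qform p m V' z"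
  unfolding qform_def sum_distrib_left sum.distrib[symmetric]
  by (intro sum_mono) (simp add: distrib_right sum.distrib square_sum_le)

lemma fro2_add_le: "fro2 p m (\<lambda>i j. V i j + V' i j) \<le> 2 * fro2 p m V + 2 * fro2 p m V'"
  unfolding fro2_def sum_distrib_left sum.distrib[symmetric] by (intro sum_mono) (simp add: square_sum_le)

lemma abs_mult_le_weighted:
  fixes a b d :: real
  assumes "0 < d"
  shows "\<bar>a * b\<bar> \<le> (a\<^sup>2 / d + d * b\<^sup>2) / 2"
proof -
  have "0 \<le> (\<bar>a\<bar> - d * \<bar>b\<bar>)\<^sup>2 / d" using assms by simp
  also have "\<dots> = a\<^sup>2 / d + d * b\<^sup>2 - 2 * \<bar>a * b\<bar>"
    using assms by (simp add: power2_diff power_mult_distrib abs_mult field_simps power2_eq_square)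
  finally show ?thesis by simp
qed

text \<open>A difference of squares is factored and the product weighted: when \<open>d\<close> is
  the size of the difference of the matrices, both resulting terms are of order
  \<open>d\<close>.\<close>

lemma qform_diff_le:
  assumes "0 < d"
  shows "\<bar>qform p m V z - qform p m V' z\<bar> \<le>
    (qform p m (\<lambda>i j. V i j - V' i j) z / d + d * qform p m (\<lambda>i j. V i j + V' i j) z) / 2"
proof -
  define a where "a j = (\<Sum>i<p. V i j * z i)" for j
  define b where "b j = (\<Sum>i<p. V' i j * z i)" for j
  have "qform p m V z - qform p m V' z = (\<Sum>j<m. (a j - b j) * (a j + b j))"
    unfolding qform_def a_def[symmetric] b_def[symmetric] sum_subtractf[symmetric]
    by (intro sum.cong) (simp_all add: power2_eq_square algebra_simps)
  also have "\<bar>\<dots>\<bar> \<le> (\<Sum>j<m. ((a j - b j)\<^sup>2 / d + d * (a j + b j)\<^sup>2) / 2)"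
    by (intro order_trans[OF sum_abs] sum_mono abs_mult_le_weighted assms)
  also have "\<dots> = ((\<Sum>j<m. (a j - b j)\<^sup>2) / d + d * (\<Sum>j<m. (a j + b j)\<^sup>2)) / 2"
    by (simp add: sum_divide_distrib[symmetric] sum_distrib_left sum.distrib)
  also have "\<dots> = (qform p m (\<lambda>i j. V i j - V' i j) z / d + d * qform p m (\<lambda>i j. V i j + V' i j) z) / 2"
    by (simp add: qform_def a_def b_def left_diff_distrib distrib_right sum.distrib sum_subtractf)
  finally show ?thesis .
qed

lemma fform_diff_le:
  assumes d: "0 < d" and s: "0 \<le> s" "s \<le> 1"
  shows "\<bar>fform p m s V u - fform p m s V' u\<bar> \<le> \<bar>gform p m (\<lambda>i j. V i j - V' i j) (fst u) (snd u)\<bar> +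
    (qform p m (\<lambda>i j. V i j - V' i j) (fst u) / d + d * qform p m (\<lambda>i j. V i j + V' i j) (fst u)) / 2"
proof -
  have "\<bar>fform p m s V u - fform p m s V' u\<bar> = \<bar>gform p m (\<lambda>i j. V i j - V' i j) (fst u) (snd u) - s * (qform p m V (fst u) - qform p m V' (fst u))\<bar>"
    by (simp add: fform_def gform_diff algebra_simps)
  also have "\<dots> \<le> \<bar>gform p m (\<lambda>i j. V i j - V' i j) (fst u) (snd u)\<bar> + \<bar>s * (qform p m V (fst u) - qform p m V' (fst u))\<bar>"
    by (rule abs_triangle_ineq4)
  finally have 1: "\<bar>fform p m s V u - fform p m s V' u\<bar> \<le> \<bar>gform p m (\<lambda>i j. V i j - V' i j) (fst u) (snd u)\<bar> + \<bar>s * (qform p m V (fst u) - qform p m V' (fst u))\<bar>" .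
  have 2: "\<bar>s * (qform p m V (fst u) - qform p m V' (fst u))\<bar> \<le> 1 * \<bar>qform p m V (fst u) - qform p m V' (fst u)\<bar>"
    using s unfolding abs_mult by (intro mult_right_mono) auto
  show ?thesis
    by (rule order_trans[OF 1 add_left_mono[OF order_trans[OF 2[unfolded mult_1] qform_diff_le[OF d]]]])
qed

lemma ennreal_combine:
  "0 \<le> a \<Longrightarrow> 0 \<le> b \<Longrightarrow> 0 \<le> x \<Longrightarrow> 0 \<le> y \<Longrightarrow> 0 \<le> z \<Longrightarrow> ennreal (a * x + (b + (a * y + b * z))) =
    ennreal a * ennreal x + (ennreal b + (ennreal a * ennreal y + ennreal b * ennreal z))"
  by (simp add: ennreal_mult)

text \<open>Markov's inequality for a majorant made of squares: the bilinear form is traded for its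
  square at weight \<open>d\<close>, so all means are Frobenius norms. They add up to 2d + d/2 + 2d
  + 2d, rounded up to 7d.\<close>

lemma prob_fform_diff:
  assumes V: "fro2 p m V = 1" "fro2 p m V' = 1" "fro2 p m (\<lambda>i j. V i j - V' i j) \<le> 4 * d\<^sup>2"
    and d: "0 < d" and s: "0 \<le> s" "s \<le> 1" and t: "0 < t"
  shows "emeasure (gauss2 p m) {u\<in>space (gauss2 p m). t \<le> \<bar>fform p m s V u - fform p m s V' u\<bar>} \<le> ennreal (7 * d / t)"
proof -
  let ?D = "\<lambda>i j. V i j - V' i j" and ?S = "\<lambda>i j. V i j + V' i j"
  define b where "b u = 1 / (2 * d) * (gform p m ?D (fst u) (snd u))\<^sup>2 + (d / 2 + (1 / (2 * d) * qform p m ?D (fst u) + d / 2 * qform p m ?S (fst u)))" for u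
  have [measurable]: "b \<in> borel_measurable (gauss2 p m)" unfolding b_def[abs_def] by measurable
  have nn: "0 \<le> 1 / (2 * d) * (gform p m ?D (fst u) (snd u))\<^sup>2" "0 \<le> 1 / (2 * d) * qform p m ?D (fst u)"
      "0 \<le> d / 2 * qform p m ?S (fst u)" for u
    using d by (simp_all add: qform_nonneg)
  have le: "\<bar>fform p m s V u - fform p m s V' u\<bar> \<le> b u" for u
  proof -
    have "\<bar>gform p m ?D (fst u) (snd u) * 1\<bar> \<le> ((gform p m ?D (fst u) (snd u))\<^sup>2 / d + d * 1\<^sup>2) / 2"
      by (rule abs_mult_le_weighted[OF d])
    then show ?thesis using fform_diff_le[OF d s, of p m V u V'] unfolding b_def by (simp add: add_divide_distrib)
  qed
  have "(\<integral>\<^sup>+u. ennreal (b u) \<partial>gauss2 p m) =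
      (\<integral>\<^sup>+u. ennreal (1 / (2 * d)) * ennreal ((gform p m ?D (fst u) (snd u))\<^sup>2) + (ennreal (d / 2) +
        (ennreal (1 / (2 * d)) * ennreal (qform p m ?D (fst u)) + ennreal (d / 2) * ennreal (qform p m ?S (fst u)))) \<partial>gauss2 p m)"
    unfolding b_def using d by (intro nn_integral_cong ennreal_combine) (auto simp: qform_nonneg)
  also have "\<dots> = ennreal (1 / (2 * d)) * ennreal (fro2 p m ?D) + (ennreal (d / 2) +
        (ennreal (1 / (2 * d)) * ennreal (fro2 p m ?D) + ennreal (d / 2) * ennreal (fro2 p m ?S)))"
    by (subst nn_integral_add, measurable, subst nn_integral_add, measurable, subst nn_integral_add, measurable,
        subst nn_integral_cmult, measurable, subst nn_integral_cmult, measurable, subst nn_integral_cmult, measurable)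
      (simp add: nn_integral_gform_sq nn_integral_qform_gauss2 prob_space.emeasure_space_1[OF prob_space_gauss2])
  also have "\<dots> = ennreal (1 / (2 * d) * fro2 p m ?D + (d / 2 + (1 / (2 * d) * fro2 p m ?D + d / 2 * fro2 p m ?S)))"
    using d by (intro ennreal_combine[symmetric]) (auto simp: fro2_nonneg)
  also have "\<dots> \<le> ennreal (7 * d)"
  proof (rule ennreal_leI)
    have "1 / (2 * d) * fro2 p m ?D \<le> 1 / (2 * d) * (4 * d\<^sup>2)" using V d by (intro mult_left_mono) auto
    also have "\<dots> = 2 * d" using d by (simp add: power2_eq_square)
    finally have 1: "1 / (2 * d) * fro2 p m ?D \<le> 2 * d" .
    have "d / 2 * fro2 p m ?S \<le> d / 2 * 4" using fro2_add_le[of p m V V'] V d by (intro mult_left_mono) auto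
    then show "1 / (2 * d) * fro2 p m ?D + (d / 2 + (1 / (2 * d) * fro2 p m ?D + d / 2 * fro2 p m ?S)) \<le> 7 * d"
      using 1 d by linarith
  qed
  finally have I: "(\<integral>\<^sup>+u. ennreal (b u) \<partial>gauss2 p m) \<le> ennreal (7 * d)" .
  let ?A = "{u\<in>space (gauss2 p m). t \<le> \<bar>fform p m s V u - fform p m s V' u\<bar>}"
  have "emeasure (gauss2 p m) ?A = (\<integral>\<^sup>+u. indicator ?A u \<partial>gauss2 p m)" by simp
  also have "\<dots> \<le> (\<integral>\<^sup>+u. ennreal (1 / t) * ennreal (b u) \<partial>gauss2 p m)"
  proof (rule nn_integral_mono)
    fix u
    show "indicator ?A u \<le> ennreal (1 / t) * ennreal (b u)"
    proof (cases "u \<in> ?A")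
      case True
      then have "t \<le> b u" using le[of u] by auto
      then have "1 \<le> 1 / t * b u" using t by simp
      then have "ennreal 1 \<le> ennreal (1 / t * b u)" by (rule ennreal_leI)
      also have "\<dots> = ennreal (1 / t) * ennreal (b u)" using t by (intro ennreal_mult') simp
      finally show ?thesis using True by simp
    qed simp
  qed
  also have "\<dots> = ennreal (1 / t) * (\<integral>\<^sup>+u. ennreal (b u) \<partial>gauss2 p m)"
    by (rule nn_integral_cmult) measurable
  also have "\<dots> \<le> ennreal (1 / t) * ennreal (7 * d)" by (intro mult_left_mono I) simp
  also have "\<dots> = ennreal (7 * d / t)" using t d by (simp add: ennreal_mult'[symmetric])
  finally show ?thesis .
qed

text \<open>A sign change forces a value within 4^-j of 0 or a jump of at least 4^-j. The small ball
  bound loses a square root, giving 4/2^j; the jump has probability at most 7 * 8^-j * 4^j. Net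
  radius 8^-j is what makes both decay like 2^-j.\<close>

lemma prob_sign_change:
  assumes V: "fro2 p m V = 1" "fro2 p m V' = 1" "fro2 p m (\<lambda>i j. V i j - V' i j) \<le> 4 * (1 / 8 ^ j)\<^sup>2"
    and s: "0 \<le> s" "s \<le> 1"
  shows "measure (gauss2 p m) {u\<in>space (gauss2 p m). (0 \<le> fform p m s V u) \<noteq> (0 \<le> fform p m s V' u)} \<le> 11 / 2 ^ j"
proof -
  interpret G: prob_space "gauss2 p m" by (rule prob_space_gauss2)
  let ?t = "1 / 4 ^ j :: real" and ?G = "gauss2 p m"
  let ?A = "{u\<in>space ?G. \<bar>fform p m s V u\<bar> \<le> ?t}" and ?B = "{u\<in>space ?G. ?t \<le> \<bar>fform p m s V u - fform p m s V' u\<bar>}"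
  have mA: "?A \<in> sets ?G" and mB: "?B \<in> sets ?G" by measurable
  have sq: "sqrt ?t = 1 / 2 ^ j"
  proof -
    have "?t = (1 / 2 ^ j)\<^sup>2" by (simp add: power_divide power_mult[symmetric] power_even_eq[symmetric] power_mult_distrib[symmetric])
      (simp add: power_mult mult.commute[of j])
    then show ?thesis by simp
  qed
  have "measure ?G {u\<in>space ?G. (0 \<le> fform p m s V u) \<noteq> (0 \<le> fform p m s V' u)} \<le> measure ?G (?A \<union> ?B)"
    using mA mB by (intro G.finite_measure_mono) auto
  also have "\<dots> \<le> measure ?G ?A + measure ?G ?B" by (rule measure_Un_le[OF mA mB])
  also have "measure ?G ?A \<le> 4 / 2 ^ j"
  proof -
    have "emeasure ?G ?A \<le> ennreal (4 * sqrt ?t)"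
      using small_ball[OF V(1), of ?t s] unfolding fform_def by simp
    then show ?thesis unfolding sq by (simp add: G.emeasure_eq_measure)
  qed
  also have "measure ?G ?B \<le> 7 / 2 ^ j"
  proof -
    have "emeasure ?G ?B \<le> ennreal (7 * (1 / 8 ^ j) / ?t)"
      by (rule prob_fform_diff[OF V _ s]) auto
    also have "7 * (1 / 8 ^ j) / ?t = 7 / (2::real) ^ j"
      by (simp add: field_simps power_mult_distrib[symmetric])
    finally show ?thesis by (simp add: G.emeasure_eq_measure)
  qed
  finally show ?thesis by simp
qed

section \<open>Nets of low-rank matrices\<close>

lemma sum_geometric_abs_le:
  fixes r :: real
  assumes "0 \<le> r" "r < 1"
  shows "(\<Sum>x\<in>{- int B..int B}. r ^ nat \<bar>x\<bar>) \<le> 2 / (1 - r)"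
proof -
  have g: "(\<Sum>k\<in>{..B}. r ^ k) \<le> 1 / (1 - r)"
  proof -
    have "(\<Sum>k\<in>{..B}. r ^ k) = (1 - r ^ Suc B) / (1 - r)"
      using sum_gp_basic[of r B] assms by (simp add: field_simps)
    also have "\<dots> \<le> 1 / (1 - r)" using assms by (intro divide_right_mono) auto
    finally show ?thesis .
  qed
  have "{- int B..int B} = int ` {..B} \<union> (\<lambda>k. - int k) ` {..B}"
  proof (intro equalityI subsetI)
    fix x assume "x \<in> {- int B..int B}"
    then show "x \<in> int ` {..B} \<union> (\<lambda>k. - int k) ` {..B}"
      by (cases "0 \<le> x") (auto intro!: image_eqI[of _ int "nat x"] image_eqI[of _ "\<lambda>k. - int k" "nat (- x)"])
  qed auto
  also have "(\<Sum>x\<in>int ` {..B} \<union> (\<lambda>k. - int k) ` {..B}. r ^ nat \<bar>x\<bar>) \<le>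
      (\<Sum>x\<in>int ` {..B}. r ^ nat \<bar>x\<bar>) + (\<Sum>x\<in>(\<lambda>k. - int k) ` {..B}. r ^ nat \<bar>x\<bar>)"
    using assms by (subst sum_Un) (auto intro!: sum_nonneg)
  also have "\<dots> = (\<Sum>k\<in>{..B}. r ^ k) + (\<Sum>k\<in>{..B}. r ^ k)"
    by (subst (1 2) sum.reindex) (auto simp: inj_on_def)
  finally show ?thesis using g by simp
qed

text \<open>Counting by weights: \<open>l\<close> receives the weight \<open>r\<close> to the power
  of its l1 norm, with \<open>r = exp (- 1 / a)\<close>. Every counted vector weighs at least
  \<open>exp (- card I)\<close>, and the total weight factorises into at most
  \<open>(4 * a) ^ card I\<close>; \<open>exp 1 \<le> 3\<close> turns this into the base
  \<open>12 * a\<close>, with no further dependence on the dimension.\<close>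

lemma card_bounded_int_vectors:
  assumes I: "finite I" and a: "1 \<le> a"
  defines "L \<equiv> {l \<in> I \<rightarrow>\<^sub>E (UNIV :: int set). (\<Sum>i\<in>I. real_of_int \<bar>l i\<bar>) \<le> a * real (card I)}"
  shows "finite L" "real (card L) \<le> (12 * a) ^ card I"
proof -
  define B where "B = nat \<lceil>a * real (card I)\<rceil>"
  define r where "r = exp (- 1 / a)"
  have r: "0 < r" "r < 1" using a by (auto simp: r_def)
  have sub: "L \<subseteq> I \<rightarrow>\<^sub>E {- int B..int B}"
  proof
    fix l assume l: "l \<in> L"
    have "l i \<in> {- int B..int B}" if "i \<in> I" for i
    proof -
      have "real_of_int \<bar>l i\<bar> \<le> (\<Sum>i\<in>I. real_of_int \<bar>l i\<bar>)" using I that by (intro member_le_sum) auto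
      also have "\<dots> \<le> a * real (card I)" using l by (simp add: L_def)
      finally have "\<bar>l i\<bar> \<le> int B" unfolding B_def by linarith
      then show ?thesis by auto
    qed
    then show "l \<in> I \<rightarrow>\<^sub>E {- int B..int B}" using l by (auto simp: L_def)
  qed
  have fin: "finite (I \<rightarrow>\<^sub>E {- int B..int B})" by (rule finite_PiE[OF I]) simp
  show "finite L" by (rule finite_subset[OF sub fin])
  have "real (card L) * exp (- real (card I)) = (\<Sum>l\<in>L. exp (- real (card I)))" by simp
  also have "\<dots> \<le> (\<Sum>l\<in>L. \<Prod>i\<in>I. r ^ nat \<bar>l i\<bar>)"
  proof (rule sum_mono)
    fix l assume l: "l \<in> L"
    have "(\<Prod>i\<in>I. r ^ nat \<bar>l i\<bar>) = (\<Prod>i\<in>I. exp (- (real_of_int \<bar>l i\<bar> / a)))"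
      unfolding r_def by (intro prod.cong) (simp_all add: exp_of_nat_mult[symmetric] field_simps)
    also have "\<dots> = exp (- ((\<Sum>i\<in>I. real_of_int \<bar>l i\<bar>) / a))"
      using I by (simp add: exp_sum[symmetric] sum_negf sum_divide_distrib)
    finally have eq: "(\<Prod>i\<in>I. r ^ nat \<bar>l i\<bar>) = exp (- ((\<Sum>i\<in>I. real_of_int \<bar>l i\<bar>) / a))" .
    have "(\<Sum>i\<in>I. real_of_int \<bar>l i\<bar>) / a \<le> real (card I)" using l a by (simp add: L_def field_simps)
    then show "exp (- real (card I)) \<le> (\<Prod>i\<in>I. r ^ nat \<bar>l i\<bar>)" unfolding eq by simp
  qed
  also have "\<dots> \<le> (\<Sum>l\<in>I \<rightarrow>\<^sub>E {- int B..int B}. \<Prod>i\<in>I. r ^ nat \<bar>l i\<bar>)"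
    using r by (intro sum_mono2[OF fin sub] prod_nonneg) auto
  also have "\<dots> = (\<Prod>i\<in>I. \<Sum>x\<in>{- int B..int B}. r ^ nat \<bar>x\<bar>)"
    by (rule prod_sum_PiE[symmetric]) (use I in auto)
  also have "\<dots> \<le> (\<Prod>i\<in>I. 4 * a)"
  proof (rule prod_mono, intro conjI)
    fix i
    show "0 \<le> (\<Sum>x\<in>{- int B..int B}. r ^ nat \<bar>x\<bar>)" using r by (intro sum_nonneg) auto
    define t where "t = 1 / a"
    have t: "0 < t" "t \<le> 1" using a by (auto simp: t_def)
    have "r \<le> 1 / (1 + t)"
    proof -
      have "1 + t \<le> exp t" by (rule exp_ge_add_one_self)
      then have "1 / exp t \<le> 1 / (1 + t)" using t by (intro divide_left_mono) auto
      then show ?thesis by (simp add: r_def t_def exp_minus inverse_eq_divide)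
    qed
    also have "1 / (1 + t) \<le> 1 - t / 2"
    proof -
      have "t * t \<le> t * 1" using t by (intro mult_left_mono) auto
      then have "1 \<le> (1 - t / 2) * (1 + t)" by (simp add: algebra_simps)
      then show ?thesis using t by (simp add: pos_divide_le_eq)
    qed
    finally have "t / 2 \<le> 1 - r" by simp
    then have "2 / (1 - r) \<le> 2 / (t / 2)" using t r by (intro divide_left_mono) auto
    also have "\<dots> = 4 * a" using a by (simp add: t_def)
    finally show "(\<Sum>x\<in>{- int B..int B}. r ^ nat \<bar>x\<bar>) \<le> 4 * a"
      using sum_geometric_abs_le[of r B] r by simp
  qed
  finally have le: "real (card L) * exp (- real (card I)) \<le> (4 * a) ^ card I" by simp
  have "real (card L) = real (card L) * exp (- real (card I)) * exp (real (card I))" by (simp add: mult.assoc mult_exp_exp)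
  also have "\<dots> \<le> (4 * a) ^ card I * exp (real (card I))" using le by (rule mult_right_mono) simp
  also have "\<dots> = (4 * a * exp 1) ^ card I"
    by (simp add: power_mult_distrib exp_of_nat_mult[of "card I" 1, simplified])
  also have "\<dots> \<le> (12 * a) ^ card I"
  proof (rule power_mono)
    have "4 * a * exp 1 \<le> 4 * a * 3" using a exp_le by (intro mult_left_mono) auto
    then show "4 * a * exp 1 \<le> 12 * a" by simp
  qed (use a in simp)
  finally show "real (card L) \<le> (12 * a) ^ card I" .
qed

text \<open>Only the label of the grid cell is kept, not a grid point: vectors with equal labels are
  close, and a representative of a cell can later be taken inside the class itself.\<close>

definition grid_label :: "'a set \<Rightarrow> real \<Rightarrow> ('a \<Rightarrow> real) \<Rightarrow> 'a \<Rightarrow> int" where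
  "grid_label I st x = (\<lambda>i\<in>I. \<lfloor>x i / st\<rfloor>)"

lemma grid_label_eqD:
  assumes "grid_label I st x = grid_label I st y" "i \<in> I" "0 < st"
  shows "(x i - y i)\<^sup>2 \<le> st\<^sup>2"
proof -
  have "\<lfloor>x i / st\<rfloor> = \<lfloor>y i / st\<rfloor>" using fun_cong[OF assms(1), of i] assms(2) by (simp add: grid_label_def)
  then have "\<bar>x i / st - y i / st\<bar> \<le> 1" by linarith
  then have "\<bar>x i - y i\<bar> \<le> st" using assms(3) by (simp add: diff_divide_distrib[symmetric])
  then have "\<bar>x i - y i\<bar>\<^sup>2 \<le> st\<^sup>2" by (intro power_mono) auto
  then show ?thesis by simp
qed

text \<open>The step makes the Euclidean diameter of a cell at most \<open>d * R\<close>.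
  Cauchy-Schwarz bounds the l1 norm by \<open>sqrt (card I) * R\<close>, so labels have l1 norm at
  most \<open>(1 / d + 1) * card I\<close>, and \<open>d \<le> 1\<close> gives \<open>2 / d\<close>
  per coordinate.\<close>

lemma card_grid_label:
  assumes I: "finite I" "I \<noteq> {}" and d: "0 < d" "d \<le> 1" and R: "0 < R"
    and X: "\<And>x. x \<in> X \<Longrightarrow> (\<Sum>i\<in>I. (x i)\<^sup>2) \<le> R\<^sup>2"
  shows "finite (grid_label I (d * R / sqrt (card I)) ` X)"
    "real (card (grid_label I (d * R / sqrt (card I)) ` X)) \<le> (24 / d) ^ card I"
proof -
  let ?st = "d * R / sqrt (card I)"
  let ?L = "{l \<in> I \<rightarrow>\<^sub>E (UNIV :: int set). (\<Sum>i\<in>I. real_of_int \<bar>l i\<bar>) \<le> 2 / d * real (card I)}"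
  have cI: "0 < real (card I)" using I by (simp add: card_gt_0_iff)
  have st: "0 < ?st" using d R cI by simp
  have a: "1 \<le> 2 / d" using d by simp
  have sub: "grid_label I ?st ` X \<subseteq> ?L"
  proof (rule image_subsetI)
    fix x assume x: "x \<in> X"
    have "(\<Sum>i\<in>I. \<bar>x i\<bar>)\<^sup>2 \<le> real (card I) * R\<^sup>2"
    proof -
      have "(\<Sum>i\<in>I. \<bar>x i\<bar> * 1)\<^sup>2 \<le> (\<Sum>i\<in>I. \<bar>x i\<bar>\<^sup>2) * (\<Sum>i\<in>I. 1\<^sup>2)" by (rule Cauchy_Schwarz_ineq_sum)
      also have "\<dots> \<le> R\<^sup>2 * real (card I)" using X[OF x] by (simp add: mult_right_mono)
      finally show ?thesis by (simp add: mult.commute)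
    qed
    then have "(\<Sum>i\<in>I. \<bar>x i\<bar>) \<le> sqrt (real (card I) * R\<^sup>2)" by (rule real_le_rsqrt)
    also have "\<dots> = sqrt (card I) * R" using R by (simp add: real_sqrt_mult)
    finally have l1: "(\<Sum>i\<in>I. \<bar>x i\<bar>) \<le> sqrt (card I) * R" .
    have "(\<Sum>i\<in>I. real_of_int \<bar>grid_label I ?st x i\<bar>) \<le> (\<Sum>i\<in>I. \<bar>x i\<bar> / ?st + 1)"
    proof (rule sum_mono)
      fix i assume "i \<in> I"
      have "real_of_int \<bar>\<lfloor>x i / ?st\<rfloor>\<bar> \<le> \<bar>x i / ?st\<bar> + 1" by linarith
      also have "\<bar>x i / ?st\<bar> = \<bar>x i\<bar> / ?st" by (rule abs_div_pos[OF st, symmetric])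
      finally show "real_of_int \<bar>grid_label I ?st x i\<bar> \<le> \<bar>x i\<bar> / ?st + 1" using \<open>i \<in> I\<close> by (simp add: grid_label_def)
    qed
    also have "\<dots> = (\<Sum>i\<in>I. \<bar>x i\<bar>) / ?st + real (card I)"
      unfolding sum.distrib sum_divide_distrib by simp
    also have "\<dots> \<le> sqrt (card I) * R / ?st + real (card I)" using l1 st by (intro add_right_mono divide_right_mono) auto
    also have "sqrt (card I) * R / ?st = (sqrt (card I) * sqrt (card I)) / d" using R cI d by (simp add: field_simps)
    also have "\<dots> = real (card I) / d" by simp
    also have "real (card I) / d + real (card I) \<le> 2 / d * real (card I)"
      using d cI by (simp add: field_simps)
    finally show "grid_label I ?st x \<in> ?L" by (auto simp: grid_label_def)
  qed
  note L = card_bounded_int_vectors[OF I(1) a]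
  show "finite (grid_label I ?st ` X)" by (rule finite_subset[OF sub L(1)])
  have "real (card (grid_label I ?st ` X)) \<le> real (card ?L)" using card_mono[OF L(1) sub] by simp
  then show "real (card (grid_label I ?st ` X)) \<le> (24 / d) ^ card I" using L(2) by (simp add: mult.commute)
qed

section \<open>Covering low-rank matrices through their singular value decomposition\<close>

lemma sum_square_orthogonal:
  fixes F :: "nat \<Rightarrow> 'a \<Rightarrow> real"
  assumes "\<And>l l'. l < k \<Longrightarrow> l' < k \<Longrightarrow> l \<noteq> l' \<Longrightarrow> (\<Sum>i\<in>S. F l i * F l' i) = 0"
  shows "(\<Sum>i\<in>S. (\<Sum>l<k. a l * F l i)\<^sup>2) = (\<Sum>l<k. (a l)\<^sup>2 * (\<Sum>i\<in>S. (F l i)\<^sup>2))"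
proof -
  have "(\<Sum>i\<in>S. (\<Sum>l<k. a l * F l i)\<^sup>2) = (\<Sum>i\<in>S. \<Sum>l<k. \<Sum>l'<k. a l * a l' * (F l i * F l' i))"
    unfolding power2_eq_square by (intro sum.cong refl) (simp add: sum_product mult_ac)
  also have "\<dots> = (\<Sum>l<k. \<Sum>i\<in>S. \<Sum>l'<k. a l * a l' * (F l i * F l' i))" by (rule sum.swap)
  also have "\<dots> = (\<Sum>l<k. \<Sum>l'<k. \<Sum>i\<in>S. a l * a l' * (F l i * F l' i))" by (intro sum.cong refl sum.swap)
  also have "\<dots> = (\<Sum>l<k. \<Sum>l'<k. a l * a l' * (\<Sum>i\<in>S. F l i * F l' i))" by (simp only: sum_distrib_left)
  also have "\<dots> = (\<Sum>l<k. \<Sum>l'<k. if l = l' then (a l)\<^sup>2 * (\<Sum>i\<in>S. (F l i)\<^sup>2) else 0)"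
    using assms by (intro sum.cong refl) (auto simp: power2_eq_square)
  also have "\<dots> = (\<Sum>l<k. (a l)\<^sup>2 * (\<Sum>i\<in>S. (F l i)\<^sup>2))" by (intro sum.cong refl) simp
  finally show ?thesis .
qed

text \<open>The images under \<open>A\<close> of the matrices of rank at most \<open>k\<close>.\<close>

definition lowclass :: "(nat \<Rightarrow> nat \<Rightarrow> real) \<Rightarrow> nat \<Rightarrow> nat \<Rightarrow> nat \<Rightarrow> (nat \<Rightarrow> nat \<Rightarrow> real) \<Rightarrow> bool" where
  "lowclass A p m k V \<longleftrightarrow> (\<exists>C D. \<forall>i<p. \<forall>j<m. V i j = (\<Sum>l<k. (\<Sum>h<p. A i h * C h l) * D l j))"

text \<open>The first clause keeps the left factor in the range of \<open>A\<close>; it makes both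
  pieces of a split difference members of \<open>lowclass\<close> again.\<close>

definition svd_factors where
  "svd_factors A p m k V U M \<longleftrightarrow>
    (\<exists>C. \<forall>i<p. \<forall>l<k. U i l = (\<Sum>h<p. A i h * C h l)) \<and>
    (\<forall>i<p. \<forall>j<m. V i j = (\<Sum>l<k. U i l * M l j)) \<and>
    (\<forall>l<k. \<forall>l'<k. l \<noteq> l' \<longrightarrow> (\<Sum>i<p. U i l * U i l') = 0) \<and>
    (\<forall>l<k. (\<Sum>i<p. (U i l)\<^sup>2) \<le> 1) \<and>
    (\<forall>l<k. \<forall>l'<k. l \<noteq> l' \<longrightarrow> (\<Sum>j<m. M l j * M l' j) = 0) \<and>
    fro2 k m M = fro2 p m (V :: nat \<Rightarrow> nat \<Rightarrow> real)"

lemma lowclass_svd: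
  assumes "lowclass A p m k V"
  shows "\<exists>U M. svd_factors A p m k V U M"
proof -
  obtain C D where CD: "\<And>i j. i < p \<Longrightarrow> j < m \<Longrightarrow> V i j = (\<Sum>l<k. (\<Sum>h<p. A i h * C h l) * D l j)"
    using assms unfolding lowclass_def by blast
  obtain U M N where 1: "\<And>i h. U i h = (\<Sum>j<m. V i j * N j h)"
    and 2: "\<And>i j. i < p \<Longrightarrow> j < m \<Longrightarrow> V i j = (\<Sum>h<k. U i h * M h j)"
      "\<And>h h'. h < k \<Longrightarrow> h' < k \<Longrightarrow> h \<noteq> h' \<Longrightarrow> (\<Sum>i<p. U i h * U i h') = 0"
      "\<And>h. h < k \<Longrightarrow> (\<Sum>i<p. (U i h)\<^sup>2) \<le> 1"
      "\<And>h h'. h < k \<Longrightarrow> h' < k \<Longrightarrow> h \<noteq> h' \<Longrightarrow> (\<Sum>j<m. M h j * M h' j) = 0"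
      "fro2 k m M = fro2 p m V"
    by (rule svd_low_rank[where p = p and m = m and V = V and k = k and C = "\<lambda>i l. \<Sum>h<p. A i h * C h l" and D = D, OF CD])
      (assumption, assumption, rule that)
  define C' where "C' h l = (\<Sum>j<m. \<Sum>l'<k. C h l' * D l' j * N j l)" for h l
  have "U i l = (\<Sum>h<p. A i h * C' h l)" if "i < p" for i l
  proof -
    have "U i l = (\<Sum>j<m. \<Sum>l'<k. \<Sum>h<p. A i h * (C h l' * D l' j * N j l))"
      unfolding 1 using CD[OF that] by (intro sum.cong refl) (simp add: sum_distrib_right sum_distrib_left mult_ac)
    also have "\<dots> = (\<Sum>j<m. \<Sum>h<p. \<Sum>l'<k. A i h * (C h l' * D l' j * N j l))" by (intro sum.cong refl sum.swap)
    also have "\<dots> = (\<Sum>h<p. \<Sum>j<m. \<Sum>l'<k. A i h * (C h l' * D l' j * N j l))" by (rule sum.swap)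
    also have "\<dots> = (\<Sum>h<p. A i h * C' h l)" unfolding C'_def by (simp add: sum_distrib_left)
    finally show ?thesis .
  qed
  then show ?thesis unfolding svd_factors_def using 2 by (intro exI[of _ U] exI[of _ M] conjI exI[of _ C'] allI impI) simp_all
qed

text \<open>Both factors are rounded, and V - V' = (U - U') M + U' (M - M'). The difference itself
  may have rank 2k, but each summand has rank at most k and stays in the class. Orthogonal rows of M
  bound the first summand by the entrywise error of U and the norm of M; orthogonal columns of U' do
  the same for the second. Only \<open>k * (p + m)\<close> coordinates are rounded, whence the
  exponent.\<close>

lemma lowclass_cover:
  fixes A :: "nat \<Rightarrow> nat \<Rightarrow> real" and p m k :: nat and d :: real
  assumes p: "1 \<le> p" and m: "1 \<le> m" and k: "1 \<le> k" and d: "0 < d" "d \<le> 1"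
  defines "T \<equiv> {V. lowclass A p m k V \<and> fro2 p m V \<le> 1}"
  shows "\<exists>lab :: (nat \<Rightarrow> nat \<Rightarrow> real) \<Rightarrow> (nat \<times> nat \<Rightarrow> int) \<times> (nat \<times> nat \<Rightarrow> int).
    finite (lab ` T) \<and> real (card (lab ` T)) \<le> (24 / d) ^ (k * (p + m)) \<and>
    (\<forall>V\<in>T. \<forall>V'\<in>T. lab V = lab V' \<longrightarrow> (\<exists>X Y. lowclass A p m k X \<and> lowclass A p m k Y \<and>
      fro2 p m X \<le> d\<^sup>2 \<and> fro2 p m Y \<le> d\<^sup>2 \<and> (\<forall>i<p. \<forall>j<m. V i j - V' i j = X i j + Y i j)))"
proof -
  \<comment> \<open>An arbitrary decomposition is fixed per matrix; closeness of two matrices is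
    read off the labels of these chosen factors.\<close>
  define f where "f V = (SOME z. svd_factors A p m k V (fst z) (snd z))" for V
  have f: "svd_factors A p m k V (fst (f V)) (snd (f V))" if V: "lowclass A p m k V" for V
  proof -
    obtain U M where "svd_factors A p m k V U M" using lowclass_svd[OF V] by (elim exE)
    then have "svd_factors A p m k V (fst (U, M)) (snd (U, M))" by simp
    then show ?thesis unfolding f_def by (rule someI)
  qed
  define U where "U V = fst (f V)" for V
  define M where "M V = snd (f V)" for V
  have UM: "svd_factors A p m k V (U V) (M V)" if "V \<in> T" for V
    using f that by (simp add: U_def M_def T_def)
  have Uo: "(\<Sum>i<p. U V i l * U V i l') = 0" and Mo: "(\<Sum>j<m. M V l j * M V l' j) = 0"
    if "V \<in> T" "l < k" "l' < k" "l \<noteq> l'" for V l l'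
    using UM[OF that(1)] that(2-4) unfolding svd_factors_def by simp_all
  have Un: "(\<Sum>i<p. (U V i l)\<^sup>2) \<le> 1" if "V \<in> T" "l < k" for V l
    using UM[OF that(1)] that(2) unfolding svd_factors_def by simp
  have VUM: "V i j = (\<Sum>l<k. U V i l * M V l j)" if "V \<in> T" "i < p" "j < m" for V i j
    using UM[OF that(1), unfolded svd_factors_def, THEN conjunct2, THEN conjunct1] that(2,3) by simp
  let ?I = "{..<p} \<times> {..<k}" and ?J = "{..<k} \<times> {..<m}"
  let ?u = "\<lambda>V (i, l). U V i l" and ?v = "\<lambda>V (l, j). M V l j"
  \<comment> \<open>Columns of \<open>U\<close> have norm at most 1, so its Frobenius radius is
    \<open>sqrt k\<close> and the step becomes \<open>d / sqrt p\<close>; \<open>M\<close> has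
    radius 1 and step \<open>d / sqrt (k * m)\<close>.\<close>
  let ?s = "d * sqrt k / sqrt (card ?I)" and ?t = "d * 1 / sqrt (card ?J)"
  have s: "?s = d / sqrt p" using k by (simp add: real_sqrt_mult)
  have t: "?t = d / sqrt (k * m)" by simp
  have "(\<Sum>z\<in>?I. (?u V z)\<^sup>2) \<le> (sqrt k)\<^sup>2" if "V \<in> T" for V
  proof -
    have "(\<Sum>z\<in>?I. (?u V z)\<^sup>2) = (\<Sum>i<p. \<Sum>l<k. (U V i l)\<^sup>2)" by (simp add: sum.cartesian_product split_beta)
    also have "\<dots> = (\<Sum>l<k. \<Sum>i<p. (U V i l)\<^sup>2)" by (rule sum.swap)
    also have "\<dots> \<le> (\<Sum>l<k. 1)" using Un[OF that] by (intro sum_mono) simp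
    finally show ?thesis by simp
  qed
  then have cu: "\<And>x. x \<in> ?u ` T \<Longrightarrow> (\<Sum>z\<in>?I. (x z)\<^sup>2) \<le> (sqrt k)\<^sup>2" by blast
  have frM: "fro2 k m (M V) \<le> 1" if "V \<in> T" for V
    using UM[OF that] that by (simp add: svd_factors_def T_def)
  have "(\<Sum>z\<in>?J. (?v V z)\<^sup>2) \<le> 1\<^sup>2" if "V \<in> T" for V
    using frM[OF that] by (simp add: fro2_def sum.cartesian_product split_beta)
  then have cv: "\<And>x. x \<in> ?v ` T \<Longrightarrow> (\<Sum>z\<in>?J. (x z)\<^sup>2) \<le> 1\<^sup>2" by blast
  define lab where "lab V = (grid_label ?I ?s (?u V), grid_label ?J ?t (?v V))" for V
  have neI: "?I \<noteq> {}" "?J \<noteq> {}" using p m k by (auto simp: lessThan_empty_iff)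
  have finI: "finite ?I" "finite ?J" by simp_all
  have k0: "0 < sqrt (real k)" using k by simp
  have one: "0 < (1::real)" by simp
  note gu = card_grid_label[where I = ?I and R = "sqrt k" and X = "?u ` T", OF finI(1) neI(1) d k0 cu, unfolded image_image]
  note gv = card_grid_label[where I = ?J and R = 1 and X = "?v ` T", OF finI(2) neI(2) d one cv, unfolded image_image]
  have sub: "lab ` T \<subseteq> ((\<lambda>V. grid_label ?I ?s (?u V)) ` T) \<times> ((\<lambda>V. grid_label ?J ?t (?v V)) ` T)"
    unfolding lab_def by auto
  have fin: "finite (((\<lambda>V. grid_label ?I ?s (?u V)) ` T) \<times> ((\<lambda>V. grid_label ?J ?t (?v V)) ` T))"
    by (rule finite_cartesian_product[OF gu(1) gv(1)])
  have card: "real (card (lab ` T)) \<le> (24 / d) ^ (k * (p + m))"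
  proof -
    have "real (card (lab ` T)) \<le> real (card ((\<lambda>V. grid_label ?I ?s (?u V)) ` T)) * real (card ((\<lambda>V. grid_label ?J ?t (?v V)) ` T))"
      using card_mono[OF fin sub] unfolding card_cartesian_product of_nat_mult[symmetric] of_nat_le_iff .
    also have "\<dots> \<le> (24 / d) ^ card ?I * (24 / d) ^ card ?J"
      by (rule mult_mono[OF gu(2) gv(2)]) (use d in simp_all)
    also have "\<dots> = (24 / d) ^ (k * (p + m))" by (simp add: power_add[symmetric] algebra_simps)
    finally show ?thesis .
  qed
  have close: "\<exists>X Y. lowclass A p m k X \<and> lowclass A p m k Y \<and>
      fro2 p m X \<le> d\<^sup>2 \<and> fro2 p m Y \<le> d\<^sup>2 \<and> (\<forall>i<p. \<forall>j<m. V i j - V' i j = X i j + Y i j)"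
    if V: "V \<in> T" and V': "V' \<in> T" and eq: "lab V = lab V'" for V V'
  proof -
    have e1: "grid_label ?I ?s (?u V) = grid_label ?I ?s (?u V')" and e2: "grid_label ?J ?t (?v V) = grid_label ?J ?t (?v V')"
      using eq unfolding lab_def prod.inject by (rule conjunct1, rule conjunct2)
    have s0: "0 < ?s" and t0: "0 < ?t" unfolding s t using d p k m by simp_all
    have uu: "(U V i l - U V' i l)\<^sup>2 \<le> (d / sqrt p)\<^sup>2" if "i < p" "l < k" for i l
      using grid_label_eqD[OF e1 _ s0, of "(i, l)"] that unfolding s by simp
    have mm: "(M V l j - M V' l j)\<^sup>2 \<le> (d / sqrt (k * m))\<^sup>2" if "l < k" "j < m" for l j
      using grid_label_eqD[OF e2 _ t0, of "(l, j)"] that unfolding t by simp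
    obtain C where C: "\<And>i l. i < p \<Longrightarrow> l < k \<Longrightarrow> U V i l = (\<Sum>h<p. A i h * C h l)"
      using UM[OF V, unfolded svd_factors_def, THEN conjunct1] by (elim exE) (rule that, simp)
    obtain C' where C': "\<And>i l. i < p \<Longrightarrow> l < k \<Longrightarrow> U V' i l = (\<Sum>h<p. A i h * C' h l)"
      using UM[OF V', unfolded svd_factors_def, THEN conjunct1] by (elim exE) (rule that, simp)
    define X where "X i j = (\<Sum>l<k. (U V i l - U V' i l) * M V l j)" for i j
    define Y where "Y i j = (\<Sum>l<k. U V' i l * (M V l j - M V' l j))" for i j
    have "lowclass A p m k X" unfolding lowclass_def X_def
      by (intro exI[of _ "\<lambda>h l. C h l - C' h l"] exI[of _ "M V"] allI impI sum.cong refl)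
        (simp add: C C' right_diff_distrib sum_subtractf)
    moreover have "lowclass A p m k Y" unfolding lowclass_def Y_def
      by (intro exI[of _ C'] exI[of _ "\<lambda>l j. M V l j - M V' l j"] allI impI sum.cong refl) (simp add: C')
    moreover have "V i j - V' i j = X i j + Y i j" if "i < p" "j < m" for i j
    proof -
      show ?thesis unfolding X_def Y_def VUM[OF V that] VUM[OF V' that]
        by (simp add: sum.distrib[symmetric] sum_subtractf[symmetric] algebra_simps)
    qed
    moreover have "fro2 p m X \<le> d\<^sup>2"
    proof -
      have "fro2 p m X = (\<Sum>i<p. \<Sum>l<k. (U V i l - U V' i l)\<^sup>2 * (\<Sum>j<m. (M V l j)\<^sup>2))"
        unfolding fro2_def X_def by (intro sum.cong refl sum_square_orthogonal Mo[OF V])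
      also have "\<dots> \<le> (\<Sum>i<p. \<Sum>l<k. (d / sqrt p)\<^sup>2 * (\<Sum>j<m. (M V l j)\<^sup>2))"
        using uu by (intro sum_mono mult_right_mono sum_nonneg) auto
      also have "\<dots> = d\<^sup>2 * fro2 k m (M V)" using p by (simp add: fro2_def power_divide sum_distrib_left)
      also have "\<dots> \<le> d\<^sup>2 * 1" using frM[OF V] by (intro mult_left_mono) auto
      finally show ?thesis by simp
    qed
    moreover have "fro2 p m Y \<le> d\<^sup>2"
    proof -
      have "fro2 p m Y = (\<Sum>j<m. \<Sum>i<p. (\<Sum>l<k. (M V l j - M V' l j) * U V' i l)\<^sup>2)"
        unfolding fro2_def Y_def by (subst sum.swap) (simp add: mult.commute)
      also have "\<dots> = (\<Sum>j<m. \<Sum>l<k. (M V l j - M V' l j)\<^sup>2 * (\<Sum>i<p. (U V' i l)\<^sup>2))"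
        by (intro sum.cong refl sum_square_orthogonal Uo[OF V'])
      also have "\<dots> \<le> (\<Sum>j<m. \<Sum>l<k. (d / sqrt (k * m))\<^sup>2 * 1)"
      proof (intro sum_mono)
        fix j l assume "j \<in> {..<m}" "l \<in> {..<k}"
        then show "(M V l j - M V' l j)\<^sup>2 * (\<Sum>i<p. (U V' i l)\<^sup>2) \<le> (d / sqrt (k * m))\<^sup>2 * 1"
          using Un[OF V', of l] mm[of l j] by (intro mult_mono sum_nonneg) simp_all
      qed
      also have "\<dots> = d\<^sup>2" using k m by (simp add: power_divide)
      finally show ?thesis .
    qed
    ultimately show ?thesis by (intro exI[of _ X] exI[of _ Y]) simp
  qed
  show ?thesis
  proof (intro exI[of _ lab] conjI[OF _ conjI] ballI impI)
    show "finite (lab ` T)" by (rule finite_subset[OF sub fin])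
  qed (rule card, rule close)
qed

section \<open>Chaining\<close>

lemma exp_le_quadratic:
  fixes y :: real
  assumes "y \<le> 1"
  shows "exp y \<le> 1 + y + y\<^sup>2"
proof (cases "0 \<le> y")
  case True
  then show ?thesis using exp_bound[of y] assms by simp
next
  case False
  define u where "u = - y"
  have u: "0 < u" using False by (simp add: u_def)
  have "exp y = 1 / exp u" by (simp add: u_def exp_minus inverse_eq_divide)
  also have "\<dots> \<le> 1 / (1 + u)" using u exp_ge_add_one_self[of u] by (intro divide_left_mono) auto
  also have "\<dots> \<le> 1 - u + u\<^sup>2"
  proof -
    have "(1 - u + u\<^sup>2) * (1 + u) = 1 + u ^ 3" by (simp add: algebra_simps power2_eq_square power3_eq_cube)
    then have "1 \<le> (1 - u + u\<^sup>2) * (1 + u)" using u by simp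
    then show ?thesis using u by (simp add: pos_divide_le_eq)
  qed
  finally show ?thesis by (simp add: u_def)
qed

text \<open>Bernstein's inequality: the exponent involves the second moment \<open>v\<close>, which
  is what makes finer levels of the chain cheaper. As \<open>\<phi>\<close> deviates from its mean
  by at most 2, \<open>l \<le> 1 / 2\<close> keeps the exponent in the domain of
  \<open>exp_le_quadratic\<close>.\<close>

lemma chernoff_test_centered:
  assumes P: "prob_space P" and [measurable]: "\<phi> \<in> borel_measurable P"
    and b: "\<And>x. \<bar>\<phi> x\<bar> \<le> 1" and v: "(\<integral>x. (\<phi> x)\<^sup>2 \<partial>P) \<le> v"
    and l: "0 < l" "l \<le> 1 / 2" and q: "exp (real n * (l\<^sup>2 * v) - l * c) \<le> q"
  shows "chernoff_test P n (\<lambda>x. \<phi> x - (\<integral>x. \<phi> x \<partial>P)) c q"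
proof -
  interpret prob_space P by fact
  let ?E = "\<integral>x. \<phi> x \<partial>P"
  have i1: "integrable P \<phi>" by (rule integrable_const_bound[of _ 1]) (use b in auto)
  have b2: "(\<phi> x)\<^sup>2 \<le> 1" for x using b[of x] by (simp add: abs_square_le_1)
  have i2: "integrable P (\<lambda>x. (\<phi> x)\<^sup>2)" by (rule integrable_const_bound[of _ 1]) (use b2 in auto)
  have E1: "\<bar>?E\<bar> \<le> 1"
  proof -
    have "\<bar>?E\<bar> \<le> (\<integral>x. \<bar>\<phi> x\<bar> \<partial>P)" by (rule integral_abs_bound)
    also have "\<dots> \<le> (\<integral>x. 1 \<partial>P)" using i1 b by (intro integral_mono) auto
    finally show ?thesis using prob_space by simp
  qed
  define h where "h x = 1 + l * (\<phi> x - ?E) + (l * (\<phi> x - ?E))\<^sup>2" for x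
  have hx: "h x = (1 - l * ?E + l\<^sup>2 * ?E\<^sup>2) + ((l - 2 * l\<^sup>2 * ?E) * \<phi> x + l\<^sup>2 * (\<phi> x)\<^sup>2)" for x
    unfolding h_def by (simp add: power2_eq_square algebra_simps)
  have le: "exp (l * (\<phi> x - ?E)) \<le> h x" for x
  proof -
    have "l * (\<phi> x - ?E) \<le> l * 2" using b[of x] E1 l by (intro mult_left_mono) auto
    also have "\<dots> \<le> 1" using l by simp
    finally show ?thesis unfolding h_def by (rule exp_le_quadratic)
  qed
  have ih: "integrable P h" unfolding hx
    by (intro Bochner_Integration.integrable_add integrable_mult_right i1 i2 integrable_const)
  have "(\<integral>x. h x \<partial>P) = (1 - l * ?E + l\<^sup>2 * ?E\<^sup>2) + ((l - 2 * l\<^sup>2 * ?E) * ?E + l\<^sup>2 * (\<integral>x. (\<phi> x)\<^sup>2 \<partial>P))"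
    unfolding hx using i1 i2 prob_space by simp
  also have "\<dots> = 1 + l\<^sup>2 * (\<integral>x. (\<phi> x)\<^sup>2 \<partial>P) - l\<^sup>2 * ?E\<^sup>2"
    by (simp add: power2_eq_square algebra_simps)
  also have "\<dots> \<le> 1 + l\<^sup>2 * v"
  proof -
    have "0 \<le> l\<^sup>2 * ?E\<^sup>2" by simp
    then show ?thesis using mult_left_mono[OF v zero_le_power2[of l]] by linarith
  qed
  also have "\<dots> \<le> exp (l\<^sup>2 * v)" by (rule exp_ge_add_one_self)
  finally have ih': "(\<integral>x. h x \<partial>P) \<le> exp (l\<^sup>2 * v)" .
  have "(\<integral>\<^sup>+x. ennreal (exp (l * (\<phi> x - ?E))) \<partial>P) \<le> (\<integral>\<^sup>+x. ennreal (h x) \<partial>P)"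
    using le by (intro nn_integral_mono ennreal_leI)
  also have "\<dots> = ennreal (\<integral>x. h x \<partial>P)"
  proof (rule nn_integral_eq_integral[OF ih])
    show "AE x in P. 0 \<le> h x" using le exp_ge_zero order_trans by blast
  qed
  also have "\<dots> \<le> ennreal (exp (l\<^sup>2 * v))" using ih' by (rule ennreal_leI)
  finally have mgf: "(\<integral>\<^sup>+x. ennreal (exp (l * (\<phi> x - ?E))) \<partial>P) \<le> ennreal (exp (l\<^sup>2 * v))" .
  have "0 \<le> (\<integral>x. (\<phi> x)\<^sup>2 \<partial>P)" by (rule integral_nonneg_AE) simp
  then have "0 \<le> v" using v by linarith
  then have v0: "0 \<le> l\<^sup>2 * v" by simp
  show ?thesis unfolding chernoff_test_def
    by (intro conjI exI[of _ l] exI[of _ "l\<^sup>2 * v"]) (use l v0 mgf q in simp_all)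
qed

text \<open>At rate 1, \<open>exp 1 \<le> 3\<close> gives the moment bound \<open>1 + 2 * v\<close>.
  For rare events a threshold of order \<open>n * v\<close> plus the desired exponent is
  enough.\<close>

lemma chernoff_test_indicator:
  assumes P: "prob_space P" and A[measurable]: "Measurable.pred P A"
    and v: "measure P {x\<in>space P. A x} \<le> v" and q: "exp (real n * (2 * v) - c) \<le> q"
  shows "chernoff_test P n (\<lambda>x. of_bool (A x)) c q"
proof -
  interpret prob_space P by fact
  let ?A = "{x\<in>space P. A x}"
  have "(\<integral>\<^sup>+x. ennreal (exp (1 * of_bool (A x))) \<partial>P) \<le> (\<integral>\<^sup>+x. 1 + ennreal 2 * indicator ?A x \<partial>P)"
  proof (rule nn_integral_mono)
    fix x assume "x \<in> space P"
    have "ennreal (exp 1) \<le> ennreal (1 + 2)" using exp_le by (intro ennreal_leI) simp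
    also have "\<dots> = 1 + ennreal 2" by (subst ennreal_plus) auto
    finally show "ennreal (exp (1 * of_bool (A x))) \<le> 1 + ennreal 2 * indicator ?A x"
      using \<open>x \<in> space P\<close> by (auto simp: indicator_def)
  qed
  also have "\<dots> = 1 + ennreal 2 * emeasure P ?A"
    by (subst nn_integral_add) (auto simp: nn_integral_cmult emeasure_space_1)
  also have "\<dots> = ennreal (1 + 2 * measure P ?A)"
    by (subst ennreal_plus) (auto simp: emeasure_eq_measure ennreal_mult)
  also have "\<dots> \<le> ennreal (exp (2 * v))"
    using v exp_ge_add_one_self[of "2 * measure P ?A"] by (intro ennreal_leI order_trans[OF exp_ge_add_one_self]) simp
  finally have mgf: "(\<integral>\<^sup>+x. ennreal (exp (1 * of_bool (A x))) \<partial>P) \<le> ennreal (exp (2 * v))" .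
  have v0: "0 \<le> v" using v measure_nonneg[of P ?A] by linarith
  show ?thesis unfolding chernoff_test_def
    by (intro conjI exI[of _ 1] exI[of _ "2 * v"]) (use v0 mgf q in simp_all)
qed

lemma ensured_ball_exp:
  assumes "finite I" "real (card I) \<le> exp a" "\<And>x. x \<in> I \<Longrightarrow> ensured P n (exp (- a - b)) (R x)"
  shows "ensured P n (exp (- b)) (\<lambda>S \<omega>. \<forall>x\<in>I. R x S \<omega>)"
proof (rule ensured_mono[OF ensured_ball[OF assms(1,3)]])
  have "(\<Sum>x\<in>I. exp (- a - b)) = real (card I) * exp (- a - b)" by simp
  also have "\<dots> \<le> exp a * exp (- a - b)" using assms(2) by (rule mult_right_mono) simp
  also have "\<dots> = exp (- b)" by (simp add: mult_exp_exp)
  finally show "(\<Sum>x\<in>I. exp (- a - b)) \<le> exp (- b)" .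
qed

text \<open>Net points are taken inside \<open>T\<close>, so that whatever is assumed on
  \<open>T\<close>, such as unit norm, also holds for them.\<close>

definition rep :: "'v set \<Rightarrow> ('v \<Rightarrow> 'l) \<Rightarrow> 'v \<Rightarrow> 'v" where
  "rep T lab V = (SOME V'. V' \<in> T \<and> lab V' = lab V)"

lemma rep: assumes "V \<in> T" shows "rep T lab V \<in> T" "lab (rep T lab V) = lab V"
  using someI[of "\<lambda>V'. V' \<in> T \<and> lab V' = lab V" V] assms by (simp_all add: rep_def)

lemma rep_image:
  assumes "finite (lab ` T)"
  shows "finite (rep T lab ` T)" "card (rep T lab ` T) \<le> card (lab ` T)"
proof -
  have "rep T lab ` T = (\<lambda>a. SOME V'. V' \<in> T \<and> lab V' = a) ` (lab ` T)"
    by (simp add: image_image rep_def)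
  then show "finite (rep T lab ` T)" "card (rep T lab ` T) \<le> card (lab ` T)"
    using assms card_image_le[OF assms] by auto
qed

text \<open>\<open>K\<close> is the last level with \<open>2 ^ K * \<eta> \<le> 1 / 2\<close>, so
  2^-K is comparable with \<eta>. The first inequality keeps the test rates admissible, the second
  makes the leftover of the chain of order \<eta>.\<close>

lemma dyadic_scale:
  fixes \<eta> :: real
  assumes "0 < \<eta>" "\<eta> \<le> 1 / 2"
  obtains K :: nat where "2 ^ K * \<eta> \<le> 1 / 2" "1 / 2 ^ K < 4 * \<eta>"
proof -
  obtain N :: nat where N: "1 / (2 * \<eta>) < 2 ^ N"
    using real_arch_pow[of 2 "1 / (2 * \<eta>)"] by auto
  define K where "K = (LEAST j. 1 / (2 * \<eta>) < 2 ^ Suc j)"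
  have ex: "\<exists>j. 1 / (2 * \<eta>) < 2 ^ Suc j"
    using N by (intro exI[of _ N]) (simp add: less_le_trans)
  have K1: "1 / (2 * \<eta>) < 2 ^ Suc K" unfolding K_def using ex by (rule LeastI_ex)
  have "\<not> 1 / (2 * \<eta>) < 2 ^ K"
  proof (cases K)
    case 0
    then show ?thesis using assms by (simp add: field_simps)
  next
    case (Suc j)
    then show ?thesis using not_less_Least[of j "\<lambda>j. 1 / (2 * \<eta>) < 2 ^ Suc j"] unfolding K_def[symmetric] by simp
  qed
  then have "2 ^ K * \<eta> \<le> 1 / 2" using assms by (simp add: field_simps)
  moreover have "1 / 2 ^ K < 4 * \<eta>" using K1 assms by (simp add: field_simps)
  ultimately show ?thesis by (rule that)
qed

lemma sum_exp_levels:
  fixes D :: real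
  assumes "1 \<le> D"
  shows "(\<Sum>j\<le>K. exp (- (real j + 3) * D)) \<le> exp (- 2 * D)"
proof -
  have h: "exp (- D) \<le> 1 / 2"
  proof -
    have "2 \<le> exp D" using exp_ge_add_one_self[of D] assms by linarith
    then have "1 / exp D \<le> 1 / 2" by (intro divide_left_mono) auto
    then show ?thesis by (simp add: exp_minus inverse_eq_divide)
  qed
  have "(\<Sum>j\<le>K. exp (- (real j + 3) * D)) \<le> (\<Sum>j\<le>K. exp (- 2 * D) * (1 / 2) ^ Suc j)"
  proof (rule sum_mono)
    fix j
    have "exp (- (real j + 3) * D) = exp (- 2 * D) * exp (- D) ^ Suc j"
      by (simp add: exp_of_nat_mult[symmetric] mult_exp_exp algebra_simps)
    also have "\<dots> \<le> exp (- 2 * D) * (1 / 2) ^ Suc j" using h by (intro mult_left_mono power_mono) auto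
    finally show "exp (- (real j + 3) * D) \<le> exp (- 2 * D) * (1 / 2) ^ Suc j" .
  qed
  also have "\<dots> = exp (- 2 * D) * (\<Sum>j\<le>K. (1 / 2) ^ Suc j)" by (simp add: sum_distrib_left)
  also have "(\<Sum>j\<le>K. (1 / 2 :: real) ^ Suc j) = 1 - (1 / 2) ^ Suc K" by (induction K) auto
  also have "exp (- 2 * D) * (1 - (1 / 2) ^ Suc K) \<le> exp (- 2 * D) * 1" by (intro mult_left_mono) auto
  finally show ?thesis by simp
qed

lemma sum_geometric_7_8: "(\<Sum>j\<le>K. (7 / 8 :: real) ^ j) \<le> 8"
proof -
  have "(\<Sum>j\<le>K. (7 / 8 :: real) ^ j) = 8 * (1 - (7 / 8) ^ Suc K)" by (induction K) (auto simp: algebra_simps)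
  also have "\<dots> \<le> 8 * 1" by (intro mult_left_mono) auto
  finally show ?thesis by simp
qed

text \<open>Chaining in abstract form for the indicators of \<open>0 \<le> F V\<close>. The entropy
  \<open>c1 * D * (j + 1)\<close> grows linearly in the level, while the probability of a sign
  change within a cell decays like 2^-j; as D = n \<eta>^2, every error comes out as a multiple of n
  \<eta>.\<close>

context
  fixes P :: "'a measure" and T :: "'v set" and F :: "'v \<Rightarrow> 'a \<Rightarrow> real" and lab :: "nat \<Rightarrow> 'v \<Rightarrow> 'l"
    and c1 c2 D \<pi> :: real and n :: nat and \<eta> :: real
  assumes P: "prob_space P" and F: "\<And>V. V \<in> T \<Longrightarrow> F V \<in> borel_measurable P"
    and fin: "\<And>j. finite (lab j ` T)" and card: "\<And>j. real (card (lab j ` T)) \<le> exp (c1 * D * (real j + 1))"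
    and close: "\<And>j V V'. V \<in> T \<Longrightarrow> V' \<in> T \<Longrightarrow> lab j V = lab j V' \<Longrightarrow>
      measure P {x\<in>space P. (0 \<le> F V x) \<noteq> (0 \<le> F V' x)} \<le> c2 / 2 ^ j"
    and small: "\<And>j V. V \<in> T \<Longrightarrow> measure P {x\<in>space P. \<bar>F V x\<bar> \<le> 1 / 4 ^ j} \<le> c2 / 2 ^ j"
    and upper: "\<And>V. V \<in> T \<Longrightarrow> measure P {x\<in>space P. 0 \<le> F V x} \<le> \<pi>"
    and c1: "1 \<le> c1" and c2: "1 \<le> c2" and D: "1 \<le> D" and n: "1 \<le> n"
    and \<eta>_def: "\<eta> = sqrt (D / n)" and \<eta>: "\<eta> \<le> 1 / 2"
begin

interpretation prob_space P by (rule P)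

private lemma eta: "0 < \<eta>" "real n * \<eta>\<^sup>2 = D" "D \<le> real n * \<eta> / 2"
proof -
  show 0: "0 < \<eta>" using D n by (simp add: \<eta>_def)
  show eq: "real n * \<eta>\<^sup>2 = D" using D n by (simp add: \<eta>_def)
  have "\<eta> * \<eta> \<le> \<eta> * (1 / 2)" using 0 \<eta> by (intro mult_left_mono) auto
  then have "real n * (\<eta> * \<eta>) \<le> real n * (\<eta> * (1 / 2))" by (rule mult_left_mono) simp
  then show "D \<le> real n * \<eta> / 2" using eq by (simp add: power2_eq_square)
qed

private definition "r j = rep T (lab j)"

private lemma r: assumes "V \<in> T" shows "r j V \<in> T" "lab j (r j V) = lab j V"
  using rep[OF assms, of "lab j"] by (simp_all add: r_def)

text \<open>Telescoping increments along the chain. Level 0 is the indicator itself, hence the guard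
  around \<open>j - 1\<close>.\<close>

private definition "inc j V x = of_bool (0 \<le> F (r j V) x) - (if j = 0 then 0 else of_bool (0 \<le> F (r (j - 1) V) x) :: real)"

private lemma inc_measurable: "V \<in> T \<Longrightarrow> inc j V \<in> borel_measurable P"
proof -
  assume V: "V \<in> T"
  have [measurable]: "F (r j V) \<in> borel_measurable P" for j by (rule F[OF r(1)[OF V]])
  show ?thesis unfolding inc_def[abs_def] by measurable
qed

text \<open>Consecutive representatives need not share a label, but each shares one with
  \<open>V\<close> at its own level. A change between them is a change against \<open>V\<close>,
  whence \<open>c2 / 2 ^ j + c2 / 2 ^ (j - 1)\<close>.\<close>

private lemma inc_sq: assumes V: "V \<in> T" shows "(\<integral>x. (inc j V x)\<^sup>2 \<partial>P) \<le> 3 * c2 / 2 ^ j"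
proof -
  have [measurable]: "F (r j V) \<in> borel_measurable P" for j by (rule F[OF r(1)[OF V]])
  have [measurable]: "F V \<in> borel_measurable P" by (rule F[OF V])
  have [measurable]: "inc j V \<in> borel_measurable P" by (rule inc_measurable[OF V])
  show ?thesis
  proof (cases "j = 0")
    case True
    have "(\<integral>x. (inc j V x)\<^sup>2 \<partial>P) \<le> (\<integral>x. 1 \<partial>P)"
      by (rule integral_mono) (auto simp: inc_def True intro!: integrable_const_bound[of _ 1])
    then show ?thesis using True c2 prob_space by simp
  next
    case False
    let ?A = "{x\<in>space P. (0 \<le> F (r j V) x) \<noteq> (0 \<le> F V x)}"
    let ?B = "{x\<in>space P. (0 \<le> F V x) \<noteq> (0 \<le> F (r (j - 1) V) x)}"
    have mA: "?A \<in> sets P" and mB: "?B \<in> sets P" by measurable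
    have "(\<integral>x. (inc j V x)\<^sup>2 \<partial>P) \<le> (\<integral>x. indicator (?A \<union> ?B) x \<partial>P)"
      using mA mB False
      by (intro integral_mono integrable_const_bound[of _ 1])
        (auto simp: inc_def indicator_def intro!: borel_measurable_indicator)
    also have "\<dots> = measure P (?A \<union> ?B)" using mA mB by simp
    also have "\<dots> \<le> measure P ?A + measure P ?B" by (rule measure_Un_le[OF mA mB])
    also have "\<dots> \<le> c2 / 2 ^ j + c2 / 2 ^ (j - 1)"
      using r[OF V] V by (intro add_mono close) auto
    also have "\<dots> = 3 * c2 / 2 ^ j" using False by (cases j) (auto simp: field_simps)
    finally show ?thesis .
  qed
qed

text \<open>Six times \<open>3 * c2 + 2 * c1 + 3\<close>: the costs of variance, entropy of pairs
  and probability budget, times the factor lost in (7/6)^j \<ge> (j + 1)/6.\<close>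

private definition "amp = 18 * c2 + 12 * c1 + 18"

text \<open>Rate (4/3)^j \<eta> and deviation (7/8)^j n \<eta> balance the levels: the variance term
  is of order (16/9)^j / 2^j = (8/9)^j and stays bounded, the gain (7/6)^j outgrows the linear
  entropy, and the deviations are summable. The rate stays below 1/2 because (4/3)^j \<le>
  2^K.\<close>

private lemma increments_ensured:
  assumes K: "2 ^ K * \<eta> \<le> 1 / 2" and j: "j \<le> K"
  shows "ensured P n (exp (- (real j + 3) * D)) (\<lambda>S \<omega>. \<forall>V\<in>T.
    (\<Sum>i\<in>{..<n} - S. inc j V (\<omega> i) - (\<integral>x. inc j V x \<partial>P)) \<le> amp * (7 / 8) ^ j * (real n * \<eta>))"
proof -
  \<comment> \<open>Increments depend on \<open>V\<close> only through a pair of representatives, so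
    the union bound runs over pairs and the cardinality is squared.\<close>
  define I where "I = (\<lambda>V. (r j V, r (j - 1) V)) ` T"
  define ic where "ic z x = of_bool (0 \<le> F (fst z) x) - (if j = 0 then 0 else of_bool (0 \<le> F (snd z) x) :: real)" for z x
  have ic: "inc j V = ic (r j V, r (j - 1) V)" for V by (auto simp: inc_def ic_def)
  have sub: "I \<subseteq> (r j ` T) \<times> (r (j - 1) ` T)" by (auto simp: I_def)
  have finr: "finite (r j ` T)" for j unfolding r_def by (rule rep_image(1)[OF fin])
  have cr: "real (card (r j' ` T)) \<le> exp (c1 * D * (real j + 1))" if "j' \<le> j" for j'
  proof -
    have "real (card (r j' ` T)) \<le> real (card (lab j' ` T))" unfolding r_def using rep_image(2)[OF fin] by simp
    also have "\<dots> \<le> exp (c1 * D * (real j' + 1))" by (rule card)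
    also have "\<dots> \<le> exp (c1 * D * (real j + 1))" using that c1 D by (intro exp_le_cancel_iff[THEN iffD2] mult_left_mono) auto
    finally show ?thesis .
  qed
  have finI: "finite I" by (rule finite_subset[OF sub finite_cartesian_product[OF finr finr]])
  have "real (card I) \<le> real (card (r j ` T)) * real (card (r (j - 1) ` T))"
    using card_mono[OF finite_cartesian_product[OF finr finr] sub]
    unfolding card_cartesian_product of_nat_mult[symmetric] of_nat_le_iff .
  also have "\<dots> \<le> exp (c1 * D * (real j + 1)) * exp (c1 * D * (real j + 1))"
    by (intro mult_mono cr) auto
  also have "\<dots> = exp (2 * c1 * D * (real j + 1))" by (simp add: mult_exp_exp)
  finally have cardI: "real (card I) \<le> exp (2 * c1 * D * (real j + 1))" .
  define l where "l = (4 / 3) ^ j * \<eta>"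
  have l0: "0 < l" using eta by (simp add: l_def)
  have "(4 / 3 :: real) ^ j \<le> 2 ^ j" by (intro power_mono) auto
  also have "\<dots> \<le> 2 ^ K" using j by (intro power_increasing) auto
  finally have "l \<le> 2 ^ K * \<eta>" unfolding l_def using eta by (intro mult_right_mono) auto
  then have l1: "l \<le> 1 / 2" using K by linarith
  have expo: "real n * (l\<^sup>2 * (3 * c2 / 2 ^ j)) - l * (amp * (7 / 8) ^ j * (real n * \<eta>)) \<le> - (2 * c1 * D * (real j + 1)) - (real j + 3) * D"
  proof -
    have "real n * (l\<^sup>2 * (3 * c2 / 2 ^ j)) = (real n * \<eta>\<^sup>2) * (3 * c2) * (((4 / 3) ^ j)\<^sup>2 / 2 ^ j)"
      by (simp add: l_def power_mult_distrib)
    also have "((4 / 3 :: real) ^ j)\<^sup>2 / 2 ^ j = (8 / 9) ^ j"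
      by (simp add: power2_eq_square power_mult_distrib[symmetric] power_divide[symmetric] del: power_divide)
    also have "(real n * \<eta>\<^sup>2) * (3 * c2) * (8 / 9) ^ j \<le> D * (3 * c2) * 1"
      unfolding eta(2) using D c2 by (intro mult_left_mono power_le_one) auto
    also have "D * (3 * c2) * 1 = 3 * c2 * D" by simp
    finally have 1: "real n * (l\<^sup>2 * (3 * c2 / 2 ^ j)) \<le> 3 * c2 * D" .
    have "l * (amp * (7 / 8) ^ j * (real n * \<eta>)) = amp * (real n * \<eta>\<^sup>2) * ((4 / 3) ^ j * (7 / 8) ^ j)"
      by (simp add: l_def power2_eq_square)
    also have "\<dots> = amp * D * (7 / 6) ^ j" unfolding eta(2) power_mult_distrib[symmetric] by simp
    finally have 2: "l * (amp * (7 / 8) ^ j * (real n * \<eta>)) = amp * D * (7 / 6) ^ j" .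
    \<comment> \<open>Bernoulli's inequality replaces the exponential gain by a linear one that
      matches the entropy.\<close>
    have "(real j + 1) / 6 \<le> 1 + real j * (1 / 6)" by simp
    also have "\<dots> \<le> (1 + 1 / 6) ^ j" by (rule Bernoulli_inequality) simp
    finally have "amp * D * ((real j + 1) / 6) \<le> amp * D * (7 / 6) ^ j"
      using c1 c2 D by (intro mult_left_mono) (auto simp: amp_def)
    moreover have "amp * D * ((real j + 1) / 6) = 3 * c2 * D * (real j + 1) + 2 * c1 * D * (real j + 1) + 3 * D * (real j + 1)"
    proof -
      have "amp = 6 * (3 * c2 + 2 * c1 + 3)" by (simp add: amp_def)
      moreover have "6 * x * D * (y / 6) = x * D * y" for x y :: real by simp
      ultimately have "amp * D * ((real j + 1) / 6) = (3 * c2 + 2 * c1 + 3) * D * (real j + 1)" by metis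
      then show ?thesis by (simp only: distrib_right)
    qed
    moreover have "3 * c2 * D \<le> 3 * c2 * D * (real j + 1)" using c2 D by (simp add: algebra_simps)
    moreover have "(real j + 3) * D \<le> 3 * D * (real j + 1)" using D by (simp add: algebra_simps)
    ultimately show ?thesis using 1 unfolding 2 by linarith
  qed
  have "ensured P n (exp (- (2 * c1 * D * (real j + 1)) - (real j + 3) * D))
      (\<lambda>S \<omega>. (\<Sum>i\<in>{..<n} - S. ic z (\<omega> i) - (\<integral>x. ic z x \<partial>P)) \<le> amp * (7 / 8) ^ j * (real n * \<eta>))" if z: "z \<in> I" for z
  proof -
    obtain V where V: "V \<in> T" "z = (r j V, r (j - 1) V)" using z by (auto simp: I_def)
    then have ici: "ic z = inc j V" using ic[of V] by simp
    have b: "\<bar>inc j V x\<bar> \<le> 1" for x by (simp add: inc_def)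
    show ?thesis unfolding ici
      by (rule chernoff_testD[OF chernoff_test_centered[OF P inc_measurable[OF V(1)] b inc_sq[OF V(1)] l0 l1]])
        (use expo in simp)
  qed
  from ensured_ball_exp[OF finI cardI this]
  have "ensured P n (exp (- ((real j + 3) * D))) (\<lambda>S \<omega>. \<forall>z\<in>I. (\<Sum>i\<in>{..<n} - S. ic z (\<omega> i) - (\<integral>x. ic z x \<partial>P)) \<le> amp * (7 / 8) ^ j * (real n * \<eta>))" .
  then show ?thesis
  proof (rule ensured_mono)
    show "exp (- ((real j + 3) * D)) \<le> exp (- (real j + 3) * D)" by (simp add: algebra_simps)
  qed (auto simp: ic I_def)
qed

text \<open>At the last level the expected number of near-zero values is at most n c2 2^-K, hence at
  most 4 c2 n \<eta>. The entropy is affordable since \<open>K + 1 \<le> 2 ^ K\<close> and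
  \<open>2 ^ K * \<eta> \<le> 1 / 2\<close> give D (K + 1) \<le> n \<eta> / 2.\<close>

private lemma margin_ensured:
  assumes K: "2 ^ K * \<eta> \<le> 1 / 2" "1 / 2 ^ K < 4 * \<eta>"
  shows "ensured P n (exp (- 3 * D)) (\<lambda>S \<omega>. \<forall>V\<in>T.
    (\<Sum>i\<in>{..<n} - S. of_bool (\<bar>F (r K V) (\<omega> i)\<bar> \<le> 1 / 4 ^ K)) \<le> (8 * c2 + c1 + 2) * (real n * \<eta>))"
proof -
  define I where "I = r K ` T"
  have finI: "finite I" unfolding I_def r_def by (rule rep_image(1)[OF fin])
  have "real (card I) \<le> real (card (lab K ` T))" unfolding I_def r_def using rep_image(2)[OF fin] by simp
  also have "\<dots> \<le> exp (c1 * D * (real K + 1))" by (rule card)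
  finally have cardI: "real (card I) \<le> exp (c1 * D * (real K + 1))" .
  have cD: "c1 * D * (real K + 1) \<le> c1 * (real n * \<eta> / 2)"
  proof -
    have "real K + 1 \<le> 2 ^ K"
      using less_exp[of K] by (metis Suc_leI of_nat_Suc of_nat_le_iff of_nat_numeral of_nat_power add.commute)
    then have "(real K + 1) * \<eta> \<le> 1 / 2" using K eta(1) mult_right_mono[of "real K + 1" "2 ^ K" \<eta>] by linarith
    then have "real n * \<eta> * ((real K + 1) * \<eta>) \<le> real n * \<eta> * (1 / 2)" using eta(1) by (intro mult_left_mono) auto
    moreover have "real n * \<eta> * ((real K + 1) * \<eta>) = D * (real K + 1)" unfolding eta(2)[symmetric] by (simp add: power2_eq_square)
    ultimately have "D * (real K + 1) \<le> real n * \<eta> / 2" by simp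
    then show ?thesis using c1 unfolding mult.assoc by (intro mult_left_mono) auto
  qed
  have "ensured P n (exp (- (c1 * D * (real K + 1)) - 3 * D))
      (\<lambda>S \<omega>. (\<Sum>i\<in>{..<n} - S. of_bool (\<bar>F V (\<omega> i)\<bar> \<le> 1 / 4 ^ K)) \<le> (8 * c2 + c1 + 2) * (real n * \<eta>))" if V: "V \<in> I" for V
  proof (rule chernoff_testD[OF chernoff_test_indicator[OF P]])
    have VT: "V \<in> T" using V r by (auto simp: I_def)
    have [measurable]: "F V \<in> borel_measurable P" by (rule F[OF VT])
    show "Measurable.pred P (\<lambda>x. \<bar>F V x\<bar> \<le> 1 / 4 ^ K)" by measurable
    have "c2 / 2 ^ K \<le> c2 * (4 * \<eta>)" using K(2) c2 mult_left_mono[of "1 / 2 ^ K" "4 * \<eta>" c2] by simp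
    then show "measure P {x\<in>space P. \<bar>F V x\<bar> \<le> 1 / 4 ^ K} \<le> 4 * c2 * \<eta>" using small[OF VT, of K] by linarith
    have "c1 * (real n * \<eta> / 2) + 3 * (real n * \<eta> / 2) \<le> (c1 + 2) * (real n * \<eta>)"
    proof -
      have "0 \<le> c1 * (real n * \<eta>)" "0 \<le> real n * \<eta>" using c1 eta(1) by simp_all
      moreover have "c1 * (real n * \<eta> / 2) = c1 * (real n * \<eta>) / 2" by simp
      ultimately show ?thesis unfolding distrib_right by linarith
    qed
    then show "exp (real n * (2 * (4 * c2 * \<eta>)) - (8 * c2 + c1 + 2) * (real n * \<eta>)) \<le> exp (- (c1 * D * (real K + 1)) - 3 * D)"
      using cD eta(3) by (simp add: algebra_simps)
  qed
  from ensured_ball_exp[OF finI cardI this] show ?thesis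
    by (rule ensured_mono) (auto simp: I_def)
qed

text \<open>If \<open>0 \<le> F V\<close>, then the representative is nonnegative, or within 4^-K of
  0, or \<open>F V\<close> exceeds it by more than 4^-K. Increments handle the first case and the
  margin the second; the third involves all \<open>V\<close> of a cell and stays in the conclusion.
  The constants are those of \<open>8 * amp + (8 * c2 + c1 + 2)\<close>.\<close>

lemma chaining:
  "\<exists>K. 2 ^ K * \<eta> \<le> 1 / 2 \<and> 1 / 2 ^ K < 4 * \<eta> \<and> ensured P n (2 * exp (- 2 * D)) (\<lambda>S \<omega>. \<forall>V\<in>T. \<exists>V'\<in>T. lab K V' = lab K V \<and>
    (\<Sum>i\<in>{..<n} - S. of_bool (0 \<le> F V (\<omega> i))) \<le> real (card ({..<n} - S)) * \<pi> + (152 * c2 + 97 * c1 + 146) * (real n * \<eta>) +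
      (\<Sum>i\<in>{..<n} - S. of_bool (1 / 4 ^ K < F V (\<omega> i) - F V' (\<omega> i))))"
proof -
  obtain K :: nat where K: "2 ^ K * \<eta> \<le> 1 / 2" "1 / 2 ^ K < 4 * \<eta>" using dyadic_scale[OF eta(1) \<eta>] .
  have "ensured P n (\<Sum>j\<in>{..K}. exp (- (real j + 3) * D)) (\<lambda>S \<omega>. \<forall>j\<in>{..K}. \<forall>V\<in>T.
    (\<Sum>i\<in>{..<n} - S. inc j V (\<omega> i) - (\<integral>x. inc j V x \<partial>P)) \<le> amp * (7 / 8) ^ j * (real n * \<eta>))"
    using increments_ensured[OF K(1)] by (intro ensured_ball) auto
  from ensured_conj[OF this margin_ensured[OF K]]
  have "ensured P n (2 * exp (- 2 * D)) (\<lambda>S \<omega>. \<forall>V\<in>T. \<exists>V'\<in>T. lab K V' = lab K V \<and>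
    (\<Sum>i\<in>{..<n} - S. of_bool (0 \<le> F V (\<omega> i))) \<le> real (card ({..<n} - S)) * \<pi> + (152 * c2 + 97 * c1 + 146) * (real n * \<eta>) +
      (\<Sum>i\<in>{..<n} - S. of_bool (1 / 4 ^ K < F V (\<omega> i) - F V' (\<omega> i))))"
  proof (rule ensured_mono)
    have "exp (- 3 * D) \<le> exp (- 2 * D)" using D by simp
    then show "(\<Sum>j\<in>{..K}. exp (- (real j + 3) * D)) + exp (- 3 * D) \<le> 2 * exp (- 2 * D)"
      using sum_exp_levels[OF D, of K] by linarith
  next
    fix S :: "nat set" and \<omega> :: "nat \<Rightarrow> 'a"
    assume "(\<forall>j\<in>{..K}. \<forall>V\<in>T. (\<Sum>i\<in>{..<n} - S. inc j V (\<omega> i) - (\<integral>x. inc j V x \<partial>P)) \<le> amp * (7 / 8) ^ j * (real n * \<eta>)) \<and>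
      (\<forall>V\<in>T. (\<Sum>i\<in>{..<n} - S. of_bool (\<bar>F (r K V) (\<omega> i)\<bar> \<le> 1 / 4 ^ K)) \<le> (8 * c2 + c1 + 2) * (real n * \<eta>))"
    then have A: "\<And>j V. j \<le> K \<Longrightarrow> V \<in> T \<Longrightarrow> (\<Sum>i\<in>{..<n} - S. inc j V (\<omega> i) - (\<integral>x. inc j V x \<partial>P)) \<le> amp * (7 / 8) ^ j * (real n * \<eta>)"
      and B: "\<And>V. V \<in> T \<Longrightarrow> (\<Sum>i\<in>{..<n} - S. of_bool (\<bar>F (r K V) (\<omega> i)\<bar> \<le> 1 / 4 ^ K)) \<le> (8 * c2 + c1 + 2) * (real n * \<eta>)"
      by simp_all
    let ?I = "{..<n} - S"
    show "\<forall>V\<in>T. \<exists>V'\<in>T. lab K V' = lab K V \<and>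
      (\<Sum>i\<in>?I. of_bool (0 \<le> F V (\<omega> i))) \<le> real (card ?I) * \<pi> + (152 * c2 + 97 * c1 + 146) * (real n * \<eta>) +
        (\<Sum>i\<in>?I. of_bool (1 / 4 ^ K < F V (\<omega> i) - F V' (\<omega> i)))"
    proof
      fix V assume V: "V \<in> T"
      have tele: "(\<Sum>j\<le>k. inc j V x) = of_bool (0 \<le> F (r k V) x)" for k x
        by (induction k) (auto simp: inc_def)
      have intinc: "integrable P (inc j V)" for j
        by (rule integrable_const_bound[of _ 1]) (auto simp: inc_def intro: inc_measurable[OF V])
      have [measurable]: "F (r K V) \<in> borel_measurable P" by (rule F[OF r(1)[OF V]])
      \<comment> \<open>The expectations telescope too: their sum is one probability bounded by
        \<open>\<pi>\<close>, so the main term is the number of retained indices times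
        \<open>\<pi>\<close>.\<close>
      have "(\<Sum>j\<le>K. \<integral>x. inc j V x \<partial>P) = (\<integral>x. (\<Sum>j\<le>K. inc j V x) \<partial>P)"
        by (rule Bochner_Integration.integral_sum[symmetric]) (rule intinc)
      also have "\<dots> = (\<integral>x. indicator {x\<in>space P. 0 \<le> F (r K V) x} x \<partial>P)"
        unfolding tele by (rule Bochner_Integration.integral_cong) (auto simp: indicator_def)
      also have "\<dots> = measure P {x\<in>space P. 0 \<le> F (r K V) x}" by simp
      also have "\<dots> \<le> \<pi>" by (rule upper[OF r(1)[OF V]])
      finally have pi: "(\<Sum>j\<le>K. \<integral>x. inc j V x \<partial>P) \<le> \<pi>" .
      have "(\<Sum>i\<in>?I. of_bool (0 \<le> F (r K V) (\<omega> i))) = (\<Sum>i\<in>?I. \<Sum>j\<le>K. inc j V (\<omega> i))" by (simp only: tele)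
      also have "\<dots> = (\<Sum>j\<le>K. \<Sum>i\<in>?I. inc j V (\<omega> i))" by (rule sum.swap)
      also have "\<dots> = (\<Sum>j\<le>K. (\<Sum>i\<in>?I. inc j V (\<omega> i) - (\<integral>x. inc j V x \<partial>P)) + real (card ?I) * (\<integral>x. inc j V x \<partial>P))"
        by (simp add: sum_subtractf)
      also have "\<dots> \<le> (\<Sum>j\<le>K. amp * (7 / 8) ^ j * (real n * \<eta>) + real (card ?I) * (\<integral>x. inc j V x \<partial>P))"
        by (intro sum_mono add_right_mono A V) simp
      also have "\<dots> = amp * (real n * \<eta>) * (\<Sum>j\<le>K. (7 / 8) ^ j) + real (card ?I) * (\<Sum>j\<le>K. \<integral>x. inc j V x \<partial>P)"
        by (simp add: sum.distrib sum_distrib_left mult_ac)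
      also have "\<dots> \<le> amp * (real n * \<eta>) * 8 + real (card ?I) * \<pi>"
        using pi eta(1) c1 c2 by (intro add_mono mult_left_mono sum_geometric_7_8) (auto simp: amp_def)
      finally have main: "(\<Sum>i\<in>?I. of_bool (0 \<le> F (r K V) (\<omega> i))) \<le> amp * (real n * \<eta>) * 8 + real (card ?I) * \<pi>" .
      have "(\<Sum>i\<in>?I. of_bool (0 \<le> F V (\<omega> i))) \<le> (\<Sum>i\<in>?I. of_bool (0 \<le> F (r K V) (\<omega> i)) +
          of_bool (\<bar>F (r K V) (\<omega> i)\<bar> \<le> 1 / 4 ^ K) + of_bool (1 / 4 ^ K < F V (\<omega> i) - F (r K V) (\<omega> i)) :: real)"
        by (rule sum_mono) (auto simp: abs_if not_le not_less split: if_splits)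
      also have "\<dots> = (\<Sum>i\<in>?I. of_bool (0 \<le> F (r K V) (\<omega> i))) + (\<Sum>i\<in>?I. of_bool (\<bar>F (r K V) (\<omega> i)\<bar> \<le> 1 / 4 ^ K))
          + (\<Sum>i\<in>?I. of_bool (1 / 4 ^ K < F V (\<omega> i) - F (r K V) (\<omega> i)))"
        by (simp only: sum.distrib)
      finally have "(\<Sum>i\<in>?I. of_bool (0 \<le> F V (\<omega> i))) \<le> amp * (real n * \<eta>) * 8 + real (card ?I) * \<pi> + (8 * c2 + c1 + 2) * (real n * \<eta>)
          + (\<Sum>i\<in>?I. of_bool (1 / 4 ^ K < F V (\<omega> i) - F (r K V) (\<omega> i)))"
        using main B[OF V] by linarith
      also have "amp * (real n * \<eta>) * 8 + real (card ?I) * \<pi> + (8 * c2 + c1 + 2) * (real n * \<eta>) =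
          real (card ?I) * \<pi> + (152 * c2 + 97 * c1 + 146) * (real n * \<eta>)"
        by (simp add: amp_def algebra_simps)
      finally show "\<exists>V'\<in>T. lab K V' = lab K V \<and>
        (\<Sum>i\<in>?I. of_bool (0 \<le> F V (\<omega> i))) \<le> real (card ?I) * \<pi> + (152 * c2 + 97 * c1 + 146) * (real n * \<eta>) +
          (\<Sum>i\<in>?I. of_bool (1 / 4 ^ K < F V (\<omega> i) - F V' (\<omega> i)))"
        using r[OF V, of K] by (intro bexI[of _ "r K V"] conjI) simp_all
    qed
  qed
  then show ?thesis using K by (intro exI[of _ K]) simp
qed

end

text \<open>The crude bound \<open>M0\<close> only makes the supremum finite; the self-bounding step
  then absorbs half of it.\<close>

lemma bootstrap_bound:
  fixes N :: "'v \<Rightarrow> real"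
  assumes bdd: "\<And>V. V \<in> T \<Longrightarrow> N V \<le> M0"
    and step: "\<And>V M. V \<in> T \<Longrightarrow> (\<And>W. W \<in> T \<Longrightarrow> N W \<le> M) \<Longrightarrow> N V \<le> B + M / 2"
    and V: "V \<in> T"
  shows "N V \<le> 2 * B"
proof -
  have b: "bdd_above (N ` T)" using bdd by (intro bdd_aboveI[of _ M0]) auto
  have up: "N W \<le> (SUP V\<in>T. N V)" if "W \<in> T" for W using that b by (rule cSUP_upper)
  have "(SUP V\<in>T. N V) \<le> B + (SUP V\<in>T. N V) / 2"
  proof (rule cSUP_least)
    show "T \<noteq> {}" using V by auto
    show "N W \<le> B + (SUP V\<in>T. N V) / 2" if "W \<in> T" for W by (rule step[OF that up])
  qed
  then show ?thesis using up[OF V] by linarith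
qed

section \<open>Uniform halfspace counts\<close>

lemma gform_scale: "gform p m (\<lambda>i j. c * V i j) z w = c * gform p m V z w"
  unfolding gform_def by (simp add: sum_distrib_left mult_ac)

lemma qform_scale: "qform p m (\<lambda>i j. c * V i j) z = c\<^sup>2 * qform p m V z"
proof -
  have eq: "(\<Sum>i<p. c * V i j * z i) = c * (\<Sum>i<p. V i j * z i)" for j by (simp add: sum_distrib_left mult_ac)
  show ?thesis unfolding qform_def eq power_mult_distrib by (rule sum_distrib_left[symmetric])
qed

lemma fro2_scale: "fro2 p m (\<lambda>i j. c * V i j) = c\<^sup>2 * fro2 p m V"
  unfolding fro2_def by (simp add: power_mult_distrib sum_distrib_left)

lemma lowclass_scale: "lowclass A p m k V \<Longrightarrow> lowclass A p m k (\<lambda>i j. c * V i j)"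
proof -
  assume "lowclass A p m k V"
  then obtain C D where "\<forall>i<p. \<forall>j<m. V i j = (\<Sum>l<k. (\<Sum>h<p. A i h * C h l) * D l j)"
    unfolding lowclass_def by (elim exE)
  then show ?thesis unfolding lowclass_def
    by (intro exI[of _ C] exI[of _ "\<lambda>l j. c * D l j"]) (simp add: sum_distrib_left mult_ac)
qed

lemma gform_cong: "(\<And>i j. i < p \<Longrightarrow> j < m \<Longrightarrow> V i j = V' i j) \<Longrightarrow> gform p m V z w = gform p m V' z w"
  unfolding gform_def by (intro sum.cong refl arg_cong2[where f = "(*)"]) simp

lemma qform_cong: "(\<And>i j. i < p \<Longrightarrow> j < m \<Longrightarrow> V i j = V' i j) \<Longrightarrow> qform p m V z = qform p m V' z"
  unfolding qform_def by (intro sum.cong refl arg_cong[where f = "\<lambda>x. x\<^sup>2"]) simp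

lemma fro2_cong: "(\<And>i j. i < p \<Longrightarrow> j < m \<Longrightarrow> V i j = V' i j) \<Longrightarrow> fro2 p m V = fro2 p m V'"
  unfolding fro2_def by (intro sum.cong refl) simp

lemma entry_square_le_fro2: "i < p \<Longrightarrow> j < m \<Longrightarrow> (V i j)\<^sup>2 \<le> fro2 p m V"
proof -
  assume *: "i < p" "j < m"
  have "(V i j)\<^sup>2 \<le> (\<Sum>j<m. (V i j)\<^sup>2)" using * by (intro member_le_sum) auto
  also have "\<dots> \<le> fro2 p m V"
    unfolding fro2_def using * by (intro member_le_sum[where f = "\<lambda>i. \<Sum>j<m. (V i j)\<^sup>2"] sum_nonneg) auto
  finally show ?thesis .
qed

lemma entry_le_fro2: "fro2 p m V \<le> 1 \<Longrightarrow> i < p \<Longrightarrow> j < m \<Longrightarrow> \<bar>V i j\<bar> \<le> 1"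
  using entry_square_le_fro2[of i p j m V] by (simp add: abs_square_le_1[symmetric])

lemma abs_lin_le:
  assumes "fro2 p m V \<le> 1" "j < m"
  shows "\<bar>\<Sum>i<p. V i j * z i\<bar> \<le> (\<Sum>i<p. \<bar>z i\<bar>)"
proof (rule order_trans[OF sum_abs sum_mono])
  fix i assume "i \<in> {..<p}"
  then have "\<bar>V i j\<bar> * \<bar>z i\<bar> \<le> 1 * \<bar>z i\<bar>" using entry_le_fro2[OF assms(1) _ assms(2)] by (intro mult_right_mono) auto
  then show "\<bar>V i j * z i\<bar> \<le> \<bar>z i\<bar>" by (simp add: abs_mult)
qed

lemma abs_gform_le: "fro2 p m V \<le> 1 \<Longrightarrow> \<bar>gform p m V z w\<bar> \<le> (\<Sum>j<m. (\<Sum>i<p. \<bar>z i\<bar>) * \<bar>w j\<bar>)"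
  unfolding gform_def
  by (rule order_trans[OF sum_abs sum_mono]) (simp add: abs_mult abs_lin_le mult_right_mono)

lemma qform_le: "fro2 p m V \<le> 1 \<Longrightarrow> qform p m V z \<le> (\<Sum>j<m. (\<Sum>i<p. \<bar>z i\<bar>)\<^sup>2)"
  unfolding qform_def
proof (rule sum_mono)
  fix j assume "fro2 p m V \<le> 1" "j \<in> {..<m}"
  then have "\<bar>\<Sum>i<p. V i j * z i\<bar>\<^sup>2 \<le> (\<Sum>i<p. \<bar>z i\<bar>)\<^sup>2" using abs_lin_le[of p m V j z] by (intro power_mono) auto
  then show "(\<Sum>i<p. V i j * z i)\<^sup>2 \<le> (\<Sum>i<p. \<bar>z i\<bar>)\<^sup>2" by simp
qed

definition lowball :: "(nat \<Rightarrow> nat \<Rightarrow> real) \<Rightarrow> nat \<Rightarrow> nat \<Rightarrow> nat \<Rightarrow> (nat \<Rightarrow> nat \<Rightarrow> real) set" where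
  "lowball A p m k = {V. lowclass A p m k V \<and> fro2 p m V \<le> 1}"

text \<open>Closeness in the form the class can use: it is a cone but not closed under sums, so
  smallness is stated for two summands in the class instead of for the difference.\<close>

definition splits :: "(nat \<Rightarrow> nat \<Rightarrow> real) \<Rightarrow> nat \<Rightarrow> nat \<Rightarrow> nat \<Rightarrow> real \<Rightarrow> (nat \<Rightarrow> nat \<Rightarrow> real) \<Rightarrow> (nat \<Rightarrow> nat \<Rightarrow> real) \<Rightarrow> bool" where
  "splits A p m k d V V' \<longleftrightarrow> (\<exists>X Y. lowclass A p m k X \<and> lowclass A p m k Y \<and>
      fro2 p m X \<le> d\<^sup>2 \<and> fro2 p m Y \<le> d\<^sup>2 \<and> (\<forall>i<p. \<forall>j<m. V i j - V' i j = X i j + Y i j))"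

text \<open>Self-similarity: a member of norm at most \<open>d\<close> is \<open>d\<close> times a
  member of the unit ball, so bounds on the ball transfer to small members with a factor.\<close>

lemma lowball_rescale:
  assumes "lowclass A p m k X" "fro2 p m X \<le> d\<^sup>2" "0 < d"
  shows "(\<lambda>i j. inverse d * X i j) \<in> lowball A p m k"
proof -
  have "(inverse d)\<^sup>2 * fro2 p m X \<le> (inverse d)\<^sup>2 * d\<^sup>2" using assms(2) by (rule mult_left_mono) simp
  also have "\<dots> = 1" using assms(3) by (simp add: power_mult_distrib[symmetric])
  finally show ?thesis using assms(1) by (simp add: lowball_def fro2_scale lowclass_scale)
qed

lemma sum_gform_rescale:
  assumes X: "lowclass A p m k X" "fro2 p m X \<le> d\<^sup>2" "0 < d"
    and M: "\<And>V. V \<in> lowball A p m k \<Longrightarrow> (\<Sum>i\<in>I. \<bar>gform p m V (z i) (w i)\<bar>) \<le> M"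
  shows "(\<Sum>i\<in>I. \<bar>gform p m X (z i) (w i)\<bar>) \<le> d * M"
proof -
  have "inverse d * (\<Sum>i\<in>I. \<bar>gform p m X (z i) (w i)\<bar>) \<le> M"
    using M[OF lowball_rescale[OF X]] X(3) by (simp add: gform_scale abs_mult sum_distrib_left)
  then show ?thesis using X(3) by (simp add: field_simps)
qed

lemma sum_qform_rescale:
  assumes X: "lowclass A p m k X" "fro2 p m X \<le> d\<^sup>2" "0 < d"
    and M: "\<And>V. V \<in> lowball A p m k \<Longrightarrow> (\<Sum>i\<in>I. qform p m V (z i)) \<le> M"
  shows "(\<Sum>i\<in>I. qform p m X (z i)) \<le> d\<^sup>2 * M"
proof -
  have "(inverse d)\<^sup>2 * (\<Sum>i\<in>I. qform p m X (z i)) \<le> M"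
    using M[OF lowball_rescale[OF X]] by (simp add: qform_scale sum_distrib_left)
  then have "d\<^sup>2 * ((inverse d)\<^sup>2 * (\<Sum>i\<in>I. qform p m X (z i))) \<le> d\<^sup>2 * M" by (rule mult_left_mono) simp
  moreover have "d\<^sup>2 * ((inverse d)\<^sup>2 * x) = x" for x using X(3) by (simp add: field_simps)
  ultimately show ?thesis by simp
qed

lemma sum_gform_split:
  assumes "splits A p m k d V V'" "0 < d"
    and M: "\<And>V. V \<in> lowball A p m k \<Longrightarrow> (\<Sum>i\<in>I. \<bar>gform p m V (z i) (w i)\<bar>) \<le> M"
  shows "(\<Sum>i\<in>I. \<bar>gform p m (\<lambda>a b. V a b - V' a b) (z i) (w i)\<bar>) \<le> 2 * d * M"
proof -
  obtain X Y where X: "lowclass A p m k X" "fro2 p m X \<le> d\<^sup>2" and Y: "lowclass A p m k Y" "fro2 p m Y \<le> d\<^sup>2"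
    and eq: "\<forall>i<p. \<forall>j<m. V i j - V' i j = X i j + Y i j"
    using assms(1) unfolding splits_def by (elim exE conjE)
  have "(\<Sum>i\<in>I. \<bar>gform p m (\<lambda>a b. V a b - V' a b) (z i) (w i)\<bar>) \<le> (\<Sum>i\<in>I. \<bar>gform p m X (z i) (w i)\<bar> + \<bar>gform p m Y (z i) (w i)\<bar>)"
  proof (rule sum_mono)
    fix i
    have "gform p m (\<lambda>a b. V a b - V' a b) (z i) (w i) = gform p m X (z i) (w i) + gform p m Y (z i) (w i)"
      unfolding gform_add[symmetric] using eq by (intro gform_cong) simp
    then show "\<bar>gform p m (\<lambda>a b. V a b - V' a b) (z i) (w i)\<bar> \<le> \<bar>gform p m X (z i) (w i)\<bar> + \<bar>gform p m Y (z i) (w i)\<bar>"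
      by (simp add: abs_triangle_ineq)
  qed
  also have "\<dots> \<le> d * M + d * M"
    unfolding sum.distrib using X Y assms(2) M by (intro add_mono sum_gform_rescale)
  finally show ?thesis by (simp add: mult_ac)
qed

lemma sum_qform_split:
  assumes "splits A p m k d V V'" "0 < d"
    and M: "\<And>V. V \<in> lowball A p m k \<Longrightarrow> (\<Sum>i\<in>I. qform p m V (z i)) \<le> M"
  shows "(\<Sum>i\<in>I. qform p m (\<lambda>a b. V a b - V' a b) (z i)) \<le> 4 * d\<^sup>2 * M"
proof -
  obtain X Y where X: "lowclass A p m k X" "fro2 p m X \<le> d\<^sup>2" and Y: "lowclass A p m k Y" "fro2 p m Y \<le> d\<^sup>2"
    and eq: "\<forall>i<p. \<forall>j<m. V i j - V' i j = X i j + Y i j"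
    using assms(1) unfolding splits_def by (elim exE conjE)
  have "(\<Sum>i\<in>I. qform p m (\<lambda>a b. V a b - V' a b) (z i)) \<le> (\<Sum>i\<in>I. 2 * qform p m X (z i) + 2 * qform p m Y (z i))"
  proof (rule sum_mono)
    fix i
    have "qform p m (\<lambda>a b. V a b - V' a b) (z i) = qform p m (\<lambda>a b. X a b + Y a b) (z i)"
      using eq by (intro qform_cong) simp
    then show "qform p m (\<lambda>a b. V a b - V' a b) (z i) \<le> 2 * qform p m X (z i) + 2 * qform p m Y (z i)"
      by (simp add: qform_add_le)
  qed
  also have "\<dots> \<le> 2 * (d\<^sup>2 * M) + 2 * (d\<^sup>2 * M)"
    unfolding sum.distrib sum_distrib_left[symmetric] using X Y assms(2) M
    by (intro add_mono mult_left_mono sum_qform_rescale) simp_all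
  finally show ?thesis by (simp add: mult_ac)
qed

lemma fro2_split: "splits A p m k d V V' \<Longrightarrow> fro2 p m (\<lambda>i j. V i j - V' i j) \<le> 4 * d\<^sup>2"
proof -
  assume "splits A p m k d V V'"
  then obtain X Y where X: "fro2 p m X \<le> d\<^sup>2" and Y: "fro2 p m Y \<le> d\<^sup>2"
    and eq: "\<forall>i<p. \<forall>j<m. V i j - V' i j = X i j + Y i j"
    unfolding splits_def by (elim exE conjE)
  have "fro2 p m (\<lambda>i j. V i j - V' i j) = fro2 p m (\<lambda>i j. X i j + Y i j)" using eq by (intro fro2_cong) simp
  then show ?thesis using fro2_add_le[of p m X Y] X Y by simp
qed

text \<open>A bound on a net extends to the whole ball: the difference to a net point contributes
  \<open>2 * (1/8)\<close> of the supremum, within the half that \<open>bootstrap_bound\<close>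
  absorbs.\<close>

lemma uniform_gform:
  assumes I: "finite I"
    and near: "\<And>V. V \<in> lowball A p m k \<Longrightarrow> \<exists>V'\<in>lowball A p m k. splits A p m k (1/8) V V' \<and>
      (\<Sum>i\<in>I. \<bar>gform p m V' (z i) (w i)\<bar>) \<le> B"
    and V: "V \<in> lowball A p m k"
  shows "(\<Sum>i\<in>I. \<bar>gform p m V (z i) (w i)\<bar>) \<le> 2 * B"
proof (rule bootstrap_bound[where N = "\<lambda>V. \<Sum>i\<in>I. \<bar>gform p m V (z i) (w i)\<bar>" and T = "lowball A p m k", OF _ _ V])
  show "(\<Sum>i\<in>I. \<bar>gform p m V (z i) (w i)\<bar>) \<le> (\<Sum>i\<in>I. \<Sum>j<m. (\<Sum>h<p. \<bar>z i h\<bar>) * \<bar>w i j\<bar>)" if "V \<in> lowball A p m k" for V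
    using that by (intro sum_mono abs_gform_le) (simp add: lowball_def)
next
  fix V M assume V: "V \<in> lowball A p m k" and M: "\<And>W. W \<in> lowball A p m k \<Longrightarrow> (\<Sum>i\<in>I. \<bar>gform p m W (z i) (w i)\<bar>) \<le> M"
  obtain V' where V': "splits A p m k (1/8) V V'" "(\<Sum>i\<in>I. \<bar>gform p m V' (z i) (w i)\<bar>) \<le> B"
    using near[OF V] by (elim bexE conjE)
  have M0: "0 \<le> M" by (rule order_trans[OF _ M[OF V]]) (simp add: sum_nonneg)
  have "(\<Sum>i\<in>I. \<bar>gform p m V (z i) (w i)\<bar>) \<le> (\<Sum>i\<in>I. \<bar>gform p m V' (z i) (w i)\<bar> + \<bar>gform p m (\<lambda>a b. V a b - V' a b) (z i) (w i)\<bar>)"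
    unfolding gform_diff by (rule sum_mono) linarith
  also have "\<dots> \<le> B + 2 * (1/8) * M"
    unfolding sum.distrib by (intro add_mono V'(2) sum_gform_split[OF V'(1)] M) simp_all
  finally show "(\<Sum>i\<in>I. \<bar>gform p m V (z i) (w i)\<bar>) \<le> B + M / 2" using M0 by linarith
qed

text \<open>As for the bilinear form, but separating the square costs a factor 2: the net value is
  doubled and \<open>2 * 4 / 64\<close> of the supremum remains.\<close>

lemma uniform_qform:
  assumes I: "finite I"
    and near: "\<And>V. V \<in> lowball A p m k \<Longrightarrow> \<exists>V'\<in>lowball A p m k. splits A p m k (1/8) V V' \<and>
      (\<Sum>i\<in>I. qform p m V' (z i)) \<le> B"
    and V: "V \<in> lowball A p m k"
  shows "(\<Sum>i\<in>I. qform p m V (z i)) \<le> 2 * (2 * B)"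
proof (rule bootstrap_bound[where N = "\<lambda>V. \<Sum>i\<in>I. qform p m V (z i)" and T = "lowball A p m k", OF _ _ V])
  show "(\<Sum>i\<in>I. qform p m V (z i)) \<le> (\<Sum>i\<in>I. \<Sum>j<m. (\<Sum>h<p. \<bar>z i h\<bar>)\<^sup>2)" if "V \<in> lowball A p m k" for V
    using that by (intro sum_mono qform_le) (simp add: lowball_def)
next
  fix V M assume V: "V \<in> lowball A p m k" and M: "\<And>W. W \<in> lowball A p m k \<Longrightarrow> (\<Sum>i\<in>I. qform p m W (z i)) \<le> M"
  obtain V' where V': "splits A p m k (1/8) V V'" "(\<Sum>i\<in>I. qform p m V' (z i)) \<le> B"
    using near[OF V] by (elim bexE conjE)
  have M0: "0 \<le> M" by (rule order_trans[OF _ M[OF V]]) (simp add: sum_nonneg qform_nonneg)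
  have "(\<Sum>i\<in>I. qform p m V (z i)) \<le> (\<Sum>i\<in>I. 2 * qform p m V' (z i) + 2 * qform p m (\<lambda>a b. V a b - V' a b) (z i))"
  proof (rule sum_mono)
    fix i
    have "qform p m V (z i) = qform p m (\<lambda>a b. V' a b + (V a b - V' a b)) (z i)" by simp
    then show "qform p m V (z i) \<le> 2 * qform p m V' (z i) + 2 * qform p m (\<lambda>a b. V a b - V' a b) (z i)"
      by (simp only: qform_add_le)
  qed
  also have "\<dots> \<le> 2 * B + 2 * (4 * (1/8)\<^sup>2 * M)"
    unfolding sum.distrib sum_distrib_left[symmetric]
    by (intro add_mono mult_left_mono V'(2) sum_qform_split[OF V'(1)] M) simp_all
  finally show "(\<Sum>i\<in>I. qform p m V (z i)) \<le> 2 * B + M / 2" using M0 by (simp add: power2_eq_square)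
qed

text \<open>The model enters only through \<open>G V\<close> and \<open>H V\<close>, the observable versions of the bilinear and quadratic
  forms; the predicate \<open>R\<close> says that an observation lies in the range of the model.\<close>

context
  fixes A :: "nat \<Rightarrow> nat \<Rightarrow> real" and p m k n :: nat and D \<eta> s :: real
    and P :: "'a measure" and \<rho> :: "(nat \<Rightarrow> real) \<times> (nat \<Rightarrow> real) \<Rightarrow> 'a"
    and G H :: "(nat \<Rightarrow> nat \<Rightarrow> real) \<Rightarrow> 'a \<Rightarrow> real" and R :: "'a \<Rightarrow> bool"
  assumes p: "1 \<le> p" and m: "1 \<le> m" and k: "1 \<le> k" and n: "1 \<le> n"
    and D: "1 \<le> D" and kD: "real (k * (p + m)) \<le> 2 * D" and \<eta>_def: "\<eta> = sqrt (D / n)" and \<eta>: "\<eta> \<le> 1 / 2"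
    and s: "0 \<le> s" "s \<le> 1"
    and rho: "\<rho> \<in> gauss2 p m \<rightarrow>\<^sub>M P" and P: "P = distr (gauss2 p m) P \<rho>"
    and GH: "\<And>V u. lowclass A p m k V \<Longrightarrow> u \<in> space (gauss2 p m) \<Longrightarrow>
      G V (\<rho> u) = gform p m V (fst u) (snd u) \<and> H V (\<rho> u) = qform p m V (fst u)"
    and mG: "\<And>V. lowclass A p m k V \<Longrightarrow> G V \<in> borel_measurable P"
    and mH: "\<And>V. lowclass A p m k V \<Longrightarrow> H V \<in> borel_measurable P"
    and R: "Measurable.pred P R" "\<And>u. u \<in> space (gauss2 p m) \<Longrightarrow> R (\<rho> u)"
      "\<And>\<omega>. R \<omega> \<Longrightarrow> \<exists>z w. \<forall>V. lowclass A p m k V \<longrightarrow> G V \<omega> = gform p m V z w \<and> H V \<omega> = qform p m V z"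
begin

lemma prob_space_model: "prob_space P"
  by (subst P) (rule prob_space.prob_space_distr[OF prob_space_gauss2 rho])

lemma nn_integral_model:
  "f \<in> borel_measurable P \<Longrightarrow> (\<integral>\<^sup>+x. f x \<partial>P) = (\<integral>\<^sup>+u. f (\<rho> u) \<partial>gauss2 p m)"
  by (rule trans[OF arg_cong[OF P, of "\<lambda>M. integral\<^sup>N M f"] nn_integral_distr[OF rho]]) (simp only: measurable_distr_eq1)

lemma measure_model:
  assumes [measurable]: "Measurable.pred P Z"
  shows "measure P {x\<in>space P. Z x} = measure (gauss2 p m) {u\<in>space (gauss2 p m). Z (\<rho> u)}"
proof -
  have "measure P {x\<in>space P. Z x} = measure (distr (gauss2 p m) P \<rho>) {x\<in>space P. Z x}"
    by (rule arg_cong[OF P])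
  also have "\<dots> = measure (gauss2 p m) (\<rho> -` {x\<in>space P. Z x} \<inter> space (gauss2 p m))"
    by (rule measure_distr[OF rho]) measurable
  also have "\<rho> -` {x\<in>space P. Z x} \<inter> space (gauss2 p m) = {u\<in>space (gauss2 p m). Z (\<rho> u)}"
    using measurable_space[OF rho] by auto
  finally show ?thesis .
qed

definition cover_label :: "nat \<Rightarrow> (nat \<Rightarrow> nat \<Rightarrow> real) \<Rightarrow> (nat \<times> nat \<Rightarrow> int) \<times> (nat \<times> nat \<Rightarrow> int)" where
  "cover_label j = (SOME lab. finite (lab ` lowball A p m k) \<and>
    real (card (lab ` lowball A p m k)) \<le> (24 / (1 / 8 ^ j)) ^ (k * (p + m)) \<and>
    (\<forall>V\<in>lowball A p m k. \<forall>V'\<in>lowball A p m k. lab V = lab V' \<longrightarrow> splits A p m k (1 / 8 ^ j) V V'))"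

text \<open>Since 24 * 8^j \<le> 2^(5 + 3j) \<le> exp (5 (j + 1)) and
  \<open>k * (p + m) \<le> 2 * D\<close>, the cover has the linear entropy that
  \<open>chaining\<close> asks for, with \<open>c1 = 10\<close>.\<close>

lemma cover_label:
  "finite (cover_label j ` lowball A p m k)"
  "real (card (cover_label j ` lowball A p m k)) \<le> exp (10 * D * (real j + 1))"
  "V \<in> lowball A p m k \<Longrightarrow> V' \<in> lowball A p m k \<Longrightarrow> cover_label j V = cover_label j V' \<Longrightarrow> splits A p m k (1 / 8 ^ j) V V'"
proof -
  have "\<exists>lab :: (nat \<Rightarrow> nat \<Rightarrow> real) \<Rightarrow> (nat \<times> nat \<Rightarrow> int) \<times> (nat \<times> nat \<Rightarrow> int).
    finite (lab ` lowball A p m k) \<and> real (card (lab ` lowball A p m k)) \<le> (24 / (1 / 8 ^ j)) ^ (k * (p + m)) \<and>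
    (\<forall>V\<in>lowball A p m k. \<forall>V'\<in>lowball A p m k. lab V = lab V' \<longrightarrow> splits A p m k (1 / 8 ^ j) V V')"
    unfolding splits_def lowball_def by (rule lowclass_cover[OF p m k]) simp_all
  then have *: "finite (cover_label j ` lowball A p m k) \<and>
    real (card (cover_label j ` lowball A p m k)) \<le> (24 / (1 / 8 ^ j)) ^ (k * (p + m)) \<and>
    (\<forall>V\<in>lowball A p m k. \<forall>V'\<in>lowball A p m k. cover_label j V = cover_label j V' \<longrightarrow> splits A p m k (1 / 8 ^ j) V V')"
    unfolding cover_label_def by (rule someI_ex)
  show "finite (cover_label j ` lowball A p m k)" using * by (rule conjunct1)
  show "V \<in> lowball A p m k \<Longrightarrow> V' \<in> lowball A p m k \<Longrightarrow> cover_label j V = cover_label j V' \<Longrightarrow> splits A p m k (1 / 8 ^ j) V V'"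
    using *[THEN conjunct2, THEN conjunct2] by simp
  have e: "2 ^ j \<le> exp (real j)" for j
  proof -
    have "2 \<le> exp (1::real)" using exp_ge_add_one_self[of 1] by simp
    then have "2 ^ j \<le> exp (1::real) ^ j" by (intro power_mono) auto
    then show ?thesis by (simp add: exp_of_nat_mult[symmetric])
  qed
  have "24 / (1 / 8 ^ j) \<le> (2::real) ^ (5 + 3 * j)" by (simp add: power_add power_mult)
  also have "\<dots> \<le> exp (real (5 + 3 * j))" by (rule e)
  also have "\<dots> \<le> exp (5 * (real j + 1))" by simp
  finally have "(24 / (1 / 8 ^ j)) ^ (k * (p + m)) \<le> exp (5 * (real j + 1)) ^ (k * (p + m))" by (intro power_mono) simp_all
  also have "\<dots> = exp (real (k * (p + m)) * (5 * (real j + 1)))" by (rule exp_of_nat_mult[symmetric])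
  also have "\<dots> \<le> exp (10 * D * (real j + 1))"
  proof -
    have "real (k * (p + m)) * (5 * (real j + 1)) \<le> 2 * D * (5 * (real j + 1))" using kD by (rule mult_right_mono) simp
    also have "\<dots> = 10 * D * (real j + 1)" by simp
    finally show ?thesis by (simp only: exp_le_cancel_iff)
  qed
  finally show "real (card (cover_label j ` lowball A p m k)) \<le> exp (10 * D * (real j + 1))"
    using *[THEN conjunct2, THEN conjunct1] by linarith
qed

lemma D_le_n: "D \<le> real n / 4"
proof -
  have "sqrt (D / n) \<le> sqrt ((1 / 2)\<^sup>2)" using \<eta> by (simp add: \<eta>_def)
  then have "D / n \<le> (1 / 2)\<^sup>2" by (simp only: real_sqrt_le_iff)
  then show ?thesis using n by (simp add: field_simps power2_eq_square)
qed

text \<open>The net of scale 1/8 (level 1) has entropy 20 D. The threshold 40 n is chosen for it: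
  the exponent 4n - 40n/4 = -6n beats -22 D because D \<le> n/4.\<close>

lemma moment_ensured:
  assumes f: "\<And>V. V \<in> lowball A p m k \<Longrightarrow> f V \<in> borel_measurable P"
    and mgf: "\<And>V. V \<in> lowball A p m k \<Longrightarrow> (\<integral>\<^sup>+x. ennreal (exp (1 / 4 * f V x)) \<partial>P) \<le> ennreal (exp 4)"
  shows "ensured P n (exp (- 2 * D)) (\<lambda>S \<omega>. \<forall>V\<in>rep (lowball A p m k) (cover_label 1) ` lowball A p m k.
    (\<Sum>i\<in>{..<n} - S. f V (\<omega> i)) \<le> 40 * real n)"
proof -
  let ?T = "lowball A p m k" and ?I = "rep (lowball A p m k) (cover_label 1) ` lowball A p m k"
  have fin: "finite ?I" by (rule rep_image(1)[OF cover_label(1)])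
  have "real (card ?I) \<le> real (card (cover_label 1 ` ?T))" using rep_image(2)[OF cover_label(1)] by simp
  also have "\<dots> \<le> exp (20 * D)" using cover_label(2)[of 1] by simp
  finally have c: "real (card ?I) \<le> exp (20 * D)" .
  have "ensured P n (exp (- (20 * D) - 2 * D)) (\<lambda>S \<omega>. (\<Sum>i\<in>{..<n} - S. f V (\<omega> i)) \<le> 40 * real n)" if "V \<in> ?I" for V
  proof (rule chernoff_testD)
    have V: "V \<in> ?T" using that rep by auto
    have "real n * 4 - 1 / 4 * (40 * real n) \<le> - (20 * D) - 2 * D" using D_le_n by simp
    then show "chernoff_test P n (f V) (40 * real n) (exp (- (20 * D) - 2 * D))"
      unfolding chernoff_test_def using f[OF V] mgf[OF V] by (intro conjI exI[of _ "1 / 4"] exI[of _ 4]) simp_all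
  qed
  from ensured_ball_exp[OF fin c this] show ?thesis by simp
qed

definition Fobs :: "(nat \<Rightarrow> nat \<Rightarrow> real) \<Rightarrow> 'a \<Rightarrow> real" where
  "Fobs V x = G V x - s * H V x"

lemma measurable_Fobs: "lowclass A p m k V \<Longrightarrow> Fobs V \<in> borel_measurable P"
  unfolding Fobs_def[abs_def] by (intro borel_measurable_diff borel_measurable_times mG mH) simp_all

lemma Fobs_rho: "lowclass A p m k V \<Longrightarrow> u \<in> space (gauss2 p m) \<Longrightarrow> Fobs V (\<rho> u) = fform p m s V u"
  by (simp add: Fobs_def GH fform_def)

text \<open>Chaining with \<open>c1 = 10\<close> and \<open>c2 = 11\<close> leaves the observations
  where the form jumps by more than 4^-K within a cell. Their number is at most 4^K times the total
  jump, which the uniform first moments bound by 800 n 8^-K; the product 800 n 2^-K is at most 3200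
  n \<eta>. The sum 2788 + 3200 is rounded up to 10000.\<close>

lemma uniform_halfspace:
  "ensured P n (5 * exp (- 2 * D)) (\<lambda>S \<omega>. \<forall>V. lowclass A p m k V \<longrightarrow> fro2 p m V = 1 \<longrightarrow>
    (\<Sum>i\<in>{..<n} - S. of_bool (0 \<le> G V (\<omega> i) - s * H V (\<omega> i))) \<le> real (card ({..<n} - S)) * (1 / 2 - s / 24) + 10000 * (real n * \<eta>))"
proof -
  let ?T = "lowball A p m k"
  \<comment> \<open>Small ball and halfspace bounds require unit norm, whereas the first-moment
    bounds need the full ball, because rescaled differences have norm at most 1.\<close>
  define T1 where "T1 = {V. lowclass A p m k V \<and> fro2 p m V = 1}"
  have T1: "V \<in> ?T" "lowclass A p m k V" "fro2 p m V = 1" if "V \<in> T1" for V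
    using that by (simp_all add: T1_def lowball_def)
  have sub: "T1 \<subseteq> ?T" using T1 by auto
  have T: "lowclass A p m k V" "fro2 p m V \<le> 1" if "V \<in> ?T" for V using that by (simp_all add: lowball_def)
  have eta0: "0 < \<eta>" using D n by (simp add: \<eta>_def)
  have "\<exists>K. 2 ^ K * \<eta> \<le> 1 / 2 \<and> 1 / 2 ^ K < 4 * \<eta> \<and> ensured P n (2 * exp (- 2 * D)) (\<lambda>S \<omega>. \<forall>V\<in>T1. \<exists>V'\<in>T1. cover_label K V' = cover_label K V \<and>
    (\<Sum>i\<in>{..<n} - S. of_bool (0 \<le> Fobs V (\<omega> i))) \<le> real (card ({..<n} - S)) * (1 / 2 - s / 24) + (152 * 11 + 97 * 10 + 146) * (real n * \<eta>) +
      (\<Sum>i\<in>{..<n} - S. of_bool (1 / 4 ^ K < Fobs V (\<omega> i) - Fobs V' (\<omega> i))))"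
  proof (rule chaining[OF prob_space_model])
    fix V assume V: "V \<in> T1"
    have [measurable]: "Fobs V \<in> borel_measurable P" by (rule measurable_Fobs[OF T1(2)[OF V]])
    show "Fobs V \<in> borel_measurable P" by measurable
    show "measure P {x \<in> space P. 0 \<le> Fobs V x} \<le> 1 / 2 - s / 24"
    proof -
      have "measure P {x \<in> space P. 0 \<le> Fobs V x} = measure (gauss2 p m) {u \<in> space (gauss2 p m). 0 \<le> Fobs V (\<rho> u)}"
        by (rule measure_model) measurable
      also have "{u \<in> space (gauss2 p m). 0 \<le> Fobs V (\<rho> u)} = {u \<in> space (gauss2 p m). 0 \<le> fform p m s V u}"
        using Fobs_rho[OF T1(2)[OF V]] by auto
      finally show ?thesis using half_space_prob[OF T1(3)[OF V] s] by (simp add: fform_def)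
    qed
    fix j :: nat
    show "measure P {x \<in> space P. \<bar>Fobs V x\<bar> \<le> 1 / 4 ^ j} \<le> 11 / 2 ^ j"
    proof -
      interpret G2: prob_space "gauss2 p m" by (rule prob_space_gauss2)
      have "measure P {x \<in> space P. \<bar>Fobs V x\<bar> \<le> 1 / 4 ^ j} = measure (gauss2 p m) {u \<in> space (gauss2 p m). \<bar>Fobs V (\<rho> u)\<bar> \<le> 1 / 4 ^ j}"
        by (rule measure_model) measurable
      also have "{u \<in> space (gauss2 p m). \<bar>Fobs V (\<rho> u)\<bar> \<le> 1 / 4 ^ j} = {u \<in> space (gauss2 p m). \<bar>fform p m s V u\<bar> \<le> 1 / 4 ^ j}"
        using Fobs_rho[OF T1(2)[OF V]] by auto
      also have "measure (gauss2 p m) \<dots> \<le> 4 * sqrt (1 / 4 ^ j)"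
        using small_ball[OF T1(3)[OF V], of "1 / 4 ^ j" s] by (simp add: fform_def G2.emeasure_eq_measure)
      also have "sqrt (1 / 4 ^ j) = 1 / 2 ^ j"
      proof -
        have "(4::real) ^ j = (2 ^ j)\<^sup>2" by (simp add: power2_eq_square power_mult_distrib[symmetric])
        then show ?thesis by (simp add: real_sqrt_divide)
      qed
      also have "4 * (1 / 2 ^ j) \<le> 11 / (2::real) ^ j" by (simp add: field_simps)
      finally show ?thesis .
    qed
    fix V' assume V': "V' \<in> T1" and eq: "cover_label j V = cover_label j V'"
    have [measurable]: "Fobs V' \<in> borel_measurable P" by (rule measurable_Fobs[OF T1(2)[OF V']])
    show "measure P {x \<in> space P. (0 \<le> Fobs V x) \<noteq> (0 \<le> Fobs V' x)} \<le> 11 / 2 ^ j"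
    proof -
      have "measure P {x \<in> space P. (0 \<le> Fobs V x) \<noteq> (0 \<le> Fobs V' x)} =
          measure (gauss2 p m) {u \<in> space (gauss2 p m). (0 \<le> Fobs V (\<rho> u)) \<noteq> (0 \<le> Fobs V' (\<rho> u))}"
        by (rule measure_model) measurable
      also have "{u \<in> space (gauss2 p m). (0 \<le> Fobs V (\<rho> u)) \<noteq> (0 \<le> Fobs V' (\<rho> u))} =
          {u \<in> space (gauss2 p m). (0 \<le> fform p m s V u) \<noteq> (0 \<le> fform p m s V' u)}"
        using Fobs_rho[OF T1(2)[OF V]] Fobs_rho[OF T1(2)[OF V']] by auto
      also have "measure (gauss2 p m) \<dots> \<le> 11 / 2 ^ j"
        by (rule prob_sign_change[OF T1(3)[OF V] T1(3)[OF V'] fro2_split[OF cover_label(3)[OF T1(1)[OF V] T1(1)[OF V'] eq]] s])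
      finally show ?thesis .
    qed
  next
    fix j
    show "finite (cover_label j ` T1)" by (rule finite_subset[OF image_mono[OF sub] cover_label(1)])
    have "card (cover_label j ` T1) \<le> card (cover_label j ` ?T)" by (rule card_mono[OF cover_label(1) image_mono[OF sub]])
    then show "real (card (cover_label j ` T1)) \<le> exp (10 * D * (real j + 1))" using cover_label(2)[of j] by linarith
  qed (use D n \<eta> \<eta>_def in simp_all)
  then obtain K where K: "2 ^ K * \<eta> \<le> 1 / 2" "1 / 2 ^ K < 4 * \<eta>"
    and E1: "ensured P n (2 * exp (- 2 * D)) (\<lambda>S \<omega>. \<forall>V\<in>T1. \<exists>V'\<in>T1. cover_label K V' = cover_label K V \<and>
    (\<Sum>i\<in>{..<n} - S. of_bool (0 \<le> Fobs V (\<omega> i))) \<le> real (card ({..<n} - S)) * (1 / 2 - s / 24) + (152 * 11 + 97 * 10 + 146) * (real n * \<eta>) +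
      (\<Sum>i\<in>{..<n} - S. of_bool (1 / 4 ^ K < Fobs V (\<omega> i) - Fobs V' (\<omega> i))))"
    by (elim exE conjE)
  have E2: "ensured P n (exp (- 2 * D)) (\<lambda>S \<omega>. \<forall>V\<in>rep ?T (cover_label 1) ` ?T. (\<Sum>i\<in>{..<n} - S. \<bar>G V (\<omega> i)\<bar>) \<le> 40 * real n)"
  proof (rule moment_ensured)
    fix V assume V: "V \<in> ?T"
    have [measurable]: "G V \<in> borel_measurable P" by (rule mG[OF T(1)[OF V]])
    show "(\<lambda>x. \<bar>G V x\<bar>) \<in> borel_measurable P" by measurable
    have "(\<integral>\<^sup>+x. ennreal (exp (1 / 4 * \<bar>G V x\<bar>)) \<partial>P) = (\<integral>\<^sup>+u. ennreal (exp (1 / 4 * \<bar>G V (\<rho> u)\<bar>)) \<partial>gauss2 p m)"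
      by (rule nn_integral_model) measurable
    also have "\<dots> = (\<integral>\<^sup>+u. ennreal (exp (1 / 4 * \<bar>gform p m V (fst u) (snd u)\<bar>)) \<partial>gauss2 p m)"
      by (rule nn_integral_cong) (simp add: GH T(1)[OF V])
    also have "\<dots> \<le> ennreal (exp 4)" by (rule nn_integral_exp_abs_gform[OF T(2)[OF V]])
    finally show "(\<integral>\<^sup>+x. ennreal (exp (1 / 4 * \<bar>G V x\<bar>)) \<partial>P) \<le> ennreal (exp 4)" .
  qed
  have E3: "ensured P n (exp (- 2 * D)) (\<lambda>S \<omega>. \<forall>V\<in>rep ?T (cover_label 1) ` ?T. (\<Sum>i\<in>{..<n} - S. H V (\<omega> i)) \<le> 40 * real n)"
  proof (rule moment_ensured)
    fix V assume V: "V \<in> ?T"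
    show [measurable]: "H V \<in> borel_measurable P" by (rule mH[OF T(1)[OF V]])
    have "(\<integral>\<^sup>+x. ennreal (exp (1 / 4 * H V x)) \<partial>P) = (\<integral>\<^sup>+u. ennreal (exp (1 / 4 * H V (\<rho> u))) \<partial>gauss2 p m)"
      by (rule nn_integral_model) measurable
    also have "\<dots> = (\<integral>\<^sup>+u. ennreal (exp (1 / 4 * qform p m V (fst u))) \<partial>gauss2 p m)"
      by (rule nn_integral_cong) (simp add: GH T(1)[OF V])
    also have "\<dots> \<le> ennreal (exp 2)" by (rule nn_integral_exp_qform_gauss2[OF T(2)[OF V]])
    also have "\<dots> \<le> ennreal (exp 4)" by (rule ennreal_leI) simp
    finally show "(\<integral>\<^sup>+x. ennreal (exp (1 / 4 * H V x)) \<partial>P) \<le> ennreal (exp 4)" .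
  qed
  have "AE x in P. R x"
  proof -
    have [measurable]: "Measurable.pred P R" by (rule R(1))
    have "AE x in distr (gauss2 p m) P \<rho>. R x"
      by (subst AE_distr_iff[OF rho]) (use R(2) in \<open>auto intro!: AE_I2\<close>)
    then show ?thesis by (subst P)
  qed
  from ensured_AE[OF prob_space_model R(1) this exp_gt_zero]
  have E4: "ensured P n (exp (- 2 * D)) (\<lambda>S \<omega>. \<forall>i\<in>{..<n} - S. R (\<omega> i))" .
  from ensured_conj[OF E1 ensured_conj[OF E2 ensured_conj[OF E3 E4]]]
  show ?thesis
  proof (rule ensured_mono)
    show "2 * exp (- 2 * D) + (exp (- 2 * D) + (exp (- 2 * D) + exp (- 2 * D))) \<le> 5 * exp (- 2 * D)" by simp
  next
    fix S :: "nat set" and \<omega> :: "nat \<Rightarrow> 'a"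
    let ?I = "{..<n} - S"
    assume *: "(\<forall>V\<in>T1. \<exists>V'\<in>T1. cover_label K V' = cover_label K V \<and>
      (\<Sum>i\<in>?I. of_bool (0 \<le> Fobs V (\<omega> i))) \<le> real (card ?I) * (1 / 2 - s / 24) + (152 * 11 + 97 * 10 + 146) * (real n * \<eta>) +
        (\<Sum>i\<in>?I. of_bool (1 / 4 ^ K < Fobs V (\<omega> i) - Fobs V' (\<omega> i)))) \<and>
      (\<forall>V\<in>rep ?T (cover_label 1) ` ?T. (\<Sum>i\<in>?I. \<bar>G V (\<omega> i)\<bar>) \<le> 40 * real n) \<and>
      (\<forall>V\<in>rep ?T (cover_label 1) ` ?T. (\<Sum>i\<in>?I. H V (\<omega> i)) \<le> 40 * real n) \<and> (\<forall>i\<in>?I. R (\<omega> i))"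
    note h1 = *[THEN conjunct1] and h2 = *[THEN conjunct2, THEN conjunct1]
      and h3 = *[THEN conjunct2, THEN conjunct2, THEN conjunct1] and h4 = *[THEN conjunct2, THEN conjunct2, THEN conjunct2]
    have "\<forall>i\<in>?I. \<exists>u. \<forall>V. lowclass A p m k V \<longrightarrow> G V (\<omega> i) = gform p m V (fst u) (snd u) \<and> H V (\<omega> i) = qform p m V (fst u)"
    proof
      fix i assume "i \<in> ?I"
      then have "R (\<omega> i)" using h4 by simp
      from R(3)[OF this] obtain z w where "\<forall>V. lowclass A p m k V \<longrightarrow> G V (\<omega> i) = gform p m V z w \<and> H V (\<omega> i) = qform p m V z"
        by (elim exE)
      then show "\<exists>u. \<forall>V. lowclass A p m k V \<longrightarrow> G V (\<omega> i) = gform p m V (fst u) (snd u) \<and> H V (\<omega> i) = qform p m V (fst u)"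
        by (intro exI[of _ "(z, w)"]) simp
    qed
    \<comment> \<open>Latent pairs of the retained observations are picked sample by sample; the
      argument from here on is deterministic.\<close>
    from bchoice[OF this] obtain u where u: "\<forall>i\<in>?I. \<forall>V. lowclass A p m k V \<longrightarrow> G V (\<omega> i) = gform p m V (fst (u i)) (snd (u i)) \<and> H V (\<omega> i) = qform p m V (fst (u i))"
      by (elim exE)
    have Gu: "G V (\<omega> i) = gform p m V (fst (u i)) (snd (u i))" and Hu: "H V (\<omega> i) = qform p m V (fst (u i))"
      if "lowclass A p m k V" "i \<in> ?I" for V i using u that by simp_all
    have Fu: "Fobs V (\<omega> i) = fform p m s V (u i)" if "lowclass A p m k V" "i \<in> ?I" for V i
      using Gu[OF that] Hu[OF that] by (simp add: Fobs_def fform_def)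
    have near: "rep ?T (cover_label 1) V \<in> ?T \<and> splits A p m k (1/8) V (rep ?T (cover_label 1) V)" if V: "V \<in> ?T" for V
      using rep[OF V, of "cover_label 1"] cover_label(3)[OF V rep(1)[OF V, of "cover_label 1"], of 1] by simp
    have Ng: "(\<Sum>i\<in>?I. \<bar>gform p m V (fst (u i)) (snd (u i))\<bar>) \<le> 80 * real n" if V: "V \<in> ?T" for V
    proof -
      have "(\<Sum>i\<in>?I. \<bar>gform p m V (fst (u i)) (snd (u i))\<bar>) \<le> 2 * (40 * real n)"
      proof (rule uniform_gform[OF _ _ V])
        fix W assume W: "W \<in> ?T"
        let ?W = "rep ?T (cover_label 1) W"
        have "(\<Sum>i\<in>?I. \<bar>G ?W (\<omega> i)\<bar>) \<le> 40 * real n" using h2 W by simp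
        then have "(\<Sum>i\<in>?I. \<bar>gform p m ?W (fst (u i)) (snd (u i))\<bar>) \<le> 40 * real n"
          using Gu[OF T(1)[OF near[OF W, THEN conjunct1]]] by simp
        then show "\<exists>V'\<in>?T. splits A p m k (1 / 8) W V' \<and> (\<Sum>i\<in>?I. \<bar>gform p m V' (fst (u i)) (snd (u i))\<bar>) \<le> 40 * real n"
          using near[OF W] by (intro bexI[of _ ?W]) simp_all
      qed simp
      then show ?thesis by simp
    qed
    have Nq: "(\<Sum>i\<in>?I. qform p m V (fst (u i))) \<le> 160 * real n" if V: "V \<in> ?T" for V
    proof -
      have "(\<Sum>i\<in>?I. qform p m V (fst (u i))) \<le> 2 * (2 * (40 * real n))"
      proof (rule uniform_qform[OF _ _ V])
        fix W assume W: "W \<in> ?T"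
        let ?W = "rep ?T (cover_label 1) W"
        have "(\<Sum>i\<in>?I. H ?W (\<omega> i)) \<le> 40 * real n" using h3 W by simp
        then have "(\<Sum>i\<in>?I. qform p m ?W (fst (u i))) \<le> 40 * real n"
          using Hu[OF T(1)[OF near[OF W, THEN conjunct1]]] by simp
        then show "\<exists>V'\<in>?T. splits A p m k (1 / 8) W V' \<and> (\<Sum>i\<in>?I. qform p m V' (fst (u i))) \<le> 40 * real n"
          using near[OF W] by (intro bexI[of _ ?W]) simp_all
      qed simp
      then show ?thesis by simp
    qed
    show "\<forall>V. lowclass A p m k V \<longrightarrow> fro2 p m V = 1 \<longrightarrow>
      (\<Sum>i\<in>?I. of_bool (0 \<le> G V (\<omega> i) - s * H V (\<omega> i))) \<le> real (card ?I) * (1 / 2 - s / 24) + 10000 * (real n * \<eta>)"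
    proof (intro allI impI)
      fix V assume "lowclass A p m k V" "fro2 p m V = 1"
      then have V: "V \<in> T1" by (simp add: T1_def)
      from bspec[OF h1 V] obtain V' where V': "V' \<in> T1" and eq: "cover_label K V' = cover_label K V"
        and le: "(\<Sum>i\<in>?I. of_bool (0 \<le> Fobs V (\<omega> i))) \<le> real (card ?I) * (1 / 2 - s / 24) + (152 * 11 + 97 * 10 + 146) * (real n * \<eta>) +
        (\<Sum>i\<in>?I. of_bool (1 / 4 ^ K < Fobs V (\<omega> i) - Fobs V' (\<omega> i)))"
        by (elim bexE conjE)
      let ?d = "1 / 8 ^ K :: real"
      have d: "0 < ?d" by simp
      have sp: "splits A p m k ?d V V'" by (rule cover_label(3)[OF T1(1)[OF V] T1(1)[OF V'] eq[symmetric]])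
      let ?\<Delta> = "\<lambda>a b. V a b - V' a b" and ?\<Sigma> = "\<lambda>a b. V a b + V' a b"
      have "(\<Sum>i\<in>?I. \<bar>fform p m s V (u i) - fform p m s V' (u i)\<bar>) \<le> (\<Sum>i\<in>?I. \<bar>gform p m ?\<Delta> (fst (u i)) (snd (u i))\<bar> +
          (qform p m ?\<Delta> (fst (u i)) / ?d + ?d * qform p m ?\<Sigma> (fst (u i))) / 2)"
        by (intro sum_mono fform_diff_le d s)
      also have "\<dots> = (\<Sum>i\<in>?I. \<bar>gform p m ?\<Delta> (fst (u i)) (snd (u i))\<bar>) +
          ((\<Sum>i\<in>?I. qform p m ?\<Delta> (fst (u i))) / ?d + ?d * (\<Sum>i\<in>?I. qform p m ?\<Sigma> (fst (u i)))) / 2"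
        by (simp only: sum.distrib sum_divide_distrib[symmetric] sum_distrib_left[symmetric])
      \<comment> \<open>The bilinear form contributes 160 n d, and the quadratic form half of 640 n
        d + 640 n d, for d = 8^-K.\<close>
      also have "\<dots> \<le> 2 * ?d * (80 * real n) + ((4 * ?d\<^sup>2 * (160 * real n)) / ?d + ?d * (640 * real n)) / 2"
      proof -
        have "(\<Sum>i\<in>?I. qform p m ?\<Sigma> (fst (u i))) \<le> (\<Sum>i\<in>?I. 2 * qform p m V (fst (u i)) + 2 * qform p m V' (fst (u i)))"
          by (intro sum_mono qform_add_le)
        also have "\<dots> = 2 * (\<Sum>i\<in>?I. qform p m V (fst (u i))) + 2 * (\<Sum>i\<in>?I. qform p m V' (fst (u i)))"
          by (simp only: sum.distrib sum_distrib_left)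
        also have "\<dots> \<le> 640 * real n" using Nq[OF T1(1)[OF V]] Nq[OF T1(1)[OF V']] by linarith
        finally have q: "(\<Sum>i\<in>?I. qform p m ?\<Sigma> (fst (u i))) \<le> 640 * real n" .
        show ?thesis
          by (intro add_mono divide_right_mono mult_left_mono q sum_gform_split[OF sp d Ng] sum_qform_split[OF sp d Nq]) simp_all
      qed
      also have "\<dots> = 800 * real n * ?d"
      proof -
        have "2 * d * (80 * real n) + ((4 * d\<^sup>2 * (160 * real n)) / d + d * (640 * real n)) / 2 = 800 * real n * d" if "0 < d" for d :: real
          using that by (simp add: power2_eq_square)
        from this[OF d] show ?thesis .
      qed
      finally have tot: "(\<Sum>i\<in>?I. \<bar>fform p m s V (u i) - fform p m s V' (u i)\<bar>) \<le> 800 * real n * ?d" .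
      have "(\<Sum>i\<in>?I. of_bool (1 / 4 ^ K < Fobs V (\<omega> i) - Fobs V' (\<omega> i))) \<le> (\<Sum>i\<in>?I. 4 ^ K * \<bar>fform p m s V (u i) - fform p m s V' (u i)\<bar>)"
      proof (rule sum_mono)
        fix i assume i: "i \<in> ?I"
        have "1 \<le> 4 ^ K * \<bar>x\<bar>" if "1 / 4 ^ K < x" for x :: real
        proof -
          have "1 < 4 ^ K * x" using that by (simp add: field_simps)
          also have "4 ^ K * x \<le> 4 ^ K * \<bar>x\<bar>" by (intro mult_left_mono) auto
          finally show ?thesis by simp
        qed
        then show "of_bool (1 / 4 ^ K < Fobs V (\<omega> i) - Fobs V' (\<omega> i)) \<le> 4 ^ K * \<bar>fform p m s V (u i) - fform p m s V' (u i)\<bar>"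
          unfolding Fu[OF T1(2)[OF V] i] Fu[OF T1(2)[OF V'] i] by (simp add: of_bool_def)
      qed
      also have "\<dots> \<le> 4 ^ K * (800 * real n * ?d)" unfolding sum_distrib_left[symmetric] using tot by (rule mult_left_mono) simp
      also have "\<dots> = 800 * real n * (1 / 2 ^ K)"
        by (simp add: field_simps power_mult_distrib[symmetric])
      also have "\<dots> \<le> 800 * real n * (4 * \<eta>)" using K(2) by (intro mult_left_mono) auto
      finally have last: "(\<Sum>i\<in>?I. of_bool (1 / 4 ^ K < Fobs V (\<omega> i) - Fobs V' (\<omega> i))) \<le> 3200 * (real n * \<eta>)" by simp
      have "0 \<le> real n * \<eta>" using eta0 by simp
      moreover have "c + (152 * 11 + 97 * 10 + 146) * x + 3200 * x \<le> c + 10000 * x" if "0 \<le> x" for c x :: real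
        using that by simp
      ultimately have "(\<Sum>i\<in>?I. of_bool (0 \<le> Fobs V (\<omega> i))) \<le> real (card ?I) * (1 / 2 - s / 24) + 10000 * (real n * \<eta>)"
        using order_trans[OF le add_left_mono[OF last]] order_trans by blast
      then show "(\<Sum>i\<in>?I. of_bool (0 \<le> G V (\<omega> i) - s * H V (\<omega> i))) \<le> real (card ?I) * (1 / 2 - s / 24) + 10000 * (real n * \<eta>)"
        unfolding Fobs_def .
    qed
  qed
qed

end

section \<open>Matrix square roots, rank and nuclear norm\<close>

definition symmetric_psd :: "nat \<Rightarrow> (nat \<Rightarrow> nat \<Rightarrow> real) \<Rightarrow> bool" where
  "symmetric_psd n a \<longleftrightarrow> (\<forall>i<n. \<forall>h<n. a i h = a h i) \<and> (\<forall>x. 0 \<le> ip n x (mv n a x))"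

section \<open>Translation between matrices and index functions\<close>

lemma scalar_prod_ip: "v \<in> carrier_vec n \<Longrightarrow> w \<in> carrier_vec n \<Longrightarrow> scalar_prod v w = ip n (vec_index v) (vec_index w)"
  by (auto simp: scalar_prod_def ip_def atLeast0LessThan)

lemma mult_mat_vec_mv: "A \<in> carrier_mat p n \<Longrightarrow> v \<in> carrier_vec n \<Longrightarrow> i < p \<Longrightarrow>
    vec_index (A *\<^sub>v v) i = mv n (\<lambda>i h. A $$ (i, h)) (vec_index v) i"
  by (auto simp: scalar_prod_def mv_def atLeast0LessThan)

lemma mat_mult_entry: "A \<in> carrier_mat p n \<Longrightarrow> B \<in> carrier_mat n m \<Longrightarrow> i < p \<Longrightarrow> j < m \<Longrightarrow>
    (A * B) $$ (i, j) = (\<Sum>h<n. A $$ (i, h) * B $$ (h, j))"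
  by (auto simp: scalar_prod_def atLeast0LessThan)

lemma quadratic_form_ip: "A \<in> carrier_mat n n \<Longrightarrow> v \<in> carrier_vec n \<Longrightarrow>
    scalar_prod v (A *\<^sub>v v) = ip n (vec_index v) (mv n (\<lambda>i h. A $$ (i, h)) (vec_index v))"
  by (subst scalar_prod_ip[of _ n], simp, simp, rule ip_cong[OF refl], rule mult_mat_vec_mv)

lemma psd_mat_iff: "psd_mat n A \<longleftrightarrow> A \<in> carrier_mat n n \<and> symmetric_psd n (\<lambda>i h. A $$ (i, h))"
proof (cases "A \<in> carrier_mat n n")
  case True
  have "transpose_mat A = A \<longleftrightarrow> (\<forall>i<n. \<forall>h<n. A $$ (i, h) = A $$ (h, i))"
  proof
    assume eq: "transpose_mat A = A"
    show "\<forall>i<n. \<forall>h<n. A $$ (i, h) = A $$ (h, i)"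
    proof (intro allI impI)
      fix i h assume "i < n" "h < n"
      then have "transpose_mat A $$ (i, h) = A $$ (h, i)" using True by simp
      then show "A $$ (i, h) = A $$ (h, i)" by (simp only: eq)
    qed
  next
    assume "\<forall>i<n. \<forall>h<n. A $$ (i, h) = A $$ (h, i)"
    then show "transpose_mat A = A" using True by (intro eq_matI) auto
  qed
  moreover have "(\<forall>v\<in>carrier_vec n. 0 \<le> scalar_prod v (A *\<^sub>v v)) \<longleftrightarrow> (\<forall>x. 0 \<le> ip n x (mv n (\<lambda>i h. A $$ (i, h)) x))"
  proof (intro iffI allI ballI)
    fix x assume *: "\<forall>v\<in>carrier_vec n. 0 \<le> scalar_prod v (A *\<^sub>v v)"
    have "0 \<le> scalar_prod (Matrix.vec n x) (A *\<^sub>v Matrix.vec n x)" using * by simp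
    also have "\<dots> = ip n (vec_index (Matrix.vec n x)) (mv n (\<lambda>i h. A $$ (i, h)) (vec_index (Matrix.vec n x)))"
      by (rule quadratic_form_ip[OF True]) simp
    also have "\<dots> = ip n x (mv n (\<lambda>i h. A $$ (i, h)) x)"
      by (rule ip_cong) (auto simp: mv_def intro!: sum.cong)
    finally show "0 \<le> ip n x (mv n (\<lambda>i h. A $$ (i, h)) x)" .
  next
    fix v :: "real Matrix.vec" assume "\<forall>x. 0 \<le> ip n x (mv n (\<lambda>i h. A $$ (i, h)) x)" "v \<in> carrier_vec n"
    then show "0 \<le> scalar_prod v (A *\<^sub>v v)" by (simp add: quadratic_form_ip[OF True])
  qed
  ultimately show ?thesis using True by (simp add: psd_mat_def symmetric_psd_def)
qed (simp add: psd_mat_def)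

definition spectral_sqrt :: "nat \<Rightarrow> (nat \<Rightarrow> nat \<Rightarrow> real) \<Rightarrow> (nat \<Rightarrow> real) \<Rightarrow> nat \<Rightarrow> nat \<Rightarrow> real" where
  "spectral_sqrt n e l i h = (\<Sum>j<n. sqrt (l j) * e j i * e j h)"

context
  fixes n :: nat and a e :: "nat \<Rightarrow> nat \<Rightarrow> real" and l :: "nat \<Rightarrow> real"
  assumes a: "symmetric_psd n a" and e: "orthonormal n n e"
    and eig: "\<And>j i. j < n \<Longrightarrow> i < n \<Longrightarrow> mv n a (e j) i = l j * e j i"
begin

lemma eigenvalue_nonneg: assumes "j < n" shows "0 \<le> l j"
proof -
  have "0 \<le> ip n (e j) (mv n a (e j))" using a by (simp add: symmetric_psd_def)
  also have "\<dots> = ip n (e j) (\<lambda>i. l j * e j i)" using eig[OF assms] by (intro ip_cong) auto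
  also have "\<dots> = l j" using e assms by (simp add: ip_scale_right orthonormal_def)
  finally show ?thesis .
qed

lemma spectral_sqrt_symmetric_psd: "symmetric_psd n (spectral_sqrt n e l)"
proof -
  have mvS: "mv n (spectral_sqrt n e l) x = (\<lambda>i. \<Sum>j<n. (sqrt (l j) * ip n x (e j)) * e j i)" for x
    unfolding mv_def spectral_sqrt_def ip_def sum_distrib_left sum_distrib_right
    by (rule ext, subst sum.swap) (simp add: mult_ac)
  have "ip n x (mv n (spectral_sqrt n e l) x) = (\<Sum>j<n. sqrt (l j) * (ip n x (e j))\<^sup>2)" for x
    unfolding mvS ip_sum_right ip_scale_right by (simp add: power2_eq_square mult_ac)
  then show ?thesis
    unfolding symmetric_psd_def using eigenvalue_nonneg
    by (auto simp: spectral_sqrt_def mult_ac intro!: sum_nonneg)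
qed

lemma spectral_sqrt_square:
  assumes "i < n" "h < n"
  shows "(\<Sum>q<n. spectral_sqrt n e l i q * spectral_sqrt n e l q h) = a i h"
proof -
  have "(\<Sum>q<n. spectral_sqrt n e l i q * spectral_sqrt n e l q h) =
      (\<Sum>q<n. \<Sum>j<n. \<Sum>j'<n. sqrt (l j) * sqrt (l j') * e j i * e j' h * (e j q * e j' q))"
    unfolding spectral_sqrt_def sum_product by (intro sum.cong refl) (simp add: mult_ac)
  also have "\<dots> = (\<Sum>j<n. \<Sum>q<n. \<Sum>j'<n. sqrt (l j) * sqrt (l j') * e j i * e j' h * (e j q * e j' q))"
    by (rule sum.swap)
  also have "\<dots> = (\<Sum>j<n. \<Sum>j'<n. \<Sum>q<n. sqrt (l j) * sqrt (l j') * e j i * e j' h * (e j q * e j' q))"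
    by (intro sum.cong refl sum.swap)
  also have "\<dots> = (\<Sum>j<n. \<Sum>j'<n. sqrt (l j) * sqrt (l j') * e j i * e j' h * ip n (e j) (e j'))"
    by (simp only: sum_distrib_left ip_def)
  also have "\<dots> = (\<Sum>j<n. \<Sum>j'<n. if j = j' then l j * e j i * e j h else 0)"
    using e eigenvalue_nonneg by (intro sum.cong refl) (auto simp: orthonormal_def)
  also have "\<dots> = (\<Sum>j<n. l j * e j i * e j h)" by simp
  also have "\<dots> = (\<Sum>j<n. ip n (a i) (e j) * e j h)"
    using eig assms(1) by (intro sum.cong refl) (simp add: mv_def ip_def)
  also have "\<dots> = a i h" by (rule orthonormal_expand[OF e assms(2), symmetric])
  finally show ?thesis .
qed

text \<open>For \<open>0 < l j\<close> the defect y = t e_j - sqrt (l j) e_j satisfies t y = - sqrt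
  (l j) y, because t^2 e_j = l j e_j; positivity of t forces y = 0. For \<open>l j = 0\<close> the
  squared norm of t e_j is \<langle>e_j, t^2 e_j\<rangle> = 0.\<close>

lemma spectral_sqrt_unique:
  assumes t: "symmetric_psd n t" and sq: "\<And>i h. i < n \<Longrightarrow> h < n \<Longrightarrow> (\<Sum>q<n. t i q * t q h) = a i h"
    and i: "i < n" and h: "h < n"
  shows "t i h = spectral_sqrt n e l i h"
proof -
  have tsym: "\<And>i h. i < n \<Longrightarrow> h < n \<Longrightarrow> t i h = t h i" using t by (simp add: symmetric_psd_def)
  have tt: "mv n t (mv n t x) i = mv n a x i" if "i < n" for x i
  proof -
    have "mv n t (mv n t x) i = (\<Sum>q<n. \<Sum>h<n. t i q * t q h * x h)" unfolding mv_def by (simp add: sum_distrib_left mult_ac)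
    also have "\<dots> = (\<Sum>h<n. (\<Sum>q<n. t i q * t q h) * x h)" by (subst sum.swap) (simp add: sum_distrib_right)
    also have "\<dots> = mv n a x i" unfolding mv_def using sq[OF that] by (intro sum.cong) auto
    finally show ?thesis .
  qed
  have te: "mv n t (e j) i = sqrt (l j) * e j i" if j: "j < n" and i: "i < n" for j i
  proof (cases "l j = 0")
    case True
    have "ip n (mv n t (e j)) (mv n t (e j)) = ip n (e j) (mv n t (mv n t (e j)))"
      by (rule ip_mv_symmetric[OF tsym, symmetric])
    also have "\<dots> = ip n (e j) (\<lambda>_. 0)" using tt eig[OF j] True by (intro ip_cong) auto
    also have "\<dots> = 0" by (simp add: ip_def)
    finally show ?thesis using ip_eq_0D[OF _ i] True by simp
  next
    case False
    then have lj: "0 < l j" using eigenvalue_nonneg[OF j] by linarith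
    define y where "y i = mv n t (e j) i - sqrt (l j) * e j i" for i
    have "mv n t y i = - sqrt (l j) * y i" if i: "i < n" for i
    proof -
      have "mv n t y i = mv n t (mv n t (e j)) i - sqrt (l j) * mv n t (e j) i"
        unfolding y_def by (simp add: mv_diff mv_scale)
      also have "mv n t (mv n t (e j)) i = sqrt (l j) * sqrt (l j) * e j i" using tt[OF i] eig[OF j i] lj by simp
      finally show ?thesis unfolding y_def by (simp add: algebra_simps)
    qed
    then have "ip n y (mv n t y) = ip n y (\<lambda>i. - sqrt (l j) * y i)" by (intro ip_cong) auto
    also have "\<dots> = - sqrt (l j) * ip n y y" by (rule ip_scale_right)
    finally have "ip n y (mv n t y) = - sqrt (l j) * ip n y y" .
    moreover have "0 \<le> ip n y (mv n t y)" using t by (simp add: symmetric_psd_def)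
    ultimately have "sqrt (l j) * ip n y y \<le> 0" by simp
    then have "ip n y y \<le> 0" using lj by (simp add: mult_le_0_iff)
    then have "ip n y y = 0" using ip_nonneg[of n y] by linarith
    from ip_eq_0D[OF this i] show ?thesis by (simp add: y_def)
  qed
  have "t i h = (\<Sum>j<n. ip n (t i) (e j) * e j h)" by (rule orthonormal_expand[OF e h])
  also have "\<dots> = (\<Sum>j<n. sqrt (l j) * e j i * e j h)"
    using te[OF _ i] by (intro sum.cong refl) (simp add: mv_def ip_def)
  finally show ?thesis by (simp add: spectral_sqrt_def)
qed

end

text \<open>Existence and uniqueness make the \<open>THE\<close> in \<open>psd_sqrt\<close>
  meaningful, and its value may be computed in any eigenbasis.\<close>

lemma psd_sqrt_eq_spectral:
  assumes A: "psd_mat n A" and e: "orthonormal n n e"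
    and eig: "\<And>j i. j < n \<Longrightarrow> i < n \<Longrightarrow> mv n (\<lambda>i h. A $$ (i, h)) (e j) i = l j * e j i"
  shows "psd_sqrt A = mat n n (\<lambda>(i, h). spectral_sqrt n e l i h)"
proof -
  let ?S = "mat n n (\<lambda>(i, h). spectral_sqrt n e l i h)"
  have cA: "A \<in> carrier_mat n n" and pA: "symmetric_psd n (\<lambda>i h. A $$ (i, h))" using A by (simp_all add: psd_mat_iff)
  note ctx = pA e eig
  have psdcong: "symmetric_psd n s \<Longrightarrow> symmetric_psd n s'" if "\<And>i h. i < n \<Longrightarrow> h < n \<Longrightarrow> s' i h = s i h" for s s'
  proof -
    assume s: "symmetric_psd n s"
    have "ip n x (mv n s' x) = ip n x (mv n s x)" for x
      using that by (intro ip_cong) (auto simp: mv_def intro!: sum.cong)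
    then show ?thesis using s that by (simp add: symmetric_psd_def)
  qed
  have "symmetric_psd n (\<lambda>i h. ?S $$ (i, h))"
    by (rule psdcong[OF _ spectral_sqrt_symmetric_psd[OF ctx]]) simp
  then have 1: "psd_mat n ?S" by (simp add: psd_mat_iff)
  have 2: "?S * ?S = A"
  proof (rule eq_matI)
    fix i h assume "i < dim_row A" "h < dim_col A"
    then have ih: "i < n" "h < n" using cA by auto
    have "(?S * ?S) $$ (i, h) = (\<Sum>q<n. ?S $$ (i, q) * ?S $$ (q, h))" by (rule mat_mult_entry[OF _ _ ih]) simp_all
    also have "\<dots> = (\<Sum>q<n. spectral_sqrt n e l i q * spectral_sqrt n e l q h)" using ih by (intro sum.cong) auto
    also have "\<dots> = A $$ (i, h)" by (rule spectral_sqrt_square[OF ctx ih])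
    finally show "(?S * ?S) $$ (i, h) = A $$ (i, h)" .
  qed (use cA in auto)
  have "(THE S. psd_mat n S \<and> S * S = A) = ?S"
  proof (rule the_equality)
    show "psd_mat n ?S \<and> ?S * ?S = A" using 1 2 by simp
  next
    fix T assume T: "psd_mat n T \<and> T * T = A"
    then have cT: "T \<in> carrier_mat n n" and pT: "symmetric_psd n (\<lambda>i h. T $$ (i, h))" by (simp_all add: psd_mat_iff)
    have sq: "(\<Sum>q<n. T $$ (i, q) * T $$ (q, h)) = A $$ (i, h)" if "i < n" "h < n" for i h
      using mat_mult_entry[OF cT cT that] T by simp
    show "T = ?S"
      using cT spectral_sqrt_unique[OF ctx pT sq] by (intro eq_matI) auto
  qed
  then show ?thesis unfolding psd_sqrt_def using cA by simp
qed

lemma psd_spectral: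
  assumes "psd_mat n A"
  obtains e l where "orthonormal n n e" "\<And>j i. j < n \<Longrightarrow> i < n \<Longrightarrow> mv n (\<lambda>i h. A $$ (i, h)) (e j) i = l j * e j i"
proof -
  have "\<And>i h. i < n \<Longrightarrow> h < n \<Longrightarrow> A $$ (i, h) = A $$ (h, i)" using assms by (simp add: psd_mat_iff symmetric_psd_def)
  from spectral_symmetric[where a = "\<lambda>i h. A $$ (i, h)", OF this] that show ?thesis by metis
qed

lemma psd_sqrt:
  assumes A: "psd_mat n A"
  shows "psd_mat n (psd_sqrt A)" "i < n \<Longrightarrow> h < n \<Longrightarrow> (\<Sum>q<n. psd_sqrt A $$ (i, q) * psd_sqrt A $$ (q, h)) = A $$ (i, h)"
proof -
  obtain e l where e: "orthonormal n n e" and eig: "\<And>j i. j < n \<Longrightarrow> i < n \<Longrightarrow> mv n (\<lambda>i h. A $$ (i, h)) (e j) i = l j * e j i"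
    by (rule psd_spectral[OF A]) (rule that)
  have pA: "symmetric_psd n (\<lambda>i h. A $$ (i, h))" using A by (simp add: psd_mat_iff)
  have eq: "psd_sqrt A = mat n n (\<lambda>(i, h). spectral_sqrt n e l i h)" by (rule psd_sqrt_eq_spectral[OF A e eig])
  have S: "symmetric_psd n (spectral_sqrt n e l)" by (rule spectral_sqrt_symmetric_psd[OF pA e eig])
  have mvc: "mv n (\<lambda>i h. psd_sqrt A $$ (i, h)) x i = mv n (spectral_sqrt n e l) x i" if "i < n" for x i
    unfolding eq mv_def using that by (intro sum.cong) auto
  have "symmetric_psd n (\<lambda>i h. psd_sqrt A $$ (i, h))"
    unfolding symmetric_psd_def
  proof (intro conjI allI impI)
    fix i h assume "i < n" "h < n"
    then show "psd_sqrt A $$ (i, h) = psd_sqrt A $$ (h, i)" unfolding eq using S by (simp add: symmetric_psd_def)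
  next
    fix x
    have "ip n x (mv n (\<lambda>i h. psd_sqrt A $$ (i, h)) x) = ip n x (mv n (spectral_sqrt n e l) x)"
      using mvc by (intro ip_cong) auto
    then show "0 \<le> ip n x (mv n (\<lambda>i h. psd_sqrt A $$ (i, h)) x)" using S by (simp add: symmetric_psd_def)
  qed
  then show "psd_mat n (psd_sqrt A)" by (simp add: psd_mat_iff eq)
  show "(\<Sum>q<n. psd_sqrt A $$ (i, q) * psd_sqrt A $$ (q, h)) = A $$ (i, h)" if "i < n" "h < n"
  proof -
    have "(\<Sum>q<n. psd_sqrt A $$ (i, q) * psd_sqrt A $$ (q, h)) = (\<Sum>q<n. spectral_sqrt n e l i q * spectral_sqrt n e l q h)"
      unfolding eq using that by (intro sum.cong) auto
    then show ?thesis using spectral_sqrt_square[OF pA e eig that] by simp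
  qed
qed

text \<open>The nuclear norm is the sum of \<open>sqrt (l j)\<close> over at most \<open>k\<close>
  nonzero Gram eigenvalues; Cauchy-Schwarz against the constant 1 gives the factor
  \<open>k\<close>.\<close>

lemma nuc_norm_le:
  assumes V: "V \<in> carrier_mat p m" and CD: "\<And>i j. i < p \<Longrightarrow> j < m \<Longrightarrow> V $$ (i, j) = (\<Sum>h<k. C i h * D h j)"
  shows "(nuc_norm V)\<^sup>2 \<le> real k * (fro_norm V)\<^sup>2"
proof -
  let ?v = "\<lambda>i j. V $$ (i, j)"
  let ?A = "transpose_mat V * V"
  have cA: "?A \<in> carrier_mat m m" using V by simp
  have entry: "?A $$ (i, j) = gram p ?v i j" if "i < m" "j < m" for i j
    using mat_mult_entry[of "transpose_mat V" m p V m i j] V that by (simp add: gram_def)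
  have mvA: "mv m (\<lambda>i h. ?A $$ (i, h)) x i = mv m (gram p ?v) x i" if "i < m" for x i
    unfolding mv_def using entry[OF that] by (intro sum.cong) auto
  have "symmetric_psd m (\<lambda>i h. ?A $$ (i, h))"
    unfolding symmetric_psd_def
  proof (intro conjI allI impI)
    fix i h assume "i < m" "h < m"
    then show "?A $$ (i, h) = ?A $$ (h, i)" by (simp add: entry gram_def mult.commute)
  next
    fix x
    have "ip m x (mv m (\<lambda>i h. ?A $$ (i, h)) x) = ip m x (mv m (gram p ?v) x)" using mvA by (intro ip_cong) auto
    also have "\<dots> = ip p (mv m ?v x) (mv m ?v x)" by (rule ip_mv_gram[symmetric])
    finally show "0 \<le> ip m x (mv m (\<lambda>i h. ?A $$ (i, h)) x)" using ip_nonneg by simp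
  qed
  then have A: "psd_mat m ?A" using cA by (simp add: psd_mat_iff)
  obtain e l where e: "orthonormal m m e" and eig: "\<And>j i. j < m \<Longrightarrow> i < m \<Longrightarrow> mv m (\<lambda>i h. ?A $$ (i, h)) (e j) i = l j * e j i"
    by (rule psd_spectral[OF A]) (rule that)
  have eig': "mv m (gram p ?v) (e j) i = l j * e j i" if "j < m" "i < m" for j i using eig[OF that] mvA[OF that(2)] by simp
  have l0: "0 \<le> l j" if "j < m" for j
    using eigenvalue_nonneg[OF _ e eig that] A by (simp add: psd_mat_iff)
  let ?J = "{j\<in>{..<m}. l j \<noteq> 0}"
  have cJ: "card ?J \<le> k" by (rule gram_rank[OF e eig' CD])
  have eq: "psd_sqrt ?A = mat m m (\<lambda>(i, h). spectral_sqrt m e l i h)" by (rule psd_sqrt_eq_spectral[OF A e eig])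
  have "nuc_norm V = (\<Sum>i<m. spectral_sqrt m e l i i)"
    unfolding nuc_norm_def eq mtrace_def by simp
  also have "\<dots> = (\<Sum>j<m. \<Sum>i<m. sqrt (l j) * (e j i * e j i))"
    unfolding spectral_sqrt_def by (subst sum.swap) (simp add: mult_ac)
  also have "\<dots> = (\<Sum>j<m. sqrt (l j) * ip m (e j) (e j))" by (simp add: ip_def sum_distrib_left)
  also have "\<dots> = (\<Sum>j<m. sqrt (l j))" using e by (simp add: orthonormal_def)
  also have "\<dots> = (\<Sum>j\<in>?J. sqrt (l j) * 1)" by (intro sum.mono_neutral_cong_right) auto
  finally have "(nuc_norm V)\<^sup>2 = (\<Sum>j\<in>?J. sqrt (l j) * 1)\<^sup>2" by simp
  also have "\<dots> \<le> (\<Sum>j\<in>?J. (sqrt (l j))\<^sup>2) * (\<Sum>j\<in>?J. 1\<^sup>2)" by (rule Cauchy_Schwarz_ineq_sum)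
  also have "(\<Sum>j\<in>?J. (sqrt (l j))\<^sup>2) = (\<Sum>j\<in>?J. l j)" using l0 by (intro sum.cong) auto
  also have "\<dots> = (\<Sum>j<m. l j)" by (rule sum.mono_neutral_left) auto
  also have "\<dots> = fro2 p m ?v" by (rule fro2_eq_sum_eigen[OF e eig', symmetric])
  also have "fro2 p m ?v * (\<Sum>j\<in>?J. 1\<^sup>2) \<le> fro2 p m ?v * real k" using cJ fro2_nonneg by (intro mult_left_mono) auto
  also have "fro2 p m ?v = (fro_norm V)\<^sup>2"
    using V fro2_nonneg[of p m ?v] by (simp add: fro_norm_def fro2_def)
  finally show ?thesis by (simp add: mult.commute)
qed

text \<open>A maximal independent set of columns spans all columns and has at most \<open>k\<close>
  members; missing indices up to \<open>k\<close> are padded with zeros.\<close>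

lemma mrank_factor:
  assumes V: "V \<in> carrier_mat p m" and r: "mrank V \<le> k"
  shows "\<exists>C D. \<forall>i<p. \<forall>j<m. V $$ (i, j) = (\<Sum>h<k. C i h * D h j)"
proof -
  interpret vs: vec_space "TYPE(real)" p .
  let ?P = "\<lambda>T. T \<subseteq> set (cols V) \<and> vs.lin_indpt T"
  have cols: "set (cols V) \<subseteq> carrier_vec p" using cols_dim[of V] V by simp
  have "?P {}" by (simp add: vs.lin_dep_def)
  then obtain S where S: "finite S" "maximal S ?P"
    using maximal_exists_superset[of "set (cols V)" ?P "{}"] by auto
  then have P: "S \<subseteq> set (cols V)" "vs.lin_indpt S" by (auto simp: maximal_def)
  have cS: "S \<subseteq> carrier_vec p" using P(1) cols by blast
  have card: "card S \<le> k" using vs.rank_card_indpt[OF V S(2)] r V by (simp add: mrank_def)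
  have "\<exists>a. \<forall>i<p. V $$ (i, j) = (\<Sum>x\<in>S. a x * vec_index x i)" if j: "j < m" for j
  proof -
    let ?c = "col V j"
    have c: "?c \<in> set (cols V)" using V j by (auto simp: cols_def)
    have "?c \<in> vs.span S"
    proof (cases "?c \<in> S")
      case True
      then show ?thesis using cS vs.span_mem by blast
    next
      case False
      have "\<not> ?P (insert ?c S)" using S(2) False unfolding maximal_def by blast
      then have "vs.lin_dep (insert ?c S)" using c P(1) by blast
      then show ?thesis using vs.lin_dep_iff_in_span[OF cS P(2) _ False] c cols by auto
    qed
    then obtain a where "?c = vs.lincomb a S" using vs.finite_in_span[OF S(1) cS, of ?c] by metis
    then have "vec_index ?c i = (\<Sum>x\<in>S. a x * vec_index x i)" if "i < p" for i
      using vs.lincomb_index[OF that cS] by simp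
    then show ?thesis using V j by (intro exI[of _ a]) auto
  qed
  then have "\<forall>j\<in>{..<m}. \<exists>a. \<forall>i<p. V $$ (i, j) = (\<Sum>x\<in>S. a x * vec_index x i)" by simp
  from bchoice[OF this] obtain a where a: "\<forall>j\<in>{..<m}. \<forall>i<p. V $$ (i, j) = (\<Sum>x\<in>S. a j x * vec_index x i)" by (elim exE)
  obtain f where f: "bij_betw f {..<card S} S" using ex_bij_betw_nat_finite[OF S(1)] by (auto simp: atLeast0LessThan)
  define C where "C i h = (if h < card S then vec_index (f h) i else 0)" for i h
  define D where "D h j = a j (f h)" for h j
  have "V $$ (i, j) = (\<Sum>h<k. C i h * D h j)" if "i < p" "j < m" for i j
  proof -
    have "V $$ (i, j) = (\<Sum>x\<in>S. a j x * vec_index x i)" using a that by simp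
    also have "\<dots> = (\<Sum>h<card S. a j (f h) * vec_index (f h) i)" by (rule sum.reindex_bij_betw[OF f, symmetric])
    also have "\<dots> = (\<Sum>h<k. C i h * D h j)"
      using card by (intro sum.mono_neutral_cong_left) (auto simp: C_def D_def)
    finally show ?thesis .
  qed
  then show ?thesis by (intro exI[of _ C] exI[of _ D]) simp
qed

lemma mrank_factor_le: "mrank (mat p m (\<lambda>(i, j). \<Sum>h<k. C i h * D h j)) \<le> k"
proof -
  interpret vs: vec_space "TYPE(real)" p .
  have "vs.rank (mat p m (\<lambda>(i, j). \<Sum>h<k. C i h * D h j)) \<le> k"
  proof (induction k)
    case 0
    have eq: "mat p m (\<lambda>(i, j). \<Sum>h<0. C i h * D h j) = 0\<^sub>m p m" by (intro eq_matI) auto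
    show ?case unfolding eq using vs.rank_0I[of m] by simp
  next
    case (Suc k)
    let ?A = "mat p m (\<lambda>(i, j). \<Sum>h<k. C i h * D h j)" and ?B = "mat p m (\<lambda>(i, j). C i k * D k j)"
    have "mat p m (\<lambda>(i, j). \<Sum>h<Suc k. C i h * D h j) = ?A + ?B" by (intro eq_matI) auto
    moreover have "vs.rank ?B \<le> 1" by (rule vs.rank_le_1_product_entries[where f = "\<lambda>i. C i k" and g = "D k"]) auto
    moreover have "vs.rank (?A + ?B) \<le> vs.rank ?A + vs.rank ?B" by (rule vs.rank_subadditive) auto
    ultimately show ?case using Suc.IH by simp
  qed
  then show ?thesis by (simp add: mrank_def)
qed

lemma mrank_diff_le:
  assumes A: "A \<in> carrier_mat p m" "mrank A \<le> r" and B: "B \<in> carrier_mat p m" "mrank B \<le> r"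
  shows "mrank (A - B) \<le> 2 * r"
proof -
  obtain C D where CD: "\<forall>i<p. \<forall>j<m. A $$ (i, j) = (\<Sum>h<r. C i h * D h j)" using mrank_factor[OF A] by (elim exE)
  obtain C' D' where CD': "\<forall>i<p. \<forall>j<m. B $$ (i, j) = (\<Sum>h<r. C' i h * D' h j)" using mrank_factor[OF B] by (elim exE)
  \<comment> \<open>The factors of both matrices side by side, the minus sign absorbed into the
    second left factor.\<close>
  define E where "E i h = (if h < r then C i h else - C' i (h - r))" for i h
  define F where "F h j = (if h < r then D h j else D' (h - r) j)" for h j
  have split: "(\<Sum>h<2 * r. E i h * F h j) = (\<Sum>h<r. C i h * D h j) - (\<Sum>h<r. C' i h * D' h j)" for i j
  proof -
    have "{..<2 * r} = {..<r} \<union> (\<lambda>h. h + r) ` {..<r}"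
    proof (intro equalityI subsetI)
      fix x assume "x \<in> {..<2 * r}"
      then show "x \<in> {..<r} \<union> (\<lambda>h. h + r) ` {..<r}" by (cases "x < r") (auto intro!: image_eqI[of _ _ "x - r"])
    qed auto
    then have "(\<Sum>h<2 * r. E i h * F h j) = (\<Sum>h<r. E i h * F h j) + (\<Sum>h\<in>(\<lambda>h. h + r) ` {..<r}. E i h * F h j)"
      by (simp only:) (rule sum.union_disjoint, auto)
    also have "(\<Sum>h\<in>(\<lambda>h. h + r) ` {..<r}. E i h * F h j) = (\<Sum>h<r. E i (h + r) * F (h + r) j)"
      by (subst sum.reindex) (auto simp: inj_on_def)
    finally show ?thesis by (simp add: E_def F_def sum_negf)
  qed
  have "A - B = mat p m (\<lambda>(i, j). \<Sum>h<2 * r. E i h * F h j)"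
    unfolding split using A B CD CD' by (intro eq_matI) auto
  then show ?thesis by (simp only: mrank_factor_le)
qed

text \<open>The infimum is applied to each column of \<open>V\<close>. \<open>1 \<le> p\<close>
  makes its index set nonempty, which gives \<open>0 \<le> kappa Sig\<close> and so permits
  squaring.\<close>

lemma kappa_le:
  assumes A: "psd_mat p Sig" and p: "1 \<le> p" and V: "V \<in> carrier_mat p m"
  shows "(kappa Sig)\<^sup>2 * (fro_norm V)\<^sup>2 \<le> fro2 p m (\<lambda>i j. \<Sum>h<p. psd_sqrt Sig $$ (i, h) * V $$ (h, j))"
proof -
  let ?S = "psd_sqrt Sig" and ?K = "carrier_vec p - {0\<^sub>v p} :: real Matrix.vec set"
  have cS: "?S \<in> carrier_mat p p" using psd_sqrt(1)[OF A] by (simp add: psd_mat_iff)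
  have dim: "dim_row Sig = p" using A by (auto simp: psd_mat_def)
  have vn: "vnorm v = sqrt (ip p (vec_index v) (vec_index v))" if "v \<in> carrier_vec p" for v
    using that by (simp add: vnorm_def scalar_prod_ip)
  have vn0: "0 \<le> vnorm v" if "v \<in> carrier_vec p" for v using vn[OF that] ip_nonneg by simp
  have ne: "?K \<noteq> {}"
  proof -
    have "unit_vec p 0 \<in> ?K" using p by (auto simp: unit_vec_nonzero)
    then show ?thesis by blast
  qed
  have q0: "0 \<le> vnorm (?S *\<^sub>v v) / vnorm v" if "v \<in> carrier_vec p" for v
    using vn0[of "?S *\<^sub>v v"] vn0[of v] cS that by simp
  have k0: "0 \<le> kappa Sig" unfolding kappa_def dim by (rule cINF_greatest[OF ne]) (use q0 in auto)
  have le: "(kappa Sig)\<^sup>2 * ip p (vec_index v) (vec_index v) \<le> ip p (vec_index (?S *\<^sub>v v)) (vec_index (?S *\<^sub>v v))" if v: "v \<in> carrier_vec p" for v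
  proof (cases "v = 0\<^sub>v p")
    case True
    then have "ip p (vec_index v) (vec_index v) = 0" by (simp add: ip_def)
    then show ?thesis using ip_nonneg by simp
  next
    case False
    have pos: "0 < vnorm v"
    proof -
      have "ip p (vec_index v) (vec_index v) \<noteq> 0"
      proof
        assume "ip p (vec_index v) (vec_index v) = 0"
        then have "v = 0\<^sub>v p" using v ip_eq_0D[of p "vec_index v"] by (intro eq_vecI) auto
        then show False using False by simp
      qed
      then show ?thesis using vn[OF v] ip_nonneg[of p "vec_index v"] by simp
    qed
    have "kappa Sig \<le> vnorm (?S *\<^sub>v v) / vnorm v"
      unfolding kappa_def dim
    proof (rule cINF_lower)
      show "bdd_below ((\<lambda>v. vnorm (?S *\<^sub>v v) / vnorm v) ` ?K)" using q0 by (intro bdd_belowI[of _ 0]) auto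
    qed (use v False in simp)
    then have "kappa Sig * vnorm v \<le> vnorm (?S *\<^sub>v v)" using pos by (simp add: pos_le_divide_eq)
    then have "(kappa Sig * vnorm v)\<^sup>2 \<le> (vnorm (?S *\<^sub>v v))\<^sup>2" using k0 pos by (intro power_mono) auto
    then show ?thesis using v cS vn[OF v] vn[of "?S *\<^sub>v v"] ip_nonneg by (simp add: power_mult_distrib)
  qed
  have colS: "ip p (vec_index (?S *\<^sub>v col V j)) (vec_index (?S *\<^sub>v col V j)) = (\<Sum>i<p. (\<Sum>h<p. ?S $$ (i, h) * V $$ (h, j))\<^sup>2)" if "j < m" for j
  proof -
    have "vec_index (?S *\<^sub>v col V j) i = (\<Sum>h<p. ?S $$ (i, h) * V $$ (h, j))" if "i < p" for i
      using V cS that \<open>j < m\<close> by (subst mult_mat_vec_mv[OF cS]) (auto simp: mv_def)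
    then show ?thesis by (simp add: ip_def power2_eq_square)
  qed
  have col: "ip p (vec_index (col V j)) (vec_index (col V j)) = (\<Sum>i<p. (V $$ (i, j))\<^sup>2)" if "j < m" for j
    using V that by (simp add: ip_def power2_eq_square)
  have "(fro_norm V)\<^sup>2 = (\<Sum>i<p. \<Sum>j<m. (V $$ (i, j))\<^sup>2)" using V by (simp add: fro_norm_def sum_nonneg)
  also have "\<dots> = (\<Sum>j<m. \<Sum>i<p. (V $$ (i, j))\<^sup>2)" by (rule sum.swap)
  finally have "(kappa Sig)\<^sup>2 * (fro_norm V)\<^sup>2 = (\<Sum>j<m. (kappa Sig)\<^sup>2 * (\<Sum>i<p. (V $$ (i, j))\<^sup>2))"
    by (simp add: sum_distrib_left)
  also have "\<dots> \<le> (\<Sum>j<m. \<Sum>i<p. (\<Sum>h<p. ?S $$ (i, h) * V $$ (h, j))\<^sup>2)"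
  proof (rule sum_mono)
    fix j assume "j \<in> {..<m}"
    then show "(kappa Sig)\<^sup>2 * (\<Sum>i<p. (V $$ (i, j))\<^sup>2) \<le> (\<Sum>i<p. (\<Sum>h<p. ?S $$ (i, h) * V $$ (h, j))\<^sup>2)"
      using le[of "col V j"] col[of j] colS[of j] V by simp
  qed
  also have "\<dots> = fro2 p m (\<lambda>i j. \<Sum>h<p. ?S $$ (i, h) * V $$ (h, j))" unfolding fro2_def by (rule sum.swap)
  finally show ?thesis .
qed

lemma mtrace_eq_fro2:
  assumes A: "psd_mat p Sig" and V: "V \<in> carrier_mat p m"
  shows "mtrace (transpose_mat V * Sig * V) = fro2 p m (\<lambda>i j. \<Sum>h<p. psd_sqrt Sig $$ (i, h) * V $$ (h, j))"
proof -
  let ?S = "\<lambda>i h. psd_sqrt Sig $$ (i, h)"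
  have cA: "Sig \<in> carrier_mat p p" using A by (simp add: psd_mat_iff)
  have sym: "?S i h = ?S h i" if "i < p" "h < p" for i h
    using psd_sqrt(1)[OF A] that by (simp add: psd_mat_iff symmetric_psd_def)
  have entry: "(transpose_mat V * Sig * V) $$ (j, j) = (\<Sum>i<p. (\<Sum>h<p. ?S i h * V $$ (h, j))\<^sup>2)" if j: "j < m" for j
  proof -
    have "(transpose_mat V * Sig * V) $$ (j, j) = (\<Sum>h<p. (transpose_mat V * Sig) $$ (j, h) * V $$ (h, j))"
      by (rule mat_mult_entry[OF _ V j j]) (use V cA in simp)
    also have "\<dots> = (\<Sum>h<p. (\<Sum>h'<p. V $$ (h', j) * Sig $$ (h', h)) * V $$ (h, j))"
    proof (rule sum.cong)
      fix h assume "h \<in> {..<p}"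
      then have h: "h < p" by simp
      have "(transpose_mat V * Sig) $$ (j, h) = (\<Sum>h'<p. transpose_mat V $$ (j, h') * Sig $$ (h', h))"
        by (rule mat_mult_entry[OF _ cA j h]) (use V in simp)
      also have "\<dots> = (\<Sum>h'<p. V $$ (h', j) * Sig $$ (h', h))" using V j by (intro sum.cong) auto
      finally show "(transpose_mat V * Sig) $$ (j, h) * V $$ (h, j) = (\<Sum>h'<p. V $$ (h', j) * Sig $$ (h', h)) * V $$ (h, j)" by simp
    qed simp
    also have "\<dots> = (\<Sum>h<p. \<Sum>h'<p. \<Sum>i<p. (?S i h' * V $$ (h', j)) * (?S i h * V $$ (h, j)))"
    proof (intro sum.cong refl)
      fix h assume "h \<in> {..<p}"
      then have h: "h < p" by simp
      have "V $$ (h', j) * Sig $$ (h', h) * V $$ (h, j) = (\<Sum>i<p. (?S i h' * V $$ (h', j)) * (?S i h * V $$ (h, j)))" if "h' < p" for h'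
        unfolding psd_sqrt(2)[OF A that h, symmetric] sum_distrib_left sum_distrib_right
        using sym[OF _ that] by (intro sum.cong) auto
      then show "(\<Sum>h'<p. V $$ (h', j) * Sig $$ (h', h)) * V $$ (h, j) = (\<Sum>h'<p. \<Sum>i<p. (?S i h' * V $$ (h', j)) * (?S i h * V $$ (h, j)))"
        unfolding sum_distrib_right by (intro sum.cong) auto
    qed
    also have "\<dots> = (\<Sum>h<p. \<Sum>i<p. \<Sum>h'<p. (?S i h' * V $$ (h', j)) * (?S i h * V $$ (h, j)))" by (intro sum.cong refl sum.swap)
    also have "\<dots> = (\<Sum>i<p. \<Sum>h<p. \<Sum>h'<p. (?S i h' * V $$ (h', j)) * (?S i h * V $$ (h, j)))" by (rule sum.swap)
    also have "\<dots> = (\<Sum>i<p. (\<Sum>h<p. ?S i h * V $$ (h, j))\<^sup>2)"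
      unfolding power2_eq_square sum_product by (intro sum.cong refl sum.swap)
    finally show ?thesis .
  qed
  have "mtrace (transpose_mat V * Sig * V) = (\<Sum>j<m. (transpose_mat V * Sig * V) $$ (j, j))"
    using V by (simp add: mtrace_def)
  also have "\<dots> = (\<Sum>j<m. \<Sum>i<p. (\<Sum>h<p. ?S i h * V $$ (h, j))\<^sup>2)" using entry by simp
  also have "\<dots> = fro2 p m (\<lambda>i j. \<Sum>h<p. ?S i h * V $$ (h, j))" unfolding fro2_def by (rule sum.swap)
  finally show ?thesis .
qed

section \<open>Depth in the regression model\<close>

lemma emp_depth_le:
  assumes "V \<in> U"
  shows "emp_depth p m n U B \<omega> \<le> real (card {i\<in>{..<n}. 0 \<le> scalar_prod (transpose_mat V *\<^sub>v Matrix.vec p (fst (\<omega> i)))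
      (Matrix.vec m (snd (\<omega> i)) - transpose_mat B *\<^sub>v Matrix.vec p (fst (\<omega> i)))}) / real n"
  unfolding emp_depth_def by (rule cINF_lower[OF _ assms]) (rule bdd_belowI[of _ 0], auto)

lemma emp_depth_ge:
  assumes "U \<noteq> {}" "\<And>V. V \<in> U \<Longrightarrow> c \<le> real (card {i\<in>{..<n}. 0 \<le> scalar_prod (transpose_mat V *\<^sub>v Matrix.vec p (fst (\<omega> i)))
      (Matrix.vec m (snd (\<omega> i)) - transpose_mat B *\<^sub>v Matrix.vec p (fst (\<omega> i)))}) / real n"
  shows "c \<le> emp_depth p m n U B \<omega>"
  unfolding emp_depth_def by (rule cINF_greatest[OF assms])

lemma residual_inner_product:
  fixes V B :: "real mat" and x y :: "nat \<Rightarrow> real"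
  assumes V: "V \<in> carrier_mat p m" and B: "B \<in> carrier_mat p m"
  shows "scalar_prod (transpose_mat V *\<^sub>v Matrix.vec p x) (Matrix.vec m y - transpose_mat B *\<^sub>v Matrix.vec p x) =
    (\<Sum>j<m. (\<Sum>i<p. V $$ (i, j) * x i) * (y j - (\<Sum>i<p. B $$ (i, j) * x i)))"
proof -
  have T: "vec_index (transpose_mat W *\<^sub>v Matrix.vec p x) j = (\<Sum>i<p. W $$ (i, j) * x i)" if "W \<in> carrier_mat p m" "j < m" for W j
  proof -
    have "vec_index (transpose_mat W *\<^sub>v Matrix.vec p x) j = mv p (\<lambda>i h. transpose_mat W $$ (i, h)) (vec_index (Matrix.vec p x)) j"
      by (rule mult_mat_vec_mv[of _ m p]) (use that in auto)
    also have "\<dots> = (\<Sum>i<p. W $$ (i, j) * x i)" unfolding mv_def using that by (intro sum.cong) auto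
    finally show ?thesis .
  qed
  have "scalar_prod (transpose_mat V *\<^sub>v Matrix.vec p x) (Matrix.vec m y - transpose_mat B *\<^sub>v Matrix.vec p x) =
      ip m (vec_index (transpose_mat V *\<^sub>v Matrix.vec p x)) (vec_index (Matrix.vec m y - transpose_mat B *\<^sub>v Matrix.vec p x))"
    by (rule scalar_prod_ip) (use V B in auto)
  also have "\<dots> = ip m (\<lambda>j. \<Sum>i<p. V $$ (i, j) * x i) (\<lambda>j. y j - (\<Sum>i<p. B $$ (i, j) * x i))"
    using T[OF V] T[OF B] B by (intro ip_cong) auto
  finally show ?thesis by (simp add: ip_def)
qed

text \<open>The symmetric root moves to the other side: U^T (a z) = (a U)^T z. The value thus
  depends on U only through a U.\<close>

lemma pushforward_linear:
  fixes a U :: "nat \<Rightarrow> nat \<Rightarrow> real"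
  assumes sym: "\<And>i h. i < p \<Longrightarrow> h < p \<Longrightarrow> a i h = a h i" and x: "\<And>i. i < p \<Longrightarrow> x i = mv p a z i"
    and V: "\<And>i. i < p \<Longrightarrow> V i j = (\<Sum>h<p. a i h * U h j)"
  shows "(\<Sum>i<p. U i j * x i) = (\<Sum>i<p. V i j * z i)"
proof -
  have "(\<Sum>i<p. U i j * x i) = (\<Sum>i<p. \<Sum>h<p. a h i * U i j * z h)"
    using x sym by (intro sum.cong refl) (auto simp: mv_def sum_distrib_left intro!: sum.cong)
  also have "\<dots> = (\<Sum>h<p. \<Sum>i<p. a h i * U i j * z h)" by (rule sum.swap)
  also have "\<dots> = (\<Sum>h<p. V h j * z h)" using V by (intro sum.cong refl) (simp add: sum_distrib_right)
  finally show ?thesis .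
qed

text \<open>A symmetric operator maps onto the orthogonal complement of its kernel; the witness
  inverts the nonzero eigenvalues and drops the others.\<close>

lemma range_symmetric:
  assumes e: "orthonormal p p e" and eig: "\<And>j i. j < p \<Longrightarrow> i < p \<Longrightarrow> mv p a (e j) i = l j * e j i"
    and x: "\<And>j. j < p \<Longrightarrow> l j = 0 \<Longrightarrow> ip p x (e j) = 0"
  shows "\<exists>z. \<forall>i<p. x i = mv p a z i"
proof -
  define c where "c j = (if l j = 0 then 0 else ip p x (e j) / l j)" for j
  define z where "z i = (\<Sum>j<p. c j * e j i)" for i
  have "x i = mv p a z i" if i: "i < p" for i
  proof -
    have "mv p a z i = (\<Sum>j<p. c j * mv p a (e j) i)"
      unfolding mv_def z_def sum_distrib_left by (subst sum.swap) (simp add: mult_ac)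
    also have "\<dots> = (\<Sum>j<p. ip p x (e j) * e j i)"
      using eig[OF _ i] x by (intro sum.cong refl) (auto simp: c_def)
    also have "\<dots> = x i" by (rule orthonormal_expand[OF e i, symmetric])
    finally show ?thesis by simp
  qed
  then show ?thesis by (intro exI[of _ z]) simp
qed

lemma gform_eq: "(\<And>j. j < m \<Longrightarrow> (\<Sum>i<p. U i j * x i) = (\<Sum>i<p. V i j * z i)) \<Longrightarrow> gform p m U x w = gform p m V z w"
  unfolding gform_def by (intro sum.cong) auto

lemma qform_eq: "(\<And>j. j < m \<Longrightarrow> (\<Sum>i<p. U i j * x i) = (\<Sum>i<p. V i j * z i)) \<Longrightarrow> qform p m U x = qform p m V z"
  unfolding qform_def by (intro sum.cong) auto

context
  fixes p m r n :: nat and \<sigma> :: real and Sig B :: "real mat"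
  assumes p: "1 \<le> p" and m: "1 \<le> m" and r: "1 \<le> r" and n: "1 \<le> n" and \<sigma>: "0 < \<sigma>"
    and Sig: "psd_mat p Sig" and B: "B \<in> low_rank_set p m r"
begin

section \<open>Whitened observations for a possibly singular covariance\<close>

definition root :: "nat \<Rightarrow> nat \<Rightarrow> real" where "root i h = psd_sqrt Sig $$ (i, h)"

text \<open>Recovers the standardised noise w from an observation of the model
  (\<open>obs_noise_sample\<close>); at a contaminated point it is merely a formula.\<close>

definition obs_noise :: "(nat \<Rightarrow> real) \<times> (nat \<Rightarrow> real) \<Rightarrow> nat \<Rightarrow> real" where
  "obs_noise \<omega> j = (snd \<omega> j - (\<Sum>i<p. B $$ (i, j) * fst \<omega> i)) / \<sigma>"

definition sample :: "(nat \<Rightarrow> real) \<times> (nat \<Rightarrow> real) \<Rightarrow> (nat \<Rightarrow> real) \<times> (nat \<Rightarrow> real)" where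
  "sample u = (\<lambda>i\<in>{..<p}. mv p root (fst u) i,
     \<lambda>j\<in>{..<m}. (\<Sum>i<p. B $$ (i, j) * mv p root (fst u) i) + \<sigma> * snd u j)"

text \<open>With singular \<open>Sig\<close> the latent z cannot be recovered from x, but V^T z can
  be evaluated on x through any preimage of V under the root.\<close>

definition preim :: "(nat \<Rightarrow> nat \<Rightarrow> real) \<Rightarrow> nat \<Rightarrow> nat \<Rightarrow> real" where
  "preim V = (SOME U. \<forall>i<p. \<forall>j<m. V i j = (\<Sum>h<p. root i h * U h j))"

lemma root_symmetric: "i < p \<Longrightarrow> h < p \<Longrightarrow> root i h = root h i"
  using psd_sqrt(1)[OF Sig] by (simp add: psd_mat_iff symmetric_psd_def root_def)

lemma B_carrier: "B \<in> carrier_mat p m"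
  using B by (simp add: low_rank_set_def)

lemma preim:
  assumes "lowclass root p m k V" "i < p" "j < m"
  shows "V i j = (\<Sum>h<p. root i h * preim V h j)"
proof -
  obtain C D where CD: "\<forall>i<p. \<forall>j<m. V i j = (\<Sum>l<k. (\<Sum>h<p. root i h * C h l) * D l j)"
    using assms(1) unfolding lowclass_def by (elim exE)
  have "V i j = (\<Sum>h<p. root i h * (\<Sum>l<k. C h l * D l j))" if "i < p" "j < m" for i j
  proof -
    have "V i j = (\<Sum>l<k. \<Sum>h<p. root i h * (C h l * D l j))" using CD that by (simp add: sum_distrib_right sum_distrib_left mult_ac)
    also have "\<dots> = (\<Sum>h<p. \<Sum>l<k. root i h * (C h l * D l j))" by (rule sum.swap)
    finally show ?thesis by (simp add: sum_distrib_left)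
  qed
  then have "\<exists>U. \<forall>i<p. \<forall>j<m. V i j = (\<Sum>h<p. root i h * U h j)"
    by (intro exI[of _ "\<lambda>h j. \<Sum>l<k. C h l * D l j"]) simp
  from someI_ex[OF this, folded preim_def] assms(2,3) show ?thesis by blast
qed

lemma mv_measurable: "(\<lambda>u. mv p root (fst u) i) \<in> borel_measurable (gauss2 p m)"
  unfolding mv_def gauss2_def using measurable_compose[OF measurable_fst measurable_lin] by simp

lemma snd_component_measurable: "j < m \<Longrightarrow> (\<lambda>u. snd u j) \<in> borel_measurable (gauss2 p m)"
  unfolding gauss2_def using measurable_compose[OF measurable_snd measurable_std_gauss_component[of j m]] by simp

lemma sample_measurable: "sample \<in> gauss2 p m \<rightarrow>\<^sub>M pt_space p m"
  unfolding sample_def[abs_def] pt_space_def eucl_def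
proof (intro measurable_Pair measurable_restrict)
  fix i
  show "(\<lambda>u. mv p root (fst u) i) \<in> gauss2 p m \<rightarrow>\<^sub>M lborel" using mv_measurable by simp
next
  fix j assume "j \<in> {..<m}"
  then have "(\<lambda>u. (\<Sum>i<p. B $$ (i, j) * mv p root (fst u) i) + \<sigma> * snd u j) \<in> borel_measurable (gauss2 p m)"
    by (intro borel_measurable_add borel_measurable_sum borel_measurable_times mv_measurable snd_component_measurable borel_measurable_const) simp
  then show "(\<lambda>u. (\<Sum>i<p. B $$ (i, j) * mv p root (fst u) i) + \<sigma> * snd u j) \<in> gauss2 p m \<rightarrow>\<^sub>M lborel" by simp
qed

lemma model_law_eq: "model_law p m Sig \<sigma> B = distr (gauss2 p m) (pt_space p m) sample"
proof -
  have cS: "psd_sqrt Sig \<in> carrier_mat p p" using psd_sqrt(1)[OF Sig] by (simp add: psd_mat_iff)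
  have X: "vec_index (psd_sqrt Sig *\<^sub>v Matrix.vec p z) i = mv p root z i" if "i < p" for z i
    using that by (subst mult_mat_vec_mv[OF cS]) (auto simp: mv_def root_def intro!: sum.cong)
  have BX: "vec_index (transpose_mat B *\<^sub>v (psd_sqrt Sig *\<^sub>v Matrix.vec p z)) j = (\<Sum>i<p. B $$ (i, j) * mv p root z i)" if "j < m" for z j
  proof -
    have "vec_index (transpose_mat B *\<^sub>v (psd_sqrt Sig *\<^sub>v Matrix.vec p z)) j =
        mv p (\<lambda>i h. transpose_mat B $$ (i, h)) (vec_index (psd_sqrt Sig *\<^sub>v Matrix.vec p z)) j"
      by (rule mult_mat_vec_mv[of _ m p]) (use B_carrier cS that in auto)
    also have "\<dots> = (\<Sum>i<p. B $$ (i, j) * mv p root z i)"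
      unfolding mv_def[of p "\<lambda>i h. transpose_mat B $$ (i, h)"] using B_carrier that X by (intro sum.cong) auto
    finally show ?thesis .
  qed
  have eq: "(case u of (z, w) \<Rightarrow> let x = psd_sqrt Sig *\<^sub>v Matrix.vec p z
      in (fun_of p x, fun_of m (transpose_mat B *\<^sub>v x + \<sigma> \<cdot>\<^sub>v Matrix.vec m w))) = sample u" for u
  proof -
    obtain z w where u: "u = (z, w)" by (cases u)
    have 1: "fun_of p (psd_sqrt Sig *\<^sub>v Matrix.vec p z) = (\<lambda>i\<in>{..<p}. mv p root z i)"
      unfolding fun_of_def by (rule restrict_ext) (rule X, simp)
    have 2: "fun_of m (transpose_mat B *\<^sub>v (psd_sqrt Sig *\<^sub>v Matrix.vec p z) + \<sigma> \<cdot>\<^sub>v Matrix.vec m w) =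
        (\<lambda>j\<in>{..<m}. (\<Sum>i<p. B $$ (i, j) * mv p root z i) + \<sigma> * w j)"
      unfolding fun_of_def
    proof (rule restrict_ext)
      fix j assume "j \<in> {..<m}"
      then have j: "j < m" by simp
      then show "vec_index (transpose_mat B *\<^sub>v (psd_sqrt Sig *\<^sub>v Matrix.vec p z) + \<sigma> \<cdot>\<^sub>v Matrix.vec m w) j =
          (\<Sum>i<p. B $$ (i, j) * mv p root z i) + \<sigma> * w j"
        using BX[OF j, of z] B_carrier by (simp only: index_add_vec index_smult_vec dim_vec index_vec)
    qed
    show ?thesis unfolding u sample_def Let_def prod.case fst_conv snd_conv 1 2 ..
  qed
  have "(\<lambda>(z, w). let x = psd_sqrt Sig *\<^sub>v Matrix.vec p z
      in (fun_of p x, fun_of m (transpose_mat B *\<^sub>v x + \<sigma> \<cdot>\<^sub>v Matrix.vec m w))) = sample"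
    by (rule ext) (rule eq)
  then show ?thesis unfolding model_law_def gauss2_def by (rule arg_cong)
qed

lemma model_law_distr: "model_law p m Sig \<sigma> B = distr (gauss2 p m) (model_law p m Sig \<sigma> B) sample"
  unfolding model_law_eq by (rule distr_cong) simp_all

lemma sets_model_law: "sets (model_law p m Sig \<sigma> B) = sets (pt_space p m)"
  by (simp add: model_law_eq)

lemma sample_measurable': "sample \<in> gauss2 p m \<rightarrow>\<^sub>M model_law p m Sig \<sigma> B"
  using sample_measurable by (simp add: model_law_eq)

lemma fst_measurable: "i < p \<Longrightarrow> (\<lambda>\<omega>. fst \<omega> i) \<in> borel_measurable (model_law p m Sig \<sigma> B)"
proof -
  assume i: "i < p"
  have "(\<lambda>x. x i) \<in> eucl p \<rightarrow>\<^sub>M lborel" unfolding eucl_def using i by (intro measurable_component_singleton) simp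
  then have "(\<lambda>\<omega>. fst \<omega> i) \<in> pt_space p m \<rightarrow>\<^sub>M lborel"
    unfolding pt_space_def by (intro measurable_compose[OF measurable_fst])
  then show ?thesis by (simp add: model_law_eq)
qed

lemma snd_measurable: "j < m \<Longrightarrow> (\<lambda>\<omega>. snd \<omega> j) \<in> borel_measurable (model_law p m Sig \<sigma> B)"
proof -
  assume j: "j < m"
  have "(\<lambda>x. x j) \<in> eucl m \<rightarrow>\<^sub>M lborel" unfolding eucl_def using j by (intro measurable_component_singleton) simp
  then have "(\<lambda>\<omega>. snd \<omega> j) \<in> pt_space p m \<rightarrow>\<^sub>M lborel"
    unfolding pt_space_def by (intro measurable_compose[OF measurable_snd])
  then show ?thesis by (simp add: model_law_eq)
qed

lemma lin_fst_measurable: "(\<lambda>\<omega>. \<Sum>i<p. c i * fst \<omega> i) \<in> borel_measurable (model_law p m Sig \<sigma> B)"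
  by (intro borel_measurable_sum borel_measurable_times fst_measurable borel_measurable_const) simp

lemma gform_obs_measurable: "(\<lambda>\<omega>. gform p m U (fst \<omega>) (obs_noise \<omega>)) \<in> borel_measurable (model_law p m Sig \<sigma> B)"
  unfolding gform_def obs_noise_def
  by (intro borel_measurable_sum borel_measurable_times borel_measurable_divide borel_measurable_diff
      lin_fst_measurable snd_measurable borel_measurable_const) simp

lemma qform_obs_measurable: "(\<lambda>\<omega>. qform p m U (fst \<omega>)) \<in> borel_measurable (model_law p m Sig \<sigma> B)"
  unfolding qform_def by (intro borel_measurable_sum borel_measurable_power lin_fst_measurable)

lemma obs_noise_sample: "j < m \<Longrightarrow> obs_noise (sample u) j = snd u j"
proof -
  assume j: "j < m"
  have "(\<Sum>i<p. B $$ (i, j) * fst (sample u) i) = (\<Sum>i<p. B $$ (i, j) * mv p root (fst u) i)"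
    by (rule sum.cong) (simp_all add: sample_def)
  then show ?thesis using j \<sigma> by (simp add: obs_noise_def sample_def)
qed

definition in_range :: "(nat \<Rightarrow> real) \<times> (nat \<Rightarrow> real) \<Rightarrow> bool" where
  "in_range \<omega> \<longleftrightarrow> (\<exists>z. \<forall>i<p. fst \<omega> i = mv p root z i)"

text \<open>The range is the common zero set of finitely many linear functionals, given by the
  eigenvectors with eigenvalue 0.\<close>

lemma in_range_measurable: "Measurable.pred (model_law p m Sig \<sigma> B) in_range"
proof -
  obtain e l where e: "orthonormal p p e" and eig: "\<And>j i. j < p \<Longrightarrow> i < p \<Longrightarrow> mv p root (e j) i = l j * e j i"
    by (rule spectral_symmetric[where n = p and a = root, OF root_symmetric]) (assumption, assumption, rule that)
  have eq: "in_range = (\<lambda>\<omega>. \<forall>j\<in>{j\<in>{..<p}. l j = 0}. (\<Sum>i<p. e j i * fst \<omega> i) = 0)"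
  proof (rule ext, rule iffI)
    fix \<omega> :: "(nat \<Rightarrow> real) \<times> (nat \<Rightarrow> real)" assume "in_range \<omega>"
    then obtain z where z: "\<forall>i<p. fst \<omega> i = mv p root z i" unfolding in_range_def by (elim exE)
    show "\<forall>j\<in>{j\<in>{..<p}. l j = 0}. (\<Sum>i<p. e j i * fst \<omega> i) = 0"
    proof
      fix j assume j: "j \<in> {j\<in>{..<p}. l j = 0}"
      have "(\<Sum>i<p. e j i * fst \<omega> i) = ip p (e j) (mv p root z)" using z by (simp add: ip_def)
      also have "\<dots> = ip p (mv p root (e j)) z" by (rule ip_mv_symmetric[OF root_symmetric])
      also have "\<dots> = ip p (\<lambda>_. 0) z" using eig j by (intro ip_cong) auto
      finally show "(\<Sum>i<p. e j i * fst \<omega> i) = 0" by (simp add: ip_def)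
    qed
  next
    fix \<omega> :: "(nat \<Rightarrow> real) \<times> (nat \<Rightarrow> real)"
    assume *: "\<forall>j\<in>{j\<in>{..<p}. l j = 0}. (\<Sum>i<p. e j i * fst \<omega> i) = 0"
    show "in_range \<omega>" unfolding in_range_def
      by (rule range_symmetric[OF e eig]) (use * in \<open>simp_all add: ip_def mult.commute\<close>)
  qed
  show ?thesis unfolding eq
    by (intro pred_intros_finite(3) pred_eq_const1[where N = borel] lin_fst_measurable) simp_all
qed

lemma in_range_sample: "in_range (sample u)"
  unfolding in_range_def sample_def by (intro exI[of _ "fst u"]) simp

text \<open>One latent z serves all pairs U, V at once; hence the value of a form does not depend on
  which preimage of V was chosen.\<close>

lemma in_range_forms:
  assumes "in_range \<omega>"
  shows "\<exists>z. \<forall>U V. (\<forall>i<p. \<forall>j<m. V i j = (\<Sum>h<p. root i h * U h j)) \<longrightarrow>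
    (\<forall>w. gform p m U (fst \<omega>) w = gform p m V z w) \<and> qform p m U (fst \<omega>) = qform p m V z"
proof -
  obtain z where z: "\<forall>i<p. fst \<omega> i = mv p root z i" using assms unfolding in_range_def by (elim exE)
  show ?thesis
  proof (intro exI[of _ z] allI impI)
    fix U V assume "\<forall>i<p. \<forall>j<m. V i j = (\<Sum>h<p. root i h * U h j)"
    then have eq: "(\<Sum>i<p. U i j * fst \<omega> i) = (\<Sum>i<p. V i j * z i)" if "j < m" for j
      using z that by (intro pushforward_linear[where a = root] root_symmetric) simp_all
    show "(\<forall>w. gform p m U (fst \<omega>) w = gform p m V z w) \<and> qform p m U (fst \<omega>) = qform p m V z"
      using gform_eq[OF eq] qform_eq[OF eq] by simp
  qed
qed

definition few_positive :: "nat \<Rightarrow> real \<Rightarrow> real \<Rightarrow> nat set \<Rightarrow> (nat \<Rightarrow> (nat \<Rightarrow> real) \<times> (nat \<Rightarrow> real)) \<Rightarrow> bool" where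
  "few_positive k \<eta> s S \<omega> \<longleftrightarrow> (\<forall>V. lowclass root p m k V \<longrightarrow> fro2 p m V = 1 \<longrightarrow>
    (\<Sum>i\<in>{..<n} - S. of_bool (0 \<le> gform p m (preim V) (fst (\<omega> i)) (obs_noise (\<omega> i)) - s * qform p m (preim V) (fst (\<omega> i))))
      \<le> real (card ({..<n} - S)) * (1 / 2 - s / 24) + 10000 * (real n * \<eta>))"

lemma model_halfspace:
  assumes D: "1 \<le> D" "real (k * (p + m)) \<le> 2 * D" and k: "1 \<le> k" and \<eta>: "\<eta> = sqrt (D / n)" "\<eta> \<le> 1 / 2"
    and s: "0 \<le> s" "s \<le> 1"
  shows "ensured (model_law p m Sig \<sigma> B) n (5 * exp (- 2 * D)) (few_positive k \<eta> s)"
  unfolding few_positive_def[abs_def]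
proof (rule uniform_halfspace[where G = "\<lambda>V \<omega>. gform p m (preim V) (fst \<omega>) (obs_noise \<omega>)" and H = "\<lambda>V \<omega>. qform p m (preim V) (fst \<omega>)"
      and A = root and \<rho> = sample and R = in_range, OF p m k n D \<eta> s sample_measurable' model_law_distr])
  fix V u assume V: "lowclass root p m k V"
  have eq: "(\<Sum>i<p. preim V i j * fst (sample u) i) = (\<Sum>i<p. V i j * fst u i)" if "j < m" for j
    by (rule pushforward_linear[where a = root, OF root_symmetric])
      (use preim[OF V _ that] in \<open>simp_all add: sample_def\<close>)
  have "gform p m (preim V) (fst (sample u)) (obs_noise (sample u)) = gform p m V (fst u) (obs_noise (sample u))"
    by (rule gform_eq[OF eq])
  also have "\<dots> = gform p m V (fst u) (snd u)" unfolding gform_def by (intro sum.cong) (simp_all add: obs_noise_sample)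
  finally show "gform p m (preim V) (fst (sample u)) (obs_noise (sample u)) = gform p m V (fst u) (snd u) \<and>
      qform p m (preim V) (fst (sample u)) = qform p m V (fst u)"
    using qform_eq[OF eq] by simp
next
  fix \<omega> assume "in_range \<omega>"
  from in_range_forms[OF this] obtain z where z: "\<forall>U V. (\<forall>i<p. \<forall>j<m. V i j = (\<Sum>h<p. root i h * U h j)) \<longrightarrow>
    (\<forall>w. gform p m U (fst \<omega>) w = gform p m V z w) \<and> qform p m U (fst \<omega>) = qform p m V z" by (elim exE)
  show "\<exists>z w. \<forall>V. lowclass root p m k V \<longrightarrow>
      gform p m (preim V) (fst \<omega>) (obs_noise \<omega>) = gform p m V z w \<and> qform p m (preim V) (fst \<omega>) = qform p m V z"
  proof (rule exI[of _ z], rule exI[of _ "obs_noise \<omega>"], intro allI impI)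
    fix V assume "lowclass root p m k V"
    then have "\<forall>i<p. \<forall>j<m. V i j = (\<Sum>h<p. root i h * preim V h j)" by (intro allI impI preim)
    then show "gform p m (preim V) (fst \<omega>) (obs_noise \<omega>) = gform p m V z (obs_noise \<omega>) \<and> qform p m (preim V) (fst \<omega>) = qform p m V z"
      using z by simp
  qed
qed (rule gform_obs_measurable qform_obs_measurable in_range_measurable in_range_sample)+

definition image_mat :: "real mat \<Rightarrow> nat \<Rightarrow> nat \<Rightarrow> real" where
  "image_mat U i j = (\<Sum>h<p. root i h * U $$ (h, j))"

lemma lowclass_image_mat:
  assumes "U \<in> carrier_mat p m" "mrank U \<le> k"
  shows "lowclass root p m k (\<lambda>i j. c * image_mat U i j)"
proof -
  obtain C D where CD: "\<forall>i<p. \<forall>j<m. U $$ (i, j) = (\<Sum>l<k. C i l * D l j)" using mrank_factor[OF assms] by (elim exE)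
  have "image_mat U i j = (\<Sum>l<k. (\<Sum>h<p. root i h * C h l) * D l j)" if "j < m" for i j
  proof -
    have "image_mat U i j = (\<Sum>h<p. \<Sum>l<k. root i h * C h l * D l j)"
      unfolding image_mat_def using CD that by (intro sum.cong) (auto simp: sum_distrib_left mult_ac)
    also have "\<dots> = (\<Sum>l<k. \<Sum>h<p. root i h * C h l * D l j)" by (rule sum.swap)
    finally show ?thesis by (simp add: sum_distrib_right)
  qed
  then have "lowclass root p m k (image_mat U)"
    unfolding lowclass_def by (intro exI[of _ C] exI[of _ D]) simp
  then show ?thesis by (rule lowclass_scale)
qed

text \<open>The residual under B' is \<sigma> times the noise minus (B' - B)^T x. For U = B' - B the
  last sum becomes the quadratic form.\<close>

lemma residual_term:
  assumes U: "U \<in> carrier_mat p m" and B': "B' \<in> carrier_mat p m"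
  shows "scalar_prod (transpose_mat U *\<^sub>v Matrix.vec p (fst \<omega>)) (Matrix.vec m (snd \<omega>) - transpose_mat B' *\<^sub>v Matrix.vec p (fst \<omega>)) =
    \<sigma> * gform p m (\<lambda>i j. U $$ (i, j)) (fst \<omega>) (obs_noise \<omega>) -
    (\<Sum>j<m. (\<Sum>i<p. U $$ (i, j) * fst \<omega> i) * (\<Sum>i<p. (B' - B) $$ (i, j) * fst \<omega> i))"
proof -
  have d: "(\<Sum>i<p. (B' - B) $$ (i, j) * fst \<omega> i) = (\<Sum>i<p. B' $$ (i, j) * fst \<omega> i) - (\<Sum>i<p. B $$ (i, j) * fst \<omega> i)" if "j < m" for j
    unfolding sum_subtractf[symmetric] using that B' B_carrier by (intro sum.cong) (auto simp: left_diff_distrib)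
  have "\<sigma> * gform p m (\<lambda>i j. U $$ (i, j)) (fst \<omega>) (obs_noise \<omega>) =
      (\<Sum>j<m. (\<Sum>i<p. U $$ (i, j) * fst \<omega> i) * (snd \<omega> j - (\<Sum>i<p. B $$ (i, j) * fst \<omega> i)))"
    unfolding gform_def obs_noise_def sum_distrib_left using \<sigma> by (intro sum.cong) simp_all
  moreover have "(\<Sum>j<m. (\<Sum>i<p. U $$ (i, j) * fst \<omega> i) * (snd \<omega> j - (\<Sum>i<p. B' $$ (i, j) * fst \<omega> i))) =
      (\<Sum>j<m. (\<Sum>i<p. U $$ (i, j) * fst \<omega> i) * (snd \<omega> j - (\<Sum>i<p. B $$ (i, j) * fst \<omega> i)) -
        (\<Sum>i<p. U $$ (i, j) * fst \<omega> i) * (\<Sum>i<p. (B' - B) $$ (i, j) * fst \<omega> i))"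
  proof (rule sum.cong)
    fix j assume "j \<in> {..<m}"
    then have "j < m" by simp
    from d[OF this] show "(\<Sum>i<p. U $$ (i, j) * fst \<omega> i) * (snd \<omega> j - (\<Sum>i<p. B' $$ (i, j) * fst \<omega> i)) =
      (\<Sum>i<p. U $$ (i, j) * fst \<omega> i) * (snd \<omega> j - (\<Sum>i<p. B $$ (i, j) * fst \<omega> i)) -
        (\<Sum>i<p. U $$ (i, j) * fst \<omega> i) * (\<Sum>i<p. (B' - B) $$ (i, j) * fst \<omega> i)"
      by (simp only: right_diff_distrib)
  qed simp
  ultimately show ?thesis unfolding residual_inner_product[OF assms] by (simp only: sum_subtractf)
qed

text \<open>The deterministic core: with few contaminated indices \<open>S\<close>, \<open>B\<close> has depth close to \<open>1/2\<close>, whereas a matrix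
  far from \<open>B\<close> has visibly smaller depth, witnessed by the direction \<open>Bhat - B\<close>.\<close>

lemma depth_maximizer_close:
  assumes Bh: "Bh \<in> low_rank_set p m r"
    and max: "emp_depth p m n (low_rank_set p m (2 * r)) B \<omega> \<le> emp_depth p m n (low_rank_set p m (2 * r)) Bh \<omega>"
    and S: "S \<subseteq> {..<n}" "real (card S) \<le> 5 * (real n * \<eta>)" and \<eta>: "0 < \<eta>" "2000000 * \<eta> \<le> 1"
    and range: "\<And>i. i \<in> {..<n} - S \<Longrightarrow> in_range (\<omega> i)"
    and half: "few_positive (2 * r) \<eta> 0 S \<omega>" and shifted: "few_positive (2 * r) \<eta> (2000000 * \<eta>) S \<omega>"
  shows "fro2 p m (image_mat (Bh - B)) \<le> (\<sigma> * (2000000 * \<eta>))\<^sup>2"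
proof (rule ccontr)
  let ?\<L> = "low_rank_set p m (2 * r)" and ?I = "{..<n} - S" and ?s = "2000000 * \<eta>"
  let ?term = "\<lambda>U B' i. scalar_prod (transpose_mat U *\<^sub>v Matrix.vec p (fst (\<omega> i)))
      (Matrix.vec m (snd (\<omega> i)) - transpose_mat B' *\<^sub>v Matrix.vec p (fst (\<omega> i)))"
  assume far: "\<not> fro2 p m (image_mat (Bh - B)) \<le> (\<sigma> * ?s)\<^sup>2"
  have cBh: "Bh \<in> carrier_mat p m" using Bh by (simp add: low_rank_set_def)
  have nc: "real (card ?I) = real n - real (card S)"
    using S(1) by (subst card_Diff_subset) (auto intro: finite_subset simp: of_nat_diff card_mono[of "{..<n}", simplified])
  \<comment> \<open>At most 5 n \<eta> indices are lost, so at least half survive.\<close>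
  have ncn: "real n / 2 \<le> real (card ?I)"
  proof -
    have "real n * (10 * \<eta>) \<le> real n * 1" using \<eta> by (intro mult_left_mono) auto
    then show ?thesis using nc S(2) by simp
  qed
  \<comment> \<open>scaling a direction: on \<open>in_range\<close> observations, the value does not depend on the chosen preimage\<close>
  have forms: "gform p m (preim (\<lambda>a b. c * image_mat U a b)) (fst (\<omega> i)) w = c * gform p m (\<lambda>a b. U $$ (a, b)) (fst (\<omega> i)) w \<and>
      qform p m (preim (\<lambda>a b. c * image_mat U a b)) (fst (\<omega> i)) = c\<^sup>2 * qform p m (\<lambda>a b. U $$ (a, b)) (fst (\<omega> i))"
    if U: "U \<in> ?\<L>" and i: "i \<in> ?I" for U c w i
  proof -
    let ?V = "\<lambda>a b. c * image_mat U a b"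
    have V: "lowclass root p m (2 * r) ?V" using U by (intro lowclass_image_mat) (simp_all add: low_rank_set_def)
    obtain z where z: "\<forall>U V. (\<forall>i<p. \<forall>j<m. V i j = (\<Sum>h<p. root i h * U h j)) \<longrightarrow>
        (\<forall>w. gform p m U (fst (\<omega> i)) w = gform p m V z w) \<and> qform p m U (fst (\<omega> i)) = qform p m V z"
      using in_range_forms[OF range[OF i]] by (elim exE)
    have 1: "\<forall>i<p. \<forall>j<m. ?V i j = (\<Sum>h<p. root i h * preim ?V h j)" using preim[OF V] by (intro allI impI)
    have 2: "\<forall>i<p. \<forall>j<m. image_mat U i j = (\<Sum>h<p. root i h * (\<lambda>a b. U $$ (a, b)) h j)" by (simp add: image_mat_def)
    have a: "gform p m (preim ?V) (fst (\<omega> i)) w = gform p m ?V z w" "qform p m (preim ?V) (fst (\<omega> i)) = qform p m ?V z"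
      using z[THEN spec, THEN spec, THEN mp, OF 1] by simp_all
    have b: "gform p m (\<lambda>a b. U $$ (a, b)) (fst (\<omega> i)) w = gform p m (image_mat U) z w"
        "qform p m (\<lambda>a b. U $$ (a, b)) (fst (\<omega> i)) = qform p m (image_mat U) z"
      using z[THEN spec, THEN spec, THEN mp, OF 2] by simp_all
    show ?thesis unfolding a b gform_scale qform_scale by simp
  qed
  have unit: "lowclass root p m (2 * r) (\<lambda>a b. c * image_mat U a b) \<and> fro2 p m (\<lambda>a b. c * image_mat U a b) = 1"
    if U: "U \<in> ?\<L>" and c: "c\<^sup>2 * fro2 p m (image_mat U) = 1" for U c
    using U c by (simp add: lowclass_image_mat low_rank_set_def fro2_scale)
  have lower: "(real (card ?I) / 2 - 10000 * (real n * \<eta>)) / real n \<le> emp_depth p m n ?\<L> B \<omega>"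
  proof (rule emp_depth_ge)
    have "B \<in> ?\<L>" using B by (simp add: low_rank_set_def)
    then show "?\<L> \<noteq> {}" by blast
  next
    fix U assume U: "U \<in> ?\<L>"
    have cU: "U \<in> carrier_mat p m" using U by (simp add: low_rank_set_def)
    have BB: "(B - B) $$ (i, j) = 0" if "i < p" "j < m" for i j using B_carrier that by simp
    have tm: "?term U B i = \<sigma> * gform p m (\<lambda>i j. U $$ (i, j)) (fst (\<omega> i)) (obs_noise (\<omega> i))" for i
      unfolding residual_term[OF cU B_carrier] by (simp add: BB)
    \<comment> \<open>A lower bound on the number of nonnegative terms is an upper bound on the
      number of negative ones, which is what \<open>few_positive\<close> supplies.\<close>
    let ?N = "{i\<in>?I. ?term U B i < 0}"
    have N: "real (card ?N) \<le> real (card ?I) / 2 + 10000 * (real n * \<eta>)"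
    \<comment> \<open>A direction annihilated by the root cannot be normalised; its terms vanish at
      every retained observation, so none is negative.\<close>
    proof (cases "fro2 p m (image_mat U) = 0")
      case True
      have "?N = {}"
      proof -
        have "\<not> ?term U B i < 0" if i: "i \<in> ?I" for i
        proof -
          have im0: "image_mat U a b = 0" if "a < p" "b < m" for a b
          proof -
            have "(image_mat U a b)\<^sup>2 \<le> fro2 p m (image_mat U)" using that by (rule entry_square_le_fro2)
            then show ?thesis using True by simp
          qed
          obtain z where z: "\<forall>U V. (\<forall>i<p. \<forall>j<m. V i j = (\<Sum>h<p. root i h * U h j)) \<longrightarrow>
              (\<forall>w. gform p m U (fst (\<omega> i)) w = gform p m V z w) \<and> qform p m U (fst (\<omega> i)) = qform p m V z"
            using in_range_forms[OF range[OF i]] by (elim exE)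
          have 2: "\<forall>i<p. \<forall>j<m. (\<lambda>_ _. 0) i j = (\<Sum>h<p. root i h * (\<lambda>a b. U $$ (a, b)) h j)"
            using im0 by (simp add: image_mat_def)
          have "gform p m (\<lambda>a b. U $$ (a, b)) (fst (\<omega> i)) w = gform p m (\<lambda>_ _. 0) z w" for w
            using z[THEN spec, THEN spec, THEN mp, OF 2] by simp
          then show ?thesis unfolding tm by (simp add: gform_def)
        qed
        then show ?thesis by blast
      qed
      moreover have "0 \<le> real n * \<eta>" using \<eta> by simp
      ultimately show ?thesis by (simp only: card.empty of_nat_0)
    next
      case False
      \<comment> \<open>The negative sign turns negative terms for \<open>U\<close> into positive
        values for the normalised direction.\<close>
      define c where "c = - inverse (sqrt (fro2 p m (image_mat U)))"
      have pos: "0 < fro2 p m (image_mat U)" using False fro2_nonneg[of p m "image_mat U"] by linarith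
      then have c: "c < 0" "c\<^sup>2 * fro2 p m (image_mat U) = 1"
        by (simp_all add: c_def power_inverse real_sqrt_pow2)
      have "real (card ?N) = (\<Sum>i\<in>?I. of_bool (?term U B i < 0))"
        by (simp add: Int_def)
      also have "\<dots> \<le> (\<Sum>i\<in>?I. of_bool (0 \<le> gform p m (preim (\<lambda>a b. c * image_mat U a b)) (fst (\<omega> i)) (obs_noise (\<omega> i)) -
          0 * qform p m (preim (\<lambda>a b. c * image_mat U a b)) (fst (\<omega> i))))"
      proof (rule sum_mono)
        fix i assume i: "i \<in> ?I"
        show "of_bool (?term U B i < 0) \<le> (of_bool (0 \<le> gform p m (preim (\<lambda>a b. c * image_mat U a b)) (fst (\<omega> i)) (obs_noise (\<omega> i)) -
          0 * qform p m (preim (\<lambda>a b. c * image_mat U a b)) (fst (\<omega> i))) :: real)"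
          unfolding tm forms[OF U i, THEN conjunct1] using \<sigma> c(1)
          by (auto simp: mult_less_0_iff zero_le_mult_iff of_bool_def)
      qed
      also have "\<dots> \<le> real (card ?I) * (1 / 2 - 0 / 24) + 10000 * (real n * \<eta>)"
        using unit[OF U c(2)] by (intro half[unfolded few_positive_def, rule_format]) simp_all
      finally show ?thesis by simp
    qed
    have "?I - ?N \<subseteq> {i\<in>{..<n}. 0 \<le> ?term U B i}" by auto
    then have "card (?I - ?N) \<le> card {i\<in>{..<n}. 0 \<le> ?term U B i}" by (intro card_mono) auto
    moreover have "card (?I - ?N) = card ?I - card ?N" by (intro card_Diff_subset) auto
    moreover have "card ?N \<le> card ?I" by (intro card_mono) auto
    ultimately have "real (card ?I) - real (card ?N) \<le> real (card {i\<in>{..<n}. 0 \<le> ?term U B i})" by linarith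
    then have "real (card ?I) / 2 - 10000 * (real n * \<eta>) \<le> real (card {i\<in>{..<n}. 0 \<le> ?term U B i})" using N by linarith
    then show "(real (card ?I) / 2 - 10000 * (real n * \<eta>)) / real n \<le> real (card {i\<in>{..<n}. 0 \<le> ?term U B i}) / real n"
      by (rule divide_right_mono) simp
  qed
  define \<Delta> where "\<Delta> = Bh - B"
  have pos: "(\<sigma> * ?s)\<^sup>2 < fro2 p m (image_mat \<Delta>)" using far by (simp add: \<Delta>_def)
  have cD: "\<Delta> \<in> carrier_mat p m" unfolding \<Delta>_def by (rule minus_carrier_mat[OF B_carrier])
  have "\<Delta> \<noteq> 0\<^sub>m p m"
  proof
    assume "\<Delta> = 0\<^sub>m p m"
    then have "fro2 p m (image_mat \<Delta>) = 0" by (simp add: image_mat_def fro2_def)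
    then show False using pos zero_le_power2[of "\<sigma> * ?s"] by linarith
  qed
  \<comment> \<open>The witness is a difference of two matrices of rank at most r, which is why
    depth is taken over rank 2r.\<close>
  moreover have "mrank \<Delta> \<le> 2 * r"
    unfolding \<Delta>_def using Bh B by (intro mrank_diff_le[of _ p m]) (simp_all add: low_rank_set_def)
  ultimately have DL: "\<Delta> \<in> ?\<L>" using cD by (simp add: low_rank_set_def)
  define t where "t = sqrt (fro2 p m (image_mat \<Delta>))"
  have st: "\<sigma> * ?s < t" unfolding t_def using pos by (rule real_less_rsqrt)
  have ss: "0 < \<sigma> * ?s" using \<sigma> \<eta> by simp
  then have t: "0 < t" using st by linarith
  have t2: "(inverse t)\<^sup>2 * fro2 p m (image_mat \<Delta>) = 1"
  proof -
    have *: "fro2 p m (image_mat \<Delta>) = t\<^sup>2" unfolding t_def by (simp add: fro2_nonneg)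
    show ?thesis unfolding * using t by (simp add: power_inverse)
  qed
  have tm: "?term \<Delta> Bh i = \<sigma> * gform p m (\<lambda>i j. \<Delta> $$ (i, j)) (fst (\<omega> i)) (obs_noise (\<omega> i)) - qform p m (\<lambda>i j. \<Delta> $$ (i, j)) (fst (\<omega> i))" for i
    unfolding residual_term[OF cD cBh] \<Delta>_def[symmetric] by (simp add: qform_def power2_eq_square)
  let ?V = "\<lambda>a b. inverse t * image_mat \<Delta> a b"
  have "{i\<in>{..<n}. 0 \<le> ?term \<Delta> Bh i} \<subseteq> S \<union> {i\<in>?I. 0 \<le> ?term \<Delta> Bh i}" by auto
  then have "card {i\<in>{..<n}. 0 \<le> ?term \<Delta> Bh i} \<le> card (S \<union> {i\<in>?I. 0 \<le> ?term \<Delta> Bh i})"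
    using S(1) by (intro card_mono) (auto intro: finite_subset)
  also have "\<dots> \<le> card S + card {i\<in>?I. 0 \<le> ?term \<Delta> Bh i}" by (rule card_Un_le)
  finally have "real (card {i\<in>{..<n}. 0 \<le> ?term \<Delta> Bh i}) \<le> real (card S) + real (card {i\<in>?I. 0 \<le> ?term \<Delta> Bh i})" by linarith
  also have "real (card {i\<in>?I. 0 \<le> ?term \<Delta> Bh i}) = (\<Sum>i\<in>?I. of_bool (0 \<le> ?term \<Delta> Bh i))"
    by (simp add: Int_def)
  also have "\<dots> \<le> (\<Sum>i\<in>?I. of_bool (0 \<le> gform p m (preim ?V) (fst (\<omega> i)) (obs_noise (\<omega> i)) - ?s * qform p m (preim ?V) (fst (\<omega> i))))"
  proof (rule sum_mono)
    fix i assume i: "i \<in> ?I"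
    let ?g = "gform p m (\<lambda>i j. \<Delta> $$ (i, j)) (fst (\<omega> i)) (obs_noise (\<omega> i))" and ?q = "qform p m (\<lambda>i j. \<Delta> $$ (i, j)) (fst (\<omega> i))"
    \<comment> \<open>Monotonicity in the shift: as \<open>\<sigma> * ?s < t\<close>, a nonnegative
      term for \<open>\<Delta>\<close> implies the halfspace event at the fixed shift
      \<open>?s\<close> for the normalised direction.\<close>
    have "0 \<le> inverse t * ?g - ?s * ((inverse t)\<^sup>2 * ?q)" if "0 \<le> \<sigma> * ?g - ?q"
    proof -
      have "\<sigma> * ?s * ?q \<le> t * ?q" using st by (intro mult_right_mono qform_nonneg) simp
      also have "\<dots> \<le> t * (\<sigma> * ?g)" using that t by (intro mult_left_mono) auto
      finally have "\<sigma> * (?s * ?q) \<le> \<sigma> * (t * ?g)" by (simp add: mult_ac)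
      then have "?s * ?q \<le> t * ?g" using \<sigma> by simp
      then have "(inverse t)\<^sup>2 * (?s * ?q) \<le> (inverse t)\<^sup>2 * (t * ?g)" by (rule mult_left_mono) simp
      also have "(inverse t)\<^sup>2 * (t * ?g) = inverse t * ?g" using t by (simp add: power2_eq_square)
      finally show ?thesis by (simp add: mult_ac)
    qed
    then show "of_bool (0 \<le> ?term \<Delta> Bh i) \<le> (of_bool (0 \<le> gform p m (preim ?V) (fst (\<omega> i)) (obs_noise (\<omega> i)) - ?s * qform p m (preim ?V) (fst (\<omega> i))) :: real)"
      unfolding tm forms[OF DL i, THEN conjunct1] forms[OF DL i, THEN conjunct2] by (simp add: of_bool_def)
  qed
  also have "\<dots> \<le> real (card ?I) * (1 / 2 - ?s / 24) + 10000 * (real n * \<eta>)"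
    using unit[OF DL t2] by (intro shifted[unfolded few_positive_def, rule_format]) simp_all
  finally have up: "real (card {i\<in>{..<n}. 0 \<le> ?term \<Delta> Bh i}) \<le> real (card S) + (real (card ?I) * (1 / 2 - ?s / 24) + 10000 * (real n * \<eta>))"
    by simp
  have "(real (card ?I) / 2 - 10000 * (real n * \<eta>)) / real n \<le> real (card {i\<in>{..<n}. 0 \<le> ?term \<Delta> Bh i}) / real n"
    using lower max emp_depth_le[OF DL, of p m n Bh \<omega>] by linarith
  then have "real (card ?I) / 2 - 10000 * (real n * \<eta>) \<le> real (card {i\<in>{..<n}. 0 \<le> ?term \<Delta> Bh i})"
    using n by (simp add: divide_le_cancel)
  then have "real (card ?I) / 2 - 10000 * (real n * \<eta>) \<le> real (card S) + (real (card ?I) * (1 / 2 - ?s / 24) + 10000 * (real n * \<eta>))"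
    using up by linarith
  moreover have "real (card ?I) * (1 / 2 - ?s / 24) = real (card ?I) / 2 - real (card ?I) * (?s / 24)"
    by (simp only: right_diff_distrib mult_1_right times_divide_eq_right)
  ultimately have "real (card ?I) * (?s / 24) \<le> real (card S) + 20000 * (real n * \<eta>)" by linarith
  moreover have "real n / 2 * (?s / 24) \<le> real (card ?I) * (?s / 24)" using ncn \<eta> by (intro mult_right_mono) auto
  moreover have "real n / 2 * (?s / 24) = (2000000 / 48) * (real n * \<eta>)" by simp
  \<comment> \<open>The shift is chosen for this comparison: 2000000/48 exceeds 20005, made of two
    uniform errors of 10000 and 5 for the contaminated indices.\<close>
  ultimately have "(2000000 / 48) * (real n * \<eta>) \<le> 20005 * (real n * \<eta>)" using S(2) by linarith
  moreover have "0 < real n * \<eta>" using n \<eta> by simp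
  ultimately show False by linarith
qed

end

theorem theorem9:
  "\<exists>c0>0. \<exists>C>0. \<exists>C'>0.
   \<forall>(p::nat) (m::nat) (r::nat) (n::nat) (\<sigma>::real) (Sig::real mat) (\<epsilon>::real) (B::real mat)
     (Q::((nat \<Rightarrow> real) \<times> (nat \<Rightarrow> real)) measure)
     (Bhat::(nat \<Rightarrow> (nat \<Rightarrow> real) \<times> (nat \<Rightarrow> real)) \<Rightarrow> real mat).
     1 \<le> p \<longrightarrow> 1 \<le> m \<longrightarrow> 1 \<le> r \<longrightarrow> 1 \<le> n \<longrightarrow> 0 < \<sigma> \<longrightarrow>
     psd_mat p Sig \<longrightarrow> 0 \<le> \<epsilon> \<longrightarrow> \<epsilon> < 1 \<longrightarrow>
     B \<in> low_rank_set p m r \<longrightarrow>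
     prob_space Q \<longrightarrow> sets Q = sets (pt_space p m) \<longrightarrow>
     (\<forall>\<omega>. Bhat \<omega> \<in> low_rank_set p m r \<and>
         (\<forall>B'\<in>low_rank_set p m r.
            emp_depth p m n (low_rank_set p m (2*r)) B' \<omega>
              \<le> emp_depth p m n (low_rank_set p m (2*r)) (Bhat \<omega>) \<omega>)) \<longrightarrow>
     \<epsilon>\<^sup>2 + real r * real (p + m) / real n \<le> c0 \<longrightarrow>
     (\<exists>E\<in>sets (PiM {..<n} (\<lambda>_. contam \<epsilon> (model_law p m Sig \<sigma> B) Q)).
        measure (PiM {..<n} (\<lambda>_. contam \<epsilon> (model_law p m Sig \<sigma> B) Q)) E
          \<ge> 1 - exp (- C' * (real r * real (p + m) + real n * \<epsilon>\<^sup>2)) \<and>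
        (\<forall>\<omega>\<in>E.
           mtrace (transpose_mat (Bhat \<omega> - B) * Sig * (Bhat \<omega> - B))
             \<le> C * \<sigma>\<^sup>2 * max (real r * real (p + m) / real n) (\<epsilon>\<^sup>2) \<and>
           (kappa Sig)\<^sup>2 * (fro_norm (Bhat \<omega> - B))\<^sup>2
             \<le> C * \<sigma>\<^sup>2 * max (real r * real (p + m) / real n) (\<epsilon>\<^sup>2) \<and>
           (kappa Sig)\<^sup>2 * (nuc_norm (Bhat \<omega> - B))\<^sup>2
             \<le> C * \<sigma>\<^sup>2 * max ((real r)\<^sup>2 * real (p + m) / real n) (real r * \<epsilon>\<^sup>2)))"
proof (rule exI[of _ "1 / 4000000000000"], rule conjI, simp, rule exI[of _ "16000000000000"], rule conjI, simp,
    rule exI[of _ "1 / 2"], rule conjI, simp, intro allI impI)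
  fix p m r n :: nat and \<sigma> \<epsilon> :: real and Sig B :: "real mat"
    and Q :: "((nat \<Rightarrow> real) \<times> (nat \<Rightarrow> real)) measure"
    and Bhat :: "(nat \<Rightarrow> (nat \<Rightarrow> real) \<times> (nat \<Rightarrow> real)) \<Rightarrow> real mat"
  assume p: "1 \<le> p" and m: "1 \<le> m" and r: "1 \<le> r" and n: "1 \<le> n" and \<sigma>: "0 < \<sigma>"
    and Sig: "psd_mat p Sig" and e0: "0 \<le> \<epsilon>" and e1: "\<epsilon> < 1" and B: "B \<in> low_rank_set p m r"
    and Q: "prob_space Q" "sets Q = sets (pt_space p m)"
    and Bhat: "\<forall>\<omega>. Bhat \<omega> \<in> low_rank_set p m r \<and>
         (\<forall>B'\<in>low_rank_set p m r.
            emp_depth p m n (low_rank_set p m (2*r)) B' \<omega>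
              \<le> emp_depth p m n (low_rank_set p m (2*r)) (Bhat \<omega>) \<omega>)"
    and c0: "\<epsilon>\<^sup>2 + real r * real (p + m) / real n \<le> 1 / 4000000000000"
  note ctx = p m r n \<sigma> Sig B
  let ?P = "model_law p m Sig \<sigma> B"
  \<comment> \<open>\<open>D\<close> is n times the squared target rate and at the same time the
    exponent in the failure probability.\<close>
  define D where "D = real r * real (p + m) + real n * \<epsilon>\<^sup>2"
  define \<eta> where "\<eta> = sqrt (D / n)"
  have \<eta>2: "\<eta>\<^sup>2 = real r * real (p + m) / real n + \<epsilon>\<^sup>2"
    using n by (simp add: \<eta>_def D_def add_divide_distrib)
  have D2: "2 \<le> D"
  proof -
    have "1 * 2 \<le> real r * real (p + m)" using p m r by (intro mult_mono) auto
    moreover have "0 \<le> real n * \<epsilon>\<^sup>2" by simp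
    ultimately show ?thesis unfolding D_def by linarith
  qed
  have \<eta>0: "0 < \<eta>" using D2 n by (simp add: \<eta>_def)
  \<comment> \<open>\<open>c0\<close> is the inverse square of 2000000, so that the shift is at most
    1, as \<open>half_space_prob\<close> requires.\<close>
  have \<eta>1: "2000000 * \<eta> \<le> 1"
  proof -
    have "\<eta>\<^sup>2 \<le> 1 / 4000000000000" unfolding \<eta>2 using c0 by linarith
    then have "(2000000 * \<eta>)\<^sup>2 \<le> 1\<^sup>2" by (simp add: power_mult_distrib)
    then show ?thesis by (rule power2_le_imp_le) simp
  qed
  have nD: "real n * \<eta>\<^sup>2 = D" using n D2 by (simp add: \<eta>_def)
  have eps: "\<epsilon> \<le> \<eta>" by (rule power2_le_imp_le) (use \<eta>2 \<eta>0 in simp_all)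
  have kD: "real (2 * r * (p + m)) \<le> 2 * D" unfolding D_def by simp
  have P: "prob_space ?P"
    using prob_space.prob_space_distr[OF prob_space_gauss2 sample_measurable[OF ctx]] model_law_eq[OF ctx] by simp
  have PQ: "sets Q = sets ?P" using Q(2) sets_model_law[OF ctx] by simp
  have hyps: "1 \<le> D" "1 \<le> 2 * r" "\<eta> \<le> 1 / 2" "0 \<le> 2000000 * \<eta>" using D2 r \<eta>0 \<eta>1 by simp_all
  note E1 = model_halfspace[OF ctx hyps(1) kD hyps(2) \<eta>_def hyps(3), of 0, OF order_refl zero_le_one]
  note E2 = model_halfspace[OF ctx hyps(1) kD hyps(2) \<eta>_def hyps(3,4) \<eta>1]
  have "AE x in distr (gauss2 p m) (pt_space p m) (sample p m \<sigma> Sig B). in_range p Sig x"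
    using in_range_measurable[OF ctx] in_range_sample[OF ctx] unfolding model_law_eq[OF ctx]
    by (subst AE_distr_iff[OF sample_measurable[OF ctx]]) (auto simp: pred_def)
  then have "AE x in ?P. in_range p Sig x" unfolding model_law_eq[OF ctx] .
  from ensured_AE[OF P in_range_measurable[OF ctx] this exp_gt_zero]
  have E3: "ensured ?P n (exp (- 2 * D)) (\<lambda>S \<omega>. \<forall>i\<in>{..<n} - S. in_range p Sig (\<omega> i))" .
  \<comment> \<open>The label count is tested at rate \<eta> with budget n (\<epsilon> + 4 \<eta>):
    the exponent is then \<epsilon> D - 4 D, below -2 D.\<close>
  have l: "0 < \<eta>" "\<eta> \<le> 1" using \<eta>0 \<eta>1 by simp_all
  obtain E where E: "E \<in> sets (PiM {..<n} (\<lambda>_. contam \<epsilon> ?P Q))"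
    and meas: "measure (PiM {..<n} (\<lambda>_. contam \<epsilon> ?P Q)) E \<ge> 1 - (5 * exp (- 2 * D) + (5 * exp (- 2 * D) + exp (- 2 * D)) +
      exp (real n * (\<epsilon> * (\<eta> + \<eta>\<^sup>2)) - \<eta> * (real n * (\<epsilon> + 4 * \<eta>))))"
    and good: "\<forall>\<omega>\<in>E. \<exists>S\<subseteq>{..<n}. real (card S) \<le> real n * (\<epsilon> + 4 * \<eta>) \<and>
      few_positive p m n \<sigma> Sig B (2 * r) \<eta> 0 S \<omega> \<and> few_positive p m n \<sigma> Sig B (2 * r) \<eta> (2000000 * \<eta>) S \<omega> \<and>
      (\<forall>i\<in>{..<n} - S. in_range p Sig (\<omega> i))"
    using ensured_contam[OF P Q(1) PQ e0 e1 l ensured_conj[OF E1 ensured_conj[OF E2 E3]], of "real n * (\<epsilon> + 4 * \<eta>)"]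
    by (elim bexE conjE)
  show "\<exists>E\<in>sets (PiM {..<n} (\<lambda>_. contam \<epsilon> ?P Q)).
        measure (PiM {..<n} (\<lambda>_. contam \<epsilon> ?P Q)) E
          \<ge> 1 - exp (- (1 / 2) * (real r * real (p + m) + real n * \<epsilon>\<^sup>2)) \<and>
        (\<forall>\<omega>\<in>E.
           mtrace (transpose_mat (Bhat \<omega> - B) * Sig * (Bhat \<omega> - B))
             \<le> 16000000000000 * \<sigma>\<^sup>2 * max (real r * real (p + m) / real n) (\<epsilon>\<^sup>2) \<and>
           (kappa Sig)\<^sup>2 * (fro_norm (Bhat \<omega> - B))\<^sup>2
             \<le> 16000000000000 * \<sigma>\<^sup>2 * max (real r * real (p + m) / real n) (\<epsilon>\<^sup>2) \<and>
           (kappa Sig)\<^sup>2 * (nuc_norm (Bhat \<omega> - B))\<^sup>2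
             \<le> 16000000000000 * \<sigma>\<^sup>2 * max ((real r)\<^sup>2 * real (p + m) / real n) (real r * \<epsilon>\<^sup>2))"
  proof (rule bexI[OF _ E], rule conjI, goal_cases prob bounds)
    case prob
    have "real n * (\<epsilon> * (\<eta> + \<eta>\<^sup>2)) - \<eta> * (real n * (\<epsilon> + 4 * \<eta>)) = \<epsilon> * D - 4 * D"
      unfolding nD[symmetric] by (simp add: algebra_simps power2_eq_square)
    also have "\<dots> \<le> - 2 * D" using e1 D2 mult_right_mono[of \<epsilon> 1 D] by simp
    finally have "exp (real n * (\<epsilon> * (\<eta> + \<eta>\<^sup>2)) - \<eta> * (real n * (\<epsilon> + 4 * \<eta>))) \<le> exp (- 2 * D)" by (simp only: exp_le_cancel_iff)
    \<comment> \<open>The 12 collects 5 + 5 + 1 from the tests and 1 from the labels;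
      \<open>2 \<le> D\<close> pays for it by giving up three quarters of the exponent, hence
      \<open>C' = 1 / 2\<close>.\<close>
    moreover have "12 * exp (- 2 * D) \<le> exp (- (1 / 2) * D)"
    proof -
      have "1 + 1 + 1\<^sup>2 / 2 \<le> exp (1::real)" by (rule exp_lower_Taylor_quadratic) simp
      then have "(5 / 2) ^ 3 \<le> exp (1::real) ^ 3" by (intro power_mono) auto
      also have "exp (1::real) ^ 3 = exp 3" by (simp add: exp_of_nat_mult[symmetric])
      also have "exp 3 \<le> exp (3 / 2 * D)" using D2 by simp
      finally have "12 \<le> exp (3 / 2 * D)" by (simp add: power3_eq_cube)
      then have "12 * exp (- 2 * D) \<le> exp (3 / 2 * D) * exp (- 2 * D)" by (rule mult_right_mono) simp
      also have "\<dots> = exp (- (1 / 2) * D)" by (simp add: mult_exp_exp)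
      finally show ?thesis .
    qed
    ultimately show "measure (PiM {..<n} (\<lambda>_. contam \<epsilon> ?P Q)) E
          \<ge> 1 - exp (- (1 / 2) * (real r * real (p + m) + real n * \<epsilon>\<^sup>2))"
      using meas unfolding D_def[symmetric] by linarith
  next
    case bounds
    show ?case
    proof (rule ballI)
      fix \<omega> assume "\<omega> \<in> E"
      from bspec[OF good this] obtain S where S: "S \<subseteq> {..<n}" "real (card S) \<le> real n * (\<epsilon> + 4 * \<eta>)"
        and h1: "few_positive p m n \<sigma> Sig B (2 * r) \<eta> 0 S \<omega>" and h2: "few_positive p m n \<sigma> Sig B (2 * r) \<eta> (2000000 * \<eta>) S \<omega>"
        and h3: "\<forall>i\<in>{..<n} - S. in_range p Sig (\<omega> i)"
        by (elim exE conjE)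
      have S5: "real (card S) \<le> 5 * (real n * \<eta>)"
      proof -
        have "real n * (\<epsilon> + 4 * \<eta>) \<le> real n * (5 * \<eta>)" using eps by (intro mult_left_mono) auto
        then show ?thesis using S(2) by simp
      qed
      let ?\<Delta> = "Bhat \<omega> - B" and ?M = "max (real r * real (p + m) / real n) (\<epsilon>\<^sup>2)"
      have Bh: "Bhat \<omega> \<in> low_rank_set p m r" using Bhat by simp
      have close: "fro2 p m (image_mat p Sig ?\<Delta>) \<le> (\<sigma> * (2000000 * \<eta>))\<^sup>2"
      proof (rule depth_maximizer_close[OF ctx Bh _ S(1) S5 \<eta>0 \<eta>1])
        show "emp_depth p m n (low_rank_set p m (2 * r)) B \<omega> \<le> emp_depth p m n (low_rank_set p m (2 * r)) (Bhat \<omega>) \<omega>"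
          by (rule bspec[OF conjunct2[OF spec[OF Bhat]] B])
      qed (rule h1 h2 h3[rule_format]; assumption?)+
      \<comment> \<open>A sum is at most twice the maximum, so twice the square of 2000000 appears
        here. The other factor 2 in \<open>C\<close> is reserved for the rank 2r in the nuclear norm
        bound.\<close>
      have "real r * real (p + m) / real n + \<epsilon>\<^sup>2 \<le> ?M + ?M"
        by (rule add_mono[OF max.cobounded1 max.cobounded2])
      then have \<eta>M: "\<eta>\<^sup>2 \<le> 2 * ?M" unfolding \<eta>2 by (simp only: mult_2)
      have "(\<sigma> * (2000000 * \<eta>))\<^sup>2 = 4000000000000 * \<sigma>\<^sup>2 * \<eta>\<^sup>2" by (simp add: power_mult_distrib)
      also have "\<dots> \<le> 4000000000000 * \<sigma>\<^sup>2 * (2 * ?M)" using \<eta>M by (rule mult_left_mono) simp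
      also have "4000000000000 * a * (2 * b) = 8000000000000 * a * b" for a b :: real by simp
      finally have bound: "fro2 p m (image_mat p Sig ?\<Delta>) \<le> 8000000000000 * \<sigma>\<^sup>2 * ?M" using close by (rule order_trans[rotated])
      have "0 \<le> ?M" by (rule order_trans[OF zero_le_power2 max.cobounded2])
      then have "8000000000000 * (\<sigma>\<^sup>2 * ?M) \<le> 16000000000000 * (\<sigma>\<^sup>2 * ?M)" by (intro mult_right_mono) simp_all
      then have M0: "8000000000000 * \<sigma>\<^sup>2 * ?M \<le> 16000000000000 * \<sigma>\<^sup>2 * ?M" by (simp only: mult.assoc)
      have cD: "?\<Delta> \<in> carrier_mat p m" by (rule minus_carrier_mat[OF B_carrier[OF ctx]])
      have im: "(\<lambda>i j. \<Sum>h<p. psd_sqrt Sig $$ (i, h) * ?\<Delta> $$ (h, j)) = image_mat p Sig ?\<Delta>"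
        by (simp add: fun_eq_iff image_mat_def[OF ctx] root_def[OF ctx])
      have "mtrace (transpose_mat ?\<Delta> * Sig * ?\<Delta>) = fro2 p m (image_mat p Sig ?\<Delta>)"
        unfolding mtrace_eq_fro2[OF Sig cD] im ..
      then have tr: "mtrace (transpose_mat ?\<Delta> * Sig * ?\<Delta>) \<le> 16000000000000 * \<sigma>\<^sup>2 * ?M" using order_trans[OF bound M0] by simp
      have kf: "(kappa Sig)\<^sup>2 * (fro_norm ?\<Delta>)\<^sup>2 \<le> 8000000000000 * \<sigma>\<^sup>2 * ?M"
        using kappa_le[OF Sig p cD] bound unfolding im by linarith
      then have fr: "(kappa Sig)\<^sup>2 * (fro_norm ?\<Delta>)\<^sup>2 \<le> 16000000000000 * \<sigma>\<^sup>2 * ?M" by (rule order_trans[OF _ M0])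
      have "mrank ?\<Delta> \<le> 2 * r" using Bh B by (intro mrank_diff_le[of _ p m]) (simp_all add: low_rank_set_def)
      from mrank_factor[OF cD this] obtain C' D' where CD: "\<forall>i<p. \<forall>j<m. ?\<Delta> $$ (i, j) = (\<Sum>h<2 * r. C' i h * D' h j)" by (elim exE)
      have "(nuc_norm ?\<Delta>)\<^sup>2 \<le> real (2 * r) * (fro_norm ?\<Delta>)\<^sup>2"
        by (rule nuc_norm_le[OF cD, where k = "2 * r" and C = C' and D = D']) (rule CD[rule_format])
      then have "(kappa Sig)\<^sup>2 * (nuc_norm ?\<Delta>)\<^sup>2 \<le> (kappa Sig)\<^sup>2 * (real (2 * r) * (fro_norm ?\<Delta>)\<^sup>2)" by (rule mult_left_mono) simp
      also have "\<dots> = real (2 * r) * ((kappa Sig)\<^sup>2 * (fro_norm ?\<Delta>)\<^sup>2)" by (simp add: mult_ac)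
      also have "\<dots> \<le> real (2 * r) * (8000000000000 * \<sigma>\<^sup>2 * ?M)" using kf by (rule mult_left_mono) simp
      also have "\<dots> = 16000000000000 * \<sigma>\<^sup>2 * (real r * ?M)" by simp
      also have "real r * ?M = max ((real r)\<^sup>2 * real (p + m) / real n) (real r * \<epsilon>\<^sup>2)"
        using max_mult_distrib_left[of "real r" "real r * real (p + m) / real n" "\<epsilon>\<^sup>2"] by (simp add: power2_eq_square mult.assoc)
      finally have nu: "(kappa Sig)\<^sup>2 * (nuc_norm ?\<Delta>)\<^sup>2 \<le> 16000000000000 * \<sigma>\<^sup>2 * max ((real r)\<^sup>2 * real (p + m) / real n) (real r * \<epsilon>\<^sup>2)" .
      show "mtrace (transpose_mat ?\<Delta> * Sig * ?\<Delta>) \<le> 16000000000000 * \<sigma>\<^sup>2 * ?M \<and>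
          (kappa Sig)\<^sup>2 * (fro_norm ?\<Delta>)\<^sup>2 \<le> 16000000000000 * \<sigma>\<^sup>2 * ?M \<and>
          (kappa Sig)\<^sup>2 * (nuc_norm ?\<Delta>)\<^sup>2 \<le> 16000000000000 * \<sigma>\<^sup>2 * max ((real r)\<^sup>2 * real (p + m) / real n) (real r * \<epsilon>\<^sup>2)"
        by (rule conjI[OF tr conjI[OF fr nu]])
    qed
  qed
qed

end
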